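(* Let $b$ be a non-extreme function in $H^\infty_1$ with $\|b\|_{H^\infty}=1$, let $a$ be its Pythagorean mate, let $\zeta_1,\ldots,\zeta_N\in\mathbb{T}$ be distinct points and let $\mu=\sum_{j=1}^N\delta_{\zeta_j}$. The following are equivalent: (A) $\mathcal{D}_\mu\subseteq H(b)$ (equivalently, the embedding $\mathcal{D}_\mu\hookrightarrow H(b)$ holds); (B) there exists a holomorphic function $g$ on $\mathbb{D}$ with $\inf_{\mathbb{D}}|g|>0$ such that $a(z)=\Big(\prod_{j=1}^N(z-\zeta_j)\Big)g(z)$ for all $z\in\mathbb{D}$; (C) $\inf_{z\in\mathbb{D}}|a(z)|^2V_\mu(z)>0$.
   Context: $\mathbb{D}$ is the open unit disk, $\mathbb{T}$ the unit circle, $m$ the normalized Lebesgue measure on $\mathbb{T}$. $H^2$ is the Hardy space, $H^\infty$ the bounded analytic functions on $\mathbb{D}$, $H^\infty_1$ its closed unit ball. A function $b\in H^\infty_1$ is non-extreme if $\int_{\mathbb{T}}\log(1-|b|)\,dm>-\infty$; then there is a unique outer function $a$ with $a(0)>0$ and $|a|^2+|b|^2=1$ $m$-a.e. on $\mathbb{T}$, called the Pythagorean mate of $b$. The de Branges–Rovnyak space $H(b)$ is $\operatorname{Ran}(I-T_bT_b^* )^{1/2}$ with the range norm, where $T_b f=bf$ on $H^2$; equivalently the reproducing kernel Hilbert space with kernel $k^b_w(z)=\frac{1-\overline{b(w)}b(z)}{1-\overline{w}z}$. For a finite positive Borel measure $\mu$ on $\mathbb{T}$, $\mathcal{D}_\mu=\{f\in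 H^2: \int_{\mathbb{D}}|f'(z)|^2P_\mu(z)\,dA(z)<\infty\}$, where $P_\mu$ is the Poisson integral of $\mu$ and $dA$ area measure, normed by $\|f\|^2_{H^2}+\int_{\mathbb{D}}|f'|^2P_\mu\,dA$. The potential of $\mu$ is $V_\mu(z)=\int_{\mathbb{T}}\frac{d\mu(\lambda)}{|\lambda-z|^2}$; for $\mu=\sum_j\delta_{\zeta_j}$, $V_\mu(z)=\sum_{j=1}^N|z-\zeta_j|^{-2}$. *)

theory Defs
  imports "HOL-Analysis.Analysis"
begin

text \<open>Functions on the unit disk are modelled as maps complex to complex,
  only their values on ball 0 1 matter. Points of the circle are cis t, t in [0, 2 pi];
  the normalized measure m corresponds to dt/(2 pi).\<close>

definition bdry :: "(complex \<Rightarrow> complex) \<Rightarrow> real \<Rightarrow> complex" where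
  "bdry f t = Lim (at_left 1) (\<lambda>r::real. f (complex_of_real r * cis t))"

definition H2 :: "(complex \<Rightarrow> complex) set" where
  "H2 = {f. f holomorphic_on ball 0 1 \<and>
          (\<exists>C. \<forall>r\<in>{0..<1}. integral {0..2*pi} (\<lambda>t. (cmod (f (complex_of_real r * cis t)))^2) \<le> C)}"

definition Hinf_ball :: "(complex \<Rightarrow> complex) set" where
  "Hinf_ball = {b. b holomorphic_on ball 0 1 \<and> (\<forall>z\<in>ball 0 1. cmod (b z) \<le> 1)}"

definition Hinf_norm :: "(complex \<Rightarrow> complex) \<Rightarrow> real" where
  "Hinf_norm b = (SUP z\<in>ball 0 1. cmod (b z))"

text \<open>Non-extreme: integral of log(1 - |b|) over the circle is finite
  (which forces |b| < 1 a.e. on the circle).\<close>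
definition non_extreme :: "(complex \<Rightarrow> complex) \<Rightarrow> bool" where
  "non_extreme b \<longleftrightarrow> b \<in> Hinf_ball \<and>
     (AE t in lborel. t \<in> {0..2*pi} \<longrightarrow> cmod (bdry b t) < 1) \<and>
     (\<lambda>t. ln (1 - cmod (bdry b t))) absolutely_integrable_on {0..2*pi}"

definition is_outer :: "(complex \<Rightarrow> complex) \<Rightarrow> bool" where
  "is_outer f \<longleftrightarrow> (\<exists>c k. cmod c = 1 \<and> k absolutely_integrable_on {0..2*pi} \<and>
     (\<forall>z\<in>ball 0 1. f z = c * exp (integral {0..2*pi}
        (\<lambda>t. (cis t + z) / (cis t - z) * complex_of_real (k t)) / complex_of_real (2*pi))))"

definition pythagorean_mate :: "(complex \<Rightarrow> complex) \<Rightarrow> (complex \<Rightarrow> complex) \<Rightarrow> bool" where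
  "pythagorean_mate b a \<longleftrightarrow> is_outer a \<and> a 0 \<in> \<real> \<and> Re (a 0) > 0 \<and>
     (AE t in lborel. t \<in> {0..2*pi} \<longrightarrow> (cmod (bdry a t))^2 + (cmod (bdry b t))^2 = 1)"

definition kb :: "(complex \<Rightarrow> complex) \<Rightarrow> complex \<Rightarrow> complex \<Rightarrow> complex" where
  "kb b w z = (1 - cnj (b w) * b z) / (1 - cnj w * z)"

text \<open>H(b) as the reproducing kernel Hilbert space with kernel kb b:
  f belongs to it iff f(z) conj f(w) is dominated by C times the kernel as positive kernels
  (Aronszajn), i.e. the functional sum c_i k_{w_i} |-> sum conj(c_i) f(w_i) is bounded.\<close>
definition deBR :: "(complex \<Rightarrow> complex) \<Rightarrow> (complex \<Rightarrow> complex) set" where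
  "deBR b = {f. \<exists>C. \<forall>(n::nat) (w::nat \<Rightarrow> complex) (c::nat \<Rightarrow> complex).
      (\<forall>i<n. w i \<in> ball 0 1) \<longrightarrow>
      (cmod (\<Sum>i<n. cnj (c i) * f (w i)))^2
        \<le> C * Re (\<Sum>i<n. \<Sum>j<n. cnj (c i) * c j * kb b (w j) (w i))}"

text \<open>Poisson integral of mu = sum of Dirac masses at the points of Z.\<close>
definition poisson_pts :: "complex set \<Rightarrow> complex \<Rightarrow> real" where
  "poisson_pts Z z = (\<Sum>\<zeta>\<in>Z. (1 - (cmod z)^2) / (cmod (\<zeta> - z))^2)"

definition potential_pts :: "complex set \<Rightarrow> complex \<Rightarrow> real" where
  "potential_pts Z z = (\<Sum>\<zeta>\<in>Z. 1 / (cmod (z - \<zeta>))^2)"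

definition Dmu :: "complex set \<Rightarrow> (complex \<Rightarrow> complex) set" where
  "Dmu Z = {f. f \<in> H2 \<and>
     (\<integral>\<^sup>+ z\<in>ball 0 1. ennreal ((cmod (deriv f z))^2 * poisson_pts Z z) \<partial>lborel) < \<infinity>}"

end

theory Submission
  imports Defs "HOL-Complex_Analysis.Complex_Analysis" "HOL-Real_Asymp.Real_Asymp"
begin

text \<open>Let \<open>p\<close> be the polynomial with zero set \<open>Z\<close>. All three conditions say that \<open>|p| \<le> K |a|\<close> on
  the disk for some \<open>K\<close>; for (B) and (C) this is elementary.

  If \<open>Dmu Z \<subseteq> deBR b\<close>, then \<open>p H2 \<subseteq> deBR b\<close>, and a gliding hump argument with normalized kernels gives
  \<open>|p|\<^sup>2 \<le> C (1 - |b|\<^sup>2)\<close> on the disk. On the circle the right-hand side is \<open>C |a|\<^sup>2\<close> by Fatou's theorem, and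
  since \<open>a\<close> is outer, the bound for \<open>p / a\<close> extends to the disk.

  Conversely, functions in \<open>Dmu Z\<close> have the form \<open>q + p h\<close> with a polynomial \<open>q\<close> and \<open>h \<in> H2\<close>: the area
  integral at \<open>\<zeta>\<close> is a weighted sum of the squared coefficients of \<open>f' / (1 - cnj \<zeta> z)\<close>, which are increments of
  averages of the coefficients of \<open>(f - \<gamma>) / (z - \<zeta>)\<close>. Now \<open>p h = a (p / a) h\<close> is in \<open>deBR b\<close> because \<open>a H2\<close> is, and
  polynomials are in \<open>deBR b\<close> because the range of the co-analytic Toeplitz operator with symbol \<open>cnj a\<close> is.\<close>

subsection \<open>Integration over the circle and the Poisson formula\<close>

text \<open>\<open>deBR b\<close> is given by kernel domination and \<open>Dmu Z\<close> by a finite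
  integral, so both are bare sets: the inclusion comes without a norm estimate, and boundedness has
  to be extracted from the membership of single functions. The gliding hump does this. In the other
  direction, membership in \<open>deBR b\<close> is tested on finite combinations F of Szego
  kernels, and the kernel form dominates the squared norm of a F. This one inequality serves both
  the products a h and the co-analytic images of monomials, by Cauchy-Schwarz. It is proved for
  functions continuous up to the circle and reached by dilation, which is why |a|^2 + |b|^2 <= 1 has
  to hold inside the disk. The mate, however, is tied to b only through \<open>bdry\<close>, a
  \<open>Lim\<close> that says nothing unless a radial limit exists; hence Fatou's theorem. The
  detour through the circle in the bound for p has the same source: inside the disk 1 - |b|^2
  dominates |a|^2 and may be much larger, so the estimate by 1 - |b|^2 becomes one by |a|^2 only on
  the boundary, and outerness has to carry it back inside.\<close>

definition circ :: "real measure" where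
  "circ = density lborel (\<lambda>t. ennreal (indicator {0..2*pi} t / (2*pi)))"

lemma sets_circ [simp, measurable_cong]: "sets circ = sets borel"
  by (simp add: circ_def)

lemma space_circ [simp]: "space circ = UNIV"
  by (simp add: circ_def)

lemma emeasure_circ_UNIV: "emeasure circ UNIV = 1"
proof -
  have "emeasure circ UNIV = (\<integral>\<^sup>+t. ennreal (1/(2*pi)) * indicator {0..2*pi} t \<partial>lborel)"
    unfolding circ_def
    by (subst emeasure_density) (auto intro!: nn_integral_cong split: split_indicator)
  also have "\<dots> = ennreal (1/(2*pi)) * ennreal (2*pi)"
    by (subst nn_integral_cmult_indicator) auto
  also have "\<dots> = 1"
    by (simp flip: ennreal_mult)
  finally show ?thesis .
qed

interpretation circ: finite_measure circ
  by (rule finite_measureI) (simp add: emeasure_circ_UNIV)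

lemma measure_circ_UNIV [simp]: "measure circ UNIV = 1"
  by (simp add: measure_def emeasure_circ_UNIV)

lemma AE_circ: "(AE t in circ. P t) \<longleftrightarrow> (AE t in lborel. t \<in> {0..2*pi} \<longrightarrow> P t)"
  unfolding circ_def by (subst AE_density) (auto intro!: AE_cong split: split_indicator)

lemma integrable_circ_iff:
  fixes f :: "real \<Rightarrow> 'a::{banach,second_countable_topology}"
  assumes "f \<in> borel_measurable borel"
  shows "integrable circ f \<longleftrightarrow> set_integrable lborel {0..2*pi} f"
proof -
  have "integrable circ f \<longleftrightarrow> integrable lborel (\<lambda>t. (1/(2*pi)) *\<^sub>R (indicator {0..2*pi} t *\<^sub>R f t))"
    unfolding circ_def using assms by (subst integrable_density) (auto simp: mult.commute)
  also have "\<dots> \<longleftrightarrow> set_integrable lborel {0..2*pi} f"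
    unfolding set_integrable_def
    using integrable_scaleR_right[of "2*pi" lborel "\<lambda>t. (1/(2*pi)) *\<^sub>R (indicator {0..2*pi} t *\<^sub>R f t)"]
      integrable_scaleR_right[of "1/(2*pi)" lborel "\<lambda>t. indicator {0..2*pi} t *\<^sub>R f t"]
    by auto
  finally show ?thesis .
qed

lemma integral_circ_set:
  fixes f :: "real \<Rightarrow> 'a::{banach,second_countable_topology}"
  assumes "f \<in> borel_measurable borel"
  shows "integral\<^sup>L circ f = (1/(2*pi)) *\<^sub>R (LINT t:{0..2*pi}|lborel. f t)"
proof -
  have eq: "(\<lambda>t. (indicator {0..2*pi} t / (2*pi)) *\<^sub>R f t) = (\<lambda>t. (1/(2*pi)) *\<^sub>R (indicator {0..2*pi} t *\<^sub>R f t))"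
    by (auto simp: fun_eq_iff)
  have "integral\<^sup>L circ f = integral\<^sup>L lborel (\<lambda>t. (indicator {0..2*pi} t / (2*pi)) *\<^sub>R f t)"
    unfolding circ_def using assms by (subst integral_density) auto
  then show ?thesis
    unfolding eq set_lebesgue_integral_def by (simp only: integral_scaleR_right)
qed

lemma integrable_circ_continuous:
  fixes f :: "real \<Rightarrow> 'a::{banach,second_countable_topology}"
  assumes "continuous_on UNIV f"
  shows "integrable circ f"
proof -
  have "set_integrable lborel {0..2*pi} f"
    by (rule borel_integrable_atLeastAtMost') (use assms continuous_on_subset in auto)
  moreover have "f \<in> borel_measurable borel"
    using assms by (rule borel_measurable_continuous_onI)
  ultimately show ?thesis
    by (simp add: integrable_circ_iff)
qed

lemma integral_circ_eq:
  fixes f :: "real \<Rightarrow> 'a::euclidean_space"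
  assumes "f \<in> borel_measurable borel" "integrable circ f"
  shows "integral\<^sup>L circ f = (1/(2*pi)) *\<^sub>R integral {0..2*pi} f"
proof -
  have "set_integrable lborel {0..2*pi} f"
    using assms integrable_circ_iff by blast
  from set_borel_integral_eq_integral(2)[OF this] show ?thesis
    using assms by (simp add: integral_circ_set)
qed

lemma integral_circ_continuous:
  fixes f :: "real \<Rightarrow> 'a::euclidean_space"
  assumes "continuous_on UNIV f"
  shows "integral\<^sup>L circ f = (1/(2*pi)) *\<^sub>R integral {0..2*pi} f"
  using assms by (simp add: integral_circ_eq integrable_circ_continuous borel_measurable_continuous_onI)

lemma continuous_on_cis_compose:
  assumes "continuous_on (sphere 0 1) f"
  shows "continuous_on UNIV (\<lambda>t. f (cis t))"
  by (rule continuous_on_compose2[OF assms]) (auto intro!: continuous_intros)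

text \<open>The factor e^(it) from dz = i e^(it) dt is absorbed into the denominator. What remains,
  \<open>1 / (1 - w * cis (-t))\<close>, is the conjugate of the Szego kernel on the circle, so this
  is the reproducing property of the Hardy space.\<close>

lemma Cauchy_formula_circ:
  assumes "continuous_on (cball 0 1) f" "f holomorphic_on ball 0 1" "cmod w < 1"
  shows "integral\<^sup>L circ (\<lambda>t. f (cis t) / (1 - w * cis (-t))) = f w"
proof -
  have ne: "1 - w * cis (- t) \<noteq> 0" for t
    using assms(3) by (metis norm_cis norm_mult mult.right_neutral less_irrefl norm_one right_minus_eq)
  have "((\<lambda>u. f u / (u - w)) has_contour_integral (2 * of_real pi * \<i> * f w)) (circlepath 0 1)"
    using assms by (intro Cauchy_integral_circlepath) auto
  then have "((\<lambda>u. f u / (u - w)) has_contour_integral (2 * of_real pi * \<i> * f w)) (part_circlepath 0 1 0 (2*pi))"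
    by (simp add: circlepath_def)
  then have "((\<lambda>t. f (cis t) / (cis t - w) * \<i> * cis t) has_integral (2 * of_real pi * \<i> * f w)) {0..2*pi}"
    by (subst (asm) has_contour_integral_part_circlepath_iff) auto
  also have "(\<lambda>t. f (cis t) / (cis t - w) * \<i> * cis t) = (\<lambda>t. \<i> * (f (cis t) / (1 - w * cis (-t))))"
  proof
    fix t
    have eq: "cis t - w = cis t * (1 - w * cis (-t))"
      by (simp add: algebra_simps cis_mult)
    show "f (cis t) / (cis t - w) * \<i> * cis t = \<i> * (f (cis t) / (1 - w * cis (-t)))"
      unfolding eq using ne[of t] by (simp add: divide_simps)
  qed
  finally have "((\<lambda>t. (-\<i>) * (\<i> * (f (cis t) / (1 - w * cis (-t))))) has_integral ((-\<i>) * (2 * of_real pi * \<i> * f w))) {0..2*pi}"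
    by (rule has_integral_mult_right)
  then have "((\<lambda>t. f (cis t) / (1 - w * cis (-t))) has_integral (2 * of_real pi * f w)) {0..2*pi}"
    by (simp flip: mult.assoc) (simp add: mult.assoc mult.commute mult.left_commute)
  moreover have "continuous_on UNIV (\<lambda>t. f (cis t) / (1 - w * cis (-t)))"
    using ne by (intro continuous_intros continuous_on_cis_compose
        continuous_on_subset[OF assms(1)]) auto
  ultimately show ?thesis
    by (simp add: integral_circ_continuous integral_unique scaleR_conv_of_real)
qed

lemma coeff_circ:
  assumes "continuous_on (cball 0 1) f" "f holomorphic_on ball 0 1"
  shows "integral\<^sup>L circ (\<lambda>t. f (cis t) * cis (- (real n * t))) = (deriv ^^ n) f 0 / fact n"
proof -
  have "((\<lambda>u. f u / (u - 0)^(Suc n)) has_contour_integral (2 * of_real pi * \<i> / fact n * (deriv ^^ n) f 0)) (circlepath 0 1)"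
    using Cauchy_has_contour_integral_higher_derivative_circlepath[OF assms, of 0 n] by simp
  then have "((\<lambda>t. f (cis t) / (cis t)^(Suc n) * \<i> * cis t) has_integral (2 * of_real pi * \<i> / fact n * (deriv ^^ n) f 0)) {0..2*pi}"
    unfolding circlepath_def
    by (subst (asm) has_contour_integral_part_circlepath_iff) auto
  also have "(\<lambda>t. f (cis t) / (cis t)^(Suc n) * \<i> * cis t) = (\<lambda>t. \<i> * (f (cis t) * cis (- (real n * t))))"
    by (auto simp: fun_eq_iff field_simps cis_mult Complex.DeMoivre simp flip: cis_inverse)
  finally have "((\<lambda>t. (-\<i>) * (\<i> * (f (cis t) * cis (- (real n * t))))) has_integral ((-\<i>) * (2 * of_real pi * \<i> / fact n * (deriv ^^ n) f 0))) {0..2*pi}"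
    by (rule has_integral_mult_right)
  then have "((\<lambda>t. f (cis t) * cis (- (real n * t))) has_integral (2 * of_real pi * ((deriv ^^ n) f 0/ fact n))) {0..2*pi}"
    by (simp flip: mult.assoc) (simp add: mult.assoc mult.commute mult.left_commute)
  moreover have "continuous_on UNIV (\<lambda>t. f (cis t) * cis (- (real n * t)))"
    by (intro continuous_intros continuous_on_cis_compose
        continuous_on_subset[OF assms(1)]) auto
  ultimately show ?thesis
    by (simp add: integral_circ_continuous integral_unique scaleR_conv_of_real)
qed

definition poisson_kernel :: "complex \<Rightarrow> real \<Rightarrow> real" where
  "poisson_kernel z t = (1 - (cmod z)\<^sup>2) / (cmod (cis t - z))\<^sup>2"

lemma cis_ne_disc: "cmod z < 1 \<Longrightarrow> cis t \<noteq> z"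
  using norm_cis[of t] by auto

lemma poisson_kernel_nonneg: "cmod z < 1 \<Longrightarrow> 0 \<le> poisson_kernel z t"
  by (simp add: poisson_kernel_def power_le_one)

lemma continuous_poisson_kernel: "cmod z < 1 \<Longrightarrow> continuous_on UNIV (poisson_kernel z)"
  unfolding poisson_kernel_def using cis_ne_disc by (intro continuous_intros) auto

lemma poisson_kernel_le: "cmod z < 1 \<Longrightarrow> poisson_kernel z t \<le> (1 + cmod z) / (1 - cmod z)"
proof -
  assume z: "cmod z < 1"
  have "1 - cmod z \<le> cmod (cis t - z)"
    using norm_triangle_ineq2[of "cis t" z] by simp
  then have "poisson_kernel z t \<le> (1 - (cmod z)\<^sup>2) / (1 - cmod z)\<^sup>2"
    unfolding poisson_kernel_def using z by (intro divide_left_mono power_mono mult_pos_pos) (auto simp: power_le_one cis_ne_disc)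
  also have "\<dots> = (1 + cmod z) / (1 - cmod z)"
    using z by (simp add: power2_eq_square divide_simps) (simp add: algebra_simps)
  finally show ?thesis .
qed

lemma poisson_kernel_eq_Re:
  assumes "cmod z < 1"
  shows "poisson_kernel z t = Re ((cis t + z) / (cis t - z))"
proof -
  have "(cis t + z) / (cis t - z) = (cis t + z) * cnj (cis t - z) / (cmod (cis t - z))\<^sup>2"
    by (subst complex_div_cnj) simp
  moreover have "Re ((cis t + z) * cnj (cis t - z)) = 1 - (cmod z)\<^sup>2"
    by (simp add: cmod_power2 algebra_simps) (simp add: power2_eq_square[symmetric])
  ultimately show ?thesis
    by (simp add: poisson_kernel_def)
qed

text \<open>Factoring the squared distance into a holomorphic and an antiholomorphic factor reduces
  Poisson integrals to Cauchy integrals.\<close>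

lemma poisson_kernel_eq_complex:
  assumes "cmod z < 1"
  shows "complex_of_real (poisson_kernel z t) = (1 - cnj z * z) / ((1 - cnj z * cis t) * (1 - z * cis (-t)))"
proof -
  have "cmod (cis t - z) = cmod (cis (-t) * (cis t - z))"
    by (simp add: norm_mult)
  also have "cis (-t) * (cis t - z) = 1 - z * cis (-t)"
    by (simp add: algebra_simps cis_mult)
  finally have "complex_of_real ((cmod (cis t - z))\<^sup>2) = (1 - z * cis (-t)) * cnj (1 - z * cis (-t))"
    by (simp add: complex_norm_square del: of_real_power)
  then show ?thesis
    unfolding poisson_kernel_def using complex_norm_square[of z] by (simp add: cis_cnj mult.commute)
qed

lemma Poisson_formula:
  assumes "continuous_on (cball 0 1) f" "f holomorphic_on ball 0 1" "cmod z < 1"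
  shows "integral\<^sup>L circ (\<lambda>t. of_real (poisson_kernel z t) * f (cis t)) = f z"
proof -
  have ne: "1 - cnj z * u \<noteq> 0" if "cmod u \<le> 1" for u
  proof
    assume "1 - cnj z * u = 0"
    then have "1 = cmod z * cmod u"
      by (metis complex_mod_cnj eq_iff_diff_eq_0 norm_mult norm_one)
    also have "\<dots> \<le> cmod z"
      using that by (simp add: mult_left_le)
    finally show False
      using assms(3) by simp
  qed
  \<comment> \<open>The extra factor is holomorphic, equals 1 at \<open>u = z\<close>, and turns the
    Cauchy kernel into the Poisson kernel.\<close>
  define h where "h = (\<lambda>u. f u * (1 - cnj z * z) / (1 - cnj z * u))"
  have "continuous_on (cball 0 1) h" "h holomorphic_on ball 0 1"
    unfolding h_def using ne by (auto intro!: continuous_intros holomorphic_intros assms)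
  then have "integral\<^sup>L circ (\<lambda>t. h (cis t) / (1 - z * cis (-t))) = h z"
    using assms(3) by (rule Cauchy_formula_circ)
  moreover have "h z = f z"
    using ne[of z] assms(3) by (simp add: h_def)
  moreover have "(\<lambda>t. h (cis t) / (1 - z * cis (-t))) = (\<lambda>t. of_real (poisson_kernel z t) * f (cis t))"
    using assms(3) by (auto simp: h_def poisson_kernel_eq_complex)
  ultimately show ?thesis
    by simp
qed

lemma integral_poisson_kernel: "cmod z < 1 \<Longrightarrow> integral\<^sup>L circ (poisson_kernel z) = 1"
proof -
  assume "cmod z < 1"
  then have "integral\<^sup>L circ (\<lambda>t. complex_of_real (poisson_kernel z t)) = 1"
    using Poisson_formula[of "\<lambda>_. 1" z] by simp
  then show ?thesis
    by simp
qed

text \<open>Orthonormality of the characters, read off from the Cauchy coefficient formula for a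
  monomial.\<close>

lemma integral_cis_int: "integral\<^sup>L circ (\<lambda>t. cis (real m * t) * cis (- (real n * t))) = (if m = n then 1 else 0)"
proof -
  have 1: "integral\<^sup>L circ (\<lambda>t. (cis t)^m * cis (- (real n * t))) = (deriv ^^ n) (\<lambda>z. z ^ m) (0::complex) / fact n"
  proof (rule coeff_circ[of "\<lambda>z. z ^ m"])
    show "continuous_on (cball 0 1) (\<lambda>z::complex. z ^ m)"
      by (rule continuous_on_power[OF continuous_on_id])
    show "(\<lambda>z::complex. z ^ m) holomorphic_on ball 0 1"
      by (rule holomorphic_on_power[OF holomorphic_on_ident])
  qed
  have 2: "(deriv ^^ n) (\<lambda>z. z ^ m) (0::complex) = pochhammer (of_nat (Suc m - n)) n * 0 ^ (m - n)"
    using higher_deriv_power[of n "0::complex" m 0] by simp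
  have 3: "pochhammer (of_nat (Suc m - n)) n * 0 ^ (m - n) = (if m = n then fact n else (0::complex))"
  proof (cases m n rule: linorder_cases)
    case less
    then show ?thesis
      by (simp add: pochhammer_0_left)
  next
    case equal
    then show ?thesis
      by (simp add: pochhammer_fact)
  next
    case greater
    then show ?thesis
      by (simp add: power_0_left)
  qed
  have 4: "(if m = n then fact n else 0) / fact n = (if m = n then 1 else (0::complex))"
    by (cases "m = n") auto
  show ?thesis
    using 1 by (simp only: 2 3 4 Complex.DeMoivre)
qed


section \<open>Integration by parts against a merely integrable function\<close>

lemma integrable_pair_mult:
  fixes f g :: "real \<Rightarrow> real"
  assumes f: "integrable lborel f" and g: "integrable lborel g"
  shows "integrable (lborel \<Otimes>\<^sub>M lborel) (\<lambda>(x, y). f x * g y)"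
proof (rule lborel_pair.Fubini_integrable)
  have [measurable]: "f \<in> borel_measurable borel" "g \<in> borel_measurable borel"
    using f g by auto
  show "(\<lambda>(x, y). f x * g y) \<in> borel_measurable (lborel \<Otimes>\<^sub>M lborel)"
    by measurable
  have "integrable lborel (\<lambda>x. \<bar>f x\<bar> * (\<integral>y. \<bar>g y\<bar> \<partial>lborel))"
    using f by (intro integrable_mult_left integrable_abs)
  then show "integrable lborel (\<lambda>x. \<integral>y. norm (case (x, y) of (x, y) \<Rightarrow> f x * g y) \<partial>lborel)"
    by (simp add: abs_mult)
  show "AE x in lborel. integrable lborel (\<lambda>y. case (x, y) of (x, y) \<Rightarrow> f x * g y)"
    using g by simp
qed

text \<open>Since \<open>\<psi>\<close> is only integrable, its primitive need not be differentiable
  everywhere. Fubini on the triangle s <= v for the product of \<psi>(s) and g'(v) replaces the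
  classical rule: one order of integration produces g d - g s, the other the primitive of
  \<open>\<psi>\<close>.\<close>

lemma integral_by_parts_Fubini:
  fixes g g' \<psi> :: "real \<Rightarrow> real"
  assumes d: "0 \<le> d" and \<psi>: "set_integrable lborel {0..d} \<psi>"
    and g: "\<And>u. (g has_real_derivative g' u) (at u)" and g': "continuous_on UNIV g'"
  shows "(LINT s:{0..d}|lborel. g s * \<psi> s) =
     g d * (LINT s:{0..d}|lborel. \<psi> s) - (LINT v:{0..d}|lborel. g' v * (LINT s:{0..v}|lborel. \<psi> s))"
proof -
  define a where "a = (\<lambda>s. indicator {0..d} s * \<psi> s)"
  define c where "c = (\<lambda>v. indicator {0..d} v * g' v)"
  define F where "F = (\<lambda>s v. a s * c v * (if s \<le> v then 1 else 0))"
  have ai: "integrable lborel a"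
    using \<psi> by (simp add: set_integrable_def a_def)
  have "set_integrable lborel {0..d} g'"
    by (rule borel_integrable_atLeastAtMost') (use g' continuous_on_subset in auto)
  then have ci: "integrable lborel c"
    by (simp add: set_integrable_def c_def)
  have [measurable]: "a \<in> borel_measurable borel" "c \<in> borel_measurable borel"
    using ai ci by auto
  have Fi: "integrable (lborel \<Otimes>\<^sub>M lborel) (case_prod F)"
    by (rule Bochner_Integration.integrable_bound[OF integrable_pair_mult[OF ai ci]])
       (auto simp: F_def split: prod.split)
  have inner1: "(\<integral>v. F s v \<partial>lborel) = a s * (g d - g s)" for s
  proof (cases "s \<in> {0..d}")
    case True
    have "(\<integral>v. F s v \<partial>lborel) = (\<integral>v. a s * (indicator {s..d} v * g' v) \<partial>lborel)"
      using True by (intro Bochner_Integration.integral_cong) (auto simp: F_def c_def indicator_def)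
    also have "\<dots> = a s * (\<integral>v. indicator {s..d} v *\<^sub>R g' v \<partial>lborel)"
      by simp
    also have "(\<integral>v. indicator {s..d} v *\<^sub>R g' v \<partial>lborel) = g d - g s"
      using True g g' by (intro integral_FTC_atLeastAtMost)
        (auto intro: continuous_on_subset has_field_derivative_at_within simp flip: has_real_derivative_iff_has_vector_derivative)
    finally show ?thesis .
  qed (simp add: F_def a_def)
  have inner2: "(\<integral>s. F s v \<partial>lborel) = c v * (LINT s:{0..v}|lborel. \<psi> s)" for v
  proof (cases "v \<in> {0..d}")
    case True
    have "(\<integral>s. F s v \<partial>lborel) = (\<integral>s. c v * (indicator {0..v} s *\<^sub>R \<psi> s) \<partial>lborel)"
      using True by (intro Bochner_Integration.integral_cong) (auto simp: F_def a_def indicator_def)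
    then show ?thesis
      by (simp add: set_lebesgue_integral_def)
  qed (simp add: F_def c_def)
  have gc: "continuous_on UNIV g"
    using g by (meson DERIV_isCont continuous_at_imp_continuous_on)
  have "bounded (g ` {0..d})"
    by (intro compact_imp_bounded compact_continuous_image continuous_on_subset[OF gc]) auto
  then obtain B where B: "\<And>s. s \<in> {0..d} \<Longrightarrow> \<bar>g s\<bar> \<le> B"
    unfolding bounded_iff by fastforce
  have gm[measurable]: "g \<in> borel_measurable borel"
    using gc by (rule borel_measurable_continuous_onI)
  have agi: "integrable lborel (\<lambda>s. a s * g s)"
  proof (rule Bochner_Integration.integrable_bound[OF integrable_mult_right[OF integrable_abs[OF ai], of B]])
    show "AE s in lborel. norm (a s * g s) \<le> norm (B * \<bar>a s\<bar>)"
    proof (rule AE_I2)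
      fix s show "norm (a s * g s) \<le> norm (B * \<bar>a s\<bar>)"
      proof (cases "s \<in> {0..d}")
        case True
        then have "\<bar>g s\<bar> * \<bar>\<psi> s\<bar> \<le> \<bar>B\<bar> * \<bar>\<psi> s\<bar>"
          using B[OF True] by (intro mult_right_mono) auto
        with True show ?thesis
          by (simp add: a_def abs_mult mult.commute)
      qed (simp add: a_def)
    qed
  qed auto
  have "(\<integral>v. (\<integral>s. F s v \<partial>lborel) \<partial>lborel) = (\<integral>s. (\<integral>v. F s v \<partial>lborel) \<partial>lborel)"
    by (rule lborel_pair.Fubini_integral[OF Fi])
  then have "(\<integral>v. c v * (LINT s:{0..v}|lborel. \<psi> s) \<partial>lborel) = (\<integral>s. a s * g d - a s * g s \<partial>lborel)"
    by (simp add: inner1 inner2 right_diff_distrib)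
  also have "\<dots> = (\<integral>s. a s \<partial>lborel) * g d - (\<integral>s. a s * g s \<partial>lborel)"
    using ai agi by simp
  finally show ?thesis
    unfolding set_lebesgue_integral_def a_def c_def by (simp add: mult_ac)
qed

text \<open>Integration by parts, once for the integrand and once for the constant \<open>e\<close>.\<close>

lemma decreasing_kernel_bound:
  fixes g g' \<psi> :: "real \<Rightarrow> real"
  assumes d: "0 \<le> d" and \<psi>: "set_integrable lborel {0..d} \<psi>"
    and g: "\<And>u. (g has_real_derivative g' u) (at u)" and g': "continuous_on UNIV g'"
    and dec: "\<And>u. u \<in> {0..d} \<Longrightarrow> g' u \<le> 0" and nn: "0 \<le> g d"
    and small: "\<And>u. u \<in> {0..d} \<Longrightarrow> \<bar>LINT s:{0..u}|lborel. \<psi> s\<bar> \<le> e * u"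
  shows "\<bar>LINT s:{0..d}|lborel. g s * \<psi> s\<bar> \<le> e * (LINT s:{0..d}|lborel. g s)"
proof -
  define \<Psi> where "\<Psi> u = (LINT s:{0..u}|lborel. \<psi> s)" for u
  have const: "(LINT s:{0..u}|lborel. e) = e * u" if "u \<in> {0..d}" for u
    using that by (simp add: set_lebesgue_integral_def)
  have "(LINT s:{0..d}|lborel. g s * e) = g d * (LINT s:{0..d}|lborel. e) - (LINT v:{0..d}|lborel. g' v * (LINT s:{0..v}|lborel. e))"
    by (rule integral_by_parts_Fubini[OF d _ g g']) (auto intro!: borel_integrable_atLeastAtMost')
  also have "(LINT v:{0..d}|lborel. g' v * (LINT s:{0..v}|lborel. e)) = (LINT v:{0..d}|lborel. g' v * (e * v))"
    by (rule set_lebesgue_integral_cong) (auto simp: const)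
  finally have eqe: "e * (LINT s:{0..d}|lborel. g s) = g d * (e * d) - (LINT v:{0..d}|lborel. g' v * (e * v))"
    using d by (simp add: const mult.commute)
  have int_e: "set_integrable lborel {0..d} (\<lambda>v. - (g' v * (e * v)))"
    by (rule borel_integrable_atLeastAtMost') (intro continuous_intros continuous_on_subset[OF g'] subset_UNIV)
  have pw: "\<bar>indicator {0..d} v *\<^sub>R (g' v * \<Psi> v)\<bar> \<le> indicator {0..d} v *\<^sub>R (- (g' v * (e * v)))" for v
  proof (cases "v \<in> {0..d}")
    case True
    have "\<bar>g' v * \<Psi> v\<bar> = (- g' v) * \<bar>\<Psi> v\<bar>"
      using dec[OF True] by (simp add: abs_mult)
    also have "\<dots> \<le> (- g' v) * (e * v)"
      using dec[OF True] small[OF True] by (intro mult_left_mono) (auto simp: \<Psi>_def)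
    finally show ?thesis
      using True by simp
  qed simp
  have "\<bar>LINT v:{0..d}|lborel. g' v * \<Psi> v\<bar> \<le> (LINT v:{0..d}|lborel. - (g' v * (e * v)))"
    unfolding set_lebesgue_integral_def
  proof (rule order_trans[OF integral_abs_bound], rule integral_mono')
    show "integrable lborel (\<lambda>v. indicator {0..d} v *\<^sub>R (- (g' v * (e * v))))"
      using int_e by (simp add: set_integrable_def)
    show "\<bar>indicator {0..d} v *\<^sub>R (g' v * \<Psi> v)\<bar> \<le> indicator {0..d} v *\<^sub>R (- (g' v * (e * v)))" for v
      by (rule pw)
    show "0 \<le> indicator {0..d} v *\<^sub>R (- (g' v * (e * v)))" for v
      using pw[of v] by linarith
  qed
  also have "\<dots> = - (LINT v:{0..d}|lborel. g' v * (e * v))"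
    by (simp add: set_lebesgue_integral_def)
  finally have X: "\<bar>LINT v:{0..d}|lborel. g' v * \<Psi> v\<bar> \<le> - (LINT v:{0..d}|lborel. g' v * (e * v))" .
  have Y: "\<bar>g d * \<Psi> d\<bar> \<le> g d * (e * d)"
    using small[of d] d nn by (auto simp: abs_mult \<Psi>_def intro!: mult_left_mono)
  have "(LINT s:{0..d}|lborel. g s * \<psi> s) = g d * \<Psi> d - (LINT v:{0..d}|lborel. g' v * \<Psi> v)"
    unfolding \<Psi>_def by (rule integral_by_parts_Fubini[OF d \<psi> g g'])
  with X Y eqe show ?thesis
    by linarith
qed

subsection \<open>Fatou's theorem\<close>

definition radial_kernel :: "real \<Rightarrow> real \<Rightarrow> real" where
  "radial_kernel r u = (1 - r\<^sup>2) / (1 - 2 * r * cos u + r\<^sup>2)"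

lemma cmod_cis_minus_real: "(cmod (cis u - of_real r))\<^sup>2 = 1 - 2 * r * cos u + r\<^sup>2"
  using sin_cos_squared_add[of u] by (simp add: cmod_power2) (simp add: power2_eq_square algebra_simps)

lemma poisson_kernel_radial_kernel: "poisson_kernel (of_real r * cis t) s = radial_kernel r (s - t)"
proof -
  have "cis s - of_real r * cis t = cis t * (cis (s - t) - of_real r)"
    by (simp add: right_diff_distrib cis_mult mult.commute)
  then have "cmod (cis s - of_real r * cis t) = cmod (cis (s - t) - of_real r)"
    by (metis mult.left_neutral norm_cis norm_mult)
  then show ?thesis
    by (simp add: poisson_kernel_def radial_kernel_def cmod_cis_minus_real norm_mult)
qed

lemma radial_kernel_denom_pos:
  assumes "0 \<le> r" "r < 1"
  shows "0 < 1 - 2 * r * cos (u::real) + r\<^sup>2"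
proof -
  have "cis u \<noteq> of_real r"
  proof
    assume "cis u = of_real r"
    then have "1 = \<bar>r\<bar>"
      by (metis norm_cis norm_of_real)
    then show False
      using assms by simp
  qed
  then show ?thesis
    by (simp flip: cmod_cis_minus_real)
qed

lemma radial_kernel_nonneg: "0 \<le> r \<Longrightarrow> r < 1 \<Longrightarrow> 0 \<le> radial_kernel r u"
  using radial_kernel_denom_pos[of r u] by (simp add: radial_kernel_def power_le_one)

definition radial_kernel' :: "real \<Rightarrow> real \<Rightarrow> real" where
  "radial_kernel' r u = - ((1 - r\<^sup>2) * (2 * r * sin u) / (1 - 2 * r * cos u + r\<^sup>2)\<^sup>2)"

lemma radial_kernel_deriv:
  assumes "0 \<le> r" "r < 1"
  shows "(radial_kernel r has_real_derivative radial_kernel' r u) (at u)"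
  unfolding radial_kernel_def radial_kernel'_def using radial_kernel_denom_pos[OF assms, of u]
  by (auto intro!: derivative_eq_intros simp: power2_eq_square)

lemma continuous_radial_kernel':
  assumes "0 \<le> r" "r < 1"
  shows "continuous_on UNIV (radial_kernel' r)"
  unfolding radial_kernel'_def using radial_kernel_denom_pos[OF assms] by (intro continuous_intros) (auto simp: less_le)

lemma radial_kernel'_nonpos: "0 \<le> r \<Longrightarrow> r < 1 \<Longrightarrow> u \<in> {0..pi} \<Longrightarrow> radial_kernel' r u \<le> 0"
  using radial_kernel_denom_pos[of r u] by (auto simp: radial_kernel'_def power_le_one sin_ge_zero)

text \<open>Away from the arc of half-length d, cos u <= cos d, and the denominator at d equals (r -
  cos d)^2 + (sin d)^2. The bound thus tends to 0 as r tends to 1. The range up to 2 pi - d covers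
  differences of two parameters on the circle.\<close>

lemma radial_kernel_far:
  assumes r: "0 \<le> r" "r < 1" and d: "0 < d" "d < pi/2" and u: "d \<le> \<bar>u\<bar>" "\<bar>u\<bar> \<le> 2*pi - d"
  shows "radial_kernel r u \<le> (1 - r\<^sup>2) / (sin d)\<^sup>2"
proof -
  have "cos \<bar>u\<bar> \<le> cos d"
  proof (cases "\<bar>u\<bar> \<le> pi")
    case True
    then show ?thesis
      using d u by (intro cos_monotone_0_pi_le) auto
  next
    case False
    have "cos \<bar>u\<bar> = cos (2*pi - \<bar>u\<bar>)"
      by simp
    also have "\<dots> \<le> cos d"
      using False d u by (intro cos_monotone_0_pi_le) auto
    finally show ?thesis .
  qed
  then have c: "cos u \<le> cos d"
    by simp
  have "(sin d)\<^sup>2 \<le> (r - cos d)\<^sup>2 + (sin d)\<^sup>2"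
    by simp
  also have "\<dots> = 1 - 2 * r * cos d + r\<^sup>2"
    using sin_cos_squared_add[of d] by (simp add: power2_eq_square algebra_simps)
  also have "\<dots> \<le> 1 - 2 * r * cos u + r\<^sup>2"
    using c r by (simp add: mult_left_mono)
  finally have "(sin d)\<^sup>2 \<le> 1 - 2 * r * cos u + r\<^sup>2" .
  moreover have "sin d > 0"
    using d by (intro sin_gt_zero) auto
  ultimately show ?thesis
    unfolding radial_kernel_def using r by (intro divide_left_mono) (auto simp: power_le_one radial_kernel_denom_pos)
qed


lemma integrable_bounded_mult:
  fixes f k :: "real \<Rightarrow> real"
  assumes "integrable M f" "k \<in> borel_measurable M" "\<And>x. \<bar>k x\<bar> \<le> B"
  shows "integrable M (\<lambda>x. k x * f x)"
  using assms(2) borel_measurable_integrable[OF assms(1)]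
  by (intro Bochner_Integration.integrable_bound[OF integrable_mult_right[OF integrable_abs[OF assms(1)], of B]] AE_I2)
     (use assms(3) in \<open>auto simp: abs_mult intro!: mult_right_mono intro: order_trans[OF _ abs_ge_self]\<close>)

text \<open>The hypothesis \<open>H\<close> controls signed one-sided averages, not averages of
  absolute values. It suffices because the kernel decreases on each side of t, so that integration
  by parts shifts everything to the primitive. The open range for t lets a whole arc around t fit
  into the parameter interval.\<close>

lemma Fatou_point:
  fixes \<phi> :: "real \<Rightarrow> real"
  assumes \<phi>m[measurable]: "\<phi> \<in> borel_measurable borel" and \<phi>: "integrable circ \<phi>"
    and t: "0 < t" "t < 2*pi"
    and H: "\<And>\<sigma> e. \<sigma> \<in> {1,-1} \<Longrightarrow> 0 < e \<Longrightarrow>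
      \<exists>d>0. \<forall>h. 0 < h \<and> h < d \<longrightarrow> \<bar>LINT u:{0..h}|lborel. \<phi> (t + \<sigma> * u) - \<phi> t\<bar> \<le> e * h"
  shows "((\<lambda>r. integral\<^sup>L circ (\<lambda>s. poisson_kernel (of_real r * cis t) s * \<phi> s)) \<longlongrightarrow> \<phi> t) (at_left 1)"
proof (rule tendstoI)
  fix \<epsilon> :: real assume \<epsilon>: "0 < \<epsilon>"
  define \<psi> where "\<psi> s = \<phi> s - \<phi> t" for s
  have [measurable]: "\<psi> \<in> borel_measurable borel"
    unfolding \<psi>_def by measurable
  \<comment> \<open>Each of the two arcs next to t contributes at most \<open>e\<close>, and the
    rest of the circle less than \<open>2 * e\<close> for r near 1.\<close>
  define e where "e = \<epsilon> / 4"
  have e: "e > 0"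
    using \<epsilon> by (simp add: e_def)
  obtain d1 where d1: "d1 > 0" "\<And>h. 0 < h \<Longrightarrow> h < d1 \<Longrightarrow> \<bar>LINT u:{0..h}|lborel. \<phi> (t + 1 * u) - \<phi> t\<bar> \<le> e * h"
    using H[of 1 e] e by auto
  obtain d2 where d2: "d2 > 0" "\<And>h. 0 < h \<Longrightarrow> h < d2 \<Longrightarrow> \<bar>LINT u:{0..h}|lborel. \<phi> (t + (-1) * u) - \<phi> t\<bar> \<le> e * h"
    using H[of "-1" e] e by auto
  \<comment> \<open>Halving turns the bounds into strict ones: the arc stays inside the parameter
    interval, the estimate with sin d applies, and both averages are controlled.\<close>
  define d where "d = Min {t, 2*pi - t, pi/2, d1, d2} / 2"
  have "d > 0" "2 * d \<le> t" "2 * d \<le> 2*pi - t" "2 * d \<le> pi/2" "2 * d \<le> d1" "2 * d \<le> d2"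
    using t d1 d2 pi_gt_zero by (auto simp: d_def min_def)
  then have d: "d > 0" "d < t" "d < 2*pi - t" "d < pi/2" "d < d1" "d < d2"
    by linarith+
  have sind: "sin d > 0"
    using d by (intro sin_gt_zero) auto
  define f where "f s = indicator {0..2*pi} s * \<psi> s" for s
  have \<psi>i: "integrable circ \<psi>"
    unfolding \<psi>_def using \<phi> by auto
  then have "set_integrable lborel {0..2*pi} \<psi>"
    by (subst (asm) integrable_circ_iff) auto
  then have fi: "integrable lborel f"
    by (simp add: set_integrable_def f_def[abs_def])
  then have [measurable]: "f \<in> borel_measurable borel"
    by auto
  define J where "J = (\<integral>s. \<bar>f s\<bar> \<partial>lborel)"
  have small: "\<bar>LINT u:{0..v}|lborel. \<psi> (t + \<sigma> * u)\<bar> \<le> e * v" if "v \<in> {0..d}" "\<sigma> \<in> {1,-1}" for v \<sigma>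
  proof (cases "v = 0")
    case True
    have "(LINT u:{0..v}|lborel. \<psi> (t + \<sigma> * u)) = 0"
      unfolding True set_lebesgue_integral_def
      by (rule integral_eq_zero_AE, rule AE_mp[OF AE_lborel_singleton[of 0]]) (auto simp: indicator_def)
    then show ?thesis
      using True by simp
  next
    case False
    then show ?thesis
      using d1(2)[of v] d2(2)[of v] that d by (auto simp: \<psi>_def)
  qed
  have main: "\<bar>integral\<^sup>L circ (\<lambda>s. poisson_kernel (of_real r * cis t) s * \<phi> s) - \<phi> t\<bar> \<le> 2 * e + (1 - r\<^sup>2) / (sin d)\<^sup>2 * J / (2*pi)"
    if r: "0 \<le> r" "r < 1" for r
  proof -
    define K where "K s = radial_kernel r (s - t)" for s
    have K: "poisson_kernel (of_real r * cis t) = K"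
      by (auto simp: K_def poisson_kernel_radial_kernel)
    have z: "cmod (of_real r * cis t) < 1"
      using r by (simp add: norm_mult)
    have Kc: "continuous_on UNIV K"
      using continuous_poisson_kernel[OF z] K by simp
    have [measurable]: "K \<in> borel_measurable borel"
      using Kc by (rule borel_measurable_continuous_onI)
    have K0: "0 \<le> K s" for s
      using poisson_kernel_nonneg[OF z] K by simp
    define B where "B = (1 + r) / (1 - r)"
    have KB: "K s \<le> B" for s
      using poisson_kernel_le[OF z, of s] r unfolding K B_def by (simp add: norm_mult)
    have iKf: "integrable lborel (\<lambda>s. indicator A s * K s * f s)" if "A \<in> sets borel" for A
      using that K0 KB order_trans[OF K0 KB]
      by (intro integrable_bounded_mult[OF fi, of _ B]) (auto simp: indicator_def)
    have "integral\<^sup>L circ (\<lambda>s. K s * \<phi> s) - \<phi> t = integral\<^sup>L circ (\<lambda>s. K s * \<phi> s) - integral\<^sup>L circ (\<lambda>s. K s * \<phi> t)"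
      using integral_poisson_kernel[OF z] K by simp
    also have "\<dots> = integral\<^sup>L circ (\<lambda>s. K s * \<psi> s)"
    proof (subst Bochner_Integration.integral_diff[symmetric])
      show "integrable circ (\<lambda>s. K s * \<phi> s)"
        using K0 KB by (intro integrable_bounded_mult[OF \<phi>, of _ B]) auto
      show "integrable circ (\<lambda>s. K s * \<phi> t)"
        using Kc by (intro integrable_circ_continuous continuous_intros)
    qed (simp add: \<psi>_def right_diff_distrib)
    also have "\<dots> = (1 / (2*pi)) * (\<integral>s. K s * f s \<partial>lborel)"
      by (subst integral_circ_set) (auto simp: set_lebesgue_integral_def f_def mult_ac)
    finally have eq1: "integral\<^sup>L circ (\<lambda>s. K s * \<phi> s) - \<phi> t = (1 / (2*pi)) * (\<integral>s. K s * f s \<partial>lborel)" .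
    define I where "I A = (\<integral>s. indicator A s * K s * f s \<partial>lborel)" for A
    \<comment> \<open>The sign \<sigma> = -1 reflects the left arc onto \<open>{0..d}\<close>. The
      kernel is even, so both arcs reduce to the same decreasing kernel, whose integral is at most
      the total mass 2 pi.\<close>
    have near: "\<bar>I A\<bar> \<le> e * (2*pi)" if A: "(\<sigma> = 1 \<and> A = {t..t+d}) \<or> (\<sigma> = -1 \<and> A = {t-d..t})" for \<sigma> :: real and A
    proof -
      have \<sigma>: "\<sigma> \<noteq> 0" "\<bar>\<sigma>\<bar> = 1" "\<sigma> \<in> {1,-1}"
        using A by auto
      have ind: "indicator A (t + \<sigma> * u) = (indicator {0..d} u :: real)" for u
        using A by (auto simp: indicator_def)
      have ind2: "u \<in> {0..d} \<Longrightarrow> t + \<sigma> * u \<in> {0..2*pi}" for u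
        using A d by auto
      have Ku: "K (t + \<sigma> * u) = radial_kernel r u" for u
        using A by (auto simp: K_def radial_kernel_def)
      have "I A = (\<integral>u. indicator {0..d} u * radial_kernel r u * f (t + \<sigma> * u) \<partial>lborel)"
        unfolding I_def by (subst lborel_integral_real_affine[OF \<sigma>(1), of _ t]) (simp add: \<sigma> ind Ku)
      also have "\<dots> = (LINT u:{0..d}|lborel. radial_kernel r u * \<psi> (t + \<sigma> * u))"
        unfolding set_lebesgue_integral_def using ind2
        by (intro Bochner_Integration.integral_cong) (auto simp: f_def indicator_def)
      also have "\<bar>\<dots>\<bar> \<le> e * (LINT u:{0..d}|lborel. radial_kernel r u)"
      proof (rule decreasing_kernel_bound)
        have "integrable lborel (\<lambda>u. f (t + \<sigma> * u))"
          using fi \<sigma>(1) by (rule lborel_integrable_real_affine)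
        then have "integrable lborel (\<lambda>u. indicator {0..d} u * f (t + \<sigma> * u))"
          by (rule integrable_bounded_mult[where B = 1]) (auto simp: indicator_def)
        then show "set_integrable lborel {0..d} (\<lambda>u. \<psi> (t + \<sigma> * u))"
          unfolding set_integrable_def
          by (rule Bochner_Integration.integrable_cong[THEN iffD1, rotated 2])
             (use ind2 in \<open>auto simp: f_def indicator_def\<close>)
        show "\<And>u. (radial_kernel r has_real_derivative radial_kernel' r u) (at u)"
          by (rule radial_kernel_deriv[OF r])
        show "continuous_on UNIV (radial_kernel' r)"
          by (rule continuous_radial_kernel'[OF r])
        show "radial_kernel' r u \<le> 0" if "u \<in> {0..d}" for u
          using r that d by (intro radial_kernel'_nonpos) auto
      qed (use d r radial_kernel_nonneg small \<sigma> in auto)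
      also have "\<dots> \<le> e * (2 * pi)"
      proof (rule mult_left_mono)
        have Kint: "integrable lborel (\<lambda>s. indicator {0..2*pi} s * K s)"
          using borel_integrable_atLeastAtMost'[OF continuous_on_subset[OF Kc subset_UNIV]]
          by (simp add: set_integrable_def)
        have "(LINT u:{0..d}|lborel. radial_kernel r u) = (\<integral>u. indicator A (t + \<sigma> * u) * K (t + \<sigma> * u) \<partial>lborel)"
          by (simp add: set_lebesgue_integral_def ind Ku)
        also have "\<dots> = (\<integral>s. indicator A s * K s \<partial>lborel)"
          by (subst (2) lborel_integral_real_affine[OF \<sigma>(1), of _ t]) (simp add: \<sigma>)
        also have "\<dots> \<le> (\<integral>s. indicator {0..2*pi} s * K s \<partial>lborel)"
          using A d K0 by (intro integral_mono'[OF Kint]) (auto simp: indicator_def)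
        also have "\<dots> = 2*pi * integral\<^sup>L circ K"
          by (subst integral_circ_set) (auto simp: set_lebesgue_integral_def)
        also have "\<dots> = 2*pi"
          using integral_poisson_kernel[OF z] K by simp
        finally show "(LINT u:{0..d}|lborel. radial_kernel r u) \<le> 2*pi" .
      qed (use e in auto)
      finally show ?thesis .
    qed
    define C where "C = (1 - r\<^sup>2) / (sin d)\<^sup>2"
    have c0: "0 \<le> C"
      using r by (simp add: C_def power_le_one)
    have far: "\<bar>(\<integral>s. K s * f s \<partial>lborel) - I {t..t+d} - I {t-d..t}\<bar> \<le> C * J"
    proof -
      have i0: "integrable lborel (\<lambda>s. K s * f s)"
        using iKf[of UNIV] by simp
      have fareq: "(\<integral>s. K s * f s \<partial>lborel) - I {t..t+d} - I {t-d..t} =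
        (\<integral>s. K s * f s - indicator {t..t+d} s * K s * f s - indicator {t-d..t} s * K s * f s \<partial>lborel)"
        unfolding I_def using iKf i0 by simp
      have "\<bar>\<integral>s. K s * f s - indicator {t..t+d} s * K s * f s - indicator {t-d..t} s * K s * f s \<partial>lborel\<bar> \<le> (\<integral>s. C * \<bar>f s\<bar> \<partial>lborel)"
      proof (rule order_trans[OF integral_abs_bound], rule integral_mono')
        show "integrable lborel (\<lambda>s. C * \<bar>f s\<bar>)"
          using fi by simp
        show "0 \<le> C * \<bar>f s\<bar>" for s
          using c0 by simp
        fix s
        \<comment> \<open>The two closed arcs overlap exactly at t, where \<open>\<psi>\<close>
          vanishes; off the parameter interval \<open>f\<close> vanishes. Only the last case needs
          the far bound.\<close>
        consider "s = t" | "s \<notin> {0..2*pi}" | "s \<in> {t-d..t+d}" "s \<noteq> t" | "s \<in> {0..2*pi}" "s \<notin> {t-d..t+d}"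
          by blast
        then show "\<bar>K s * f s - indicator {t..t+d} s * K s * f s - indicator {t-d..t} s * K s * f s\<bar> \<le> C * \<bar>f s\<bar>"
        proof cases
          case 4
          then have "K s \<le> C"
            unfolding K_def C_def using t d r by (intro radial_kernel_far) auto
          with 4 K0[of s] show ?thesis
            by (auto simp: abs_mult intro!: mult_right_mono)
        qed (use c0 in \<open>auto simp: f_def \<psi>_def indicator_def\<close>)
      qed
      then show ?thesis
        unfolding fareq J_def by (simp only: integral_mult_right_zero)
    qed
    have "\<bar>\<integral>s. K s * f s \<partial>lborel\<bar> \<le> 2 * (e * (2*pi)) + (1 - r\<^sup>2) / (sin d)\<^sup>2 * J"
      using far[unfolded C_def] near[of 1 "{t..t+d}", OF disjI1] near[of "-1" "{t-d..t}", OF disjI2] by simp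
    then have "\<bar>\<integral>s. K s * f s \<partial>lborel\<bar> / (2*pi) \<le> (2 * (e * (2*pi)) + (1 - r\<^sup>2) / (sin d)\<^sup>2 * J) / (2*pi)"
      by (rule divide_right_mono) simp
    then show ?thesis
      unfolding K eq1 by (simp add: abs_mult add_divide_distrib)
  qed
  have "((\<lambda>r::real. (1 - r\<^sup>2) / (sin d)\<^sup>2 * J / (2*pi)) \<longlongrightarrow> (1 - 1\<^sup>2) / (sin d)\<^sup>2 * J / (2*pi)) (at_left 1)"
    using sind by (intro tendsto_intros) auto
  then have "eventually (\<lambda>r::real. (1 - r\<^sup>2) / (sin d)\<^sup>2 * J / (2*pi) < 2 * e) (at_left 1)"
    using e by (intro order_tendstoD(2)) auto
  moreover have "eventually (\<lambda>r::real. r \<in> {0<..<1}) (at_left 1)"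
    by (rule eventually_at_leftI[of 0]) auto
  ultimately show "eventually (\<lambda>r. dist (integral\<^sup>L circ (\<lambda>s. poisson_kernel (of_real r * cis t) s * \<phi> s)) (\<phi> t) < \<epsilon>) (at_left 1)"
  proof eventually_elim
    case (elim r)
    then have "0 \<le> r" "r < 1"
      by auto
    from main[OF this] elim(1) show ?case
      unfolding dist_real_def e_def by linarith
  qed
qed


text \<open>Lebesgue differentiation over intervals [x, x + h], applied to x -> f(\<sigma> x),
  yields the right-hand and the left-hand statement at once. The exceptional set is carried back by
  a linear map, which preserves null sets.\<close>

lemma Lebesgue_point_AE:
  fixes f :: "real \<Rightarrow> real" and \<sigma> :: real
  assumes f: "integrable lborel f" and \<sigma>: "\<sigma> \<in> {1,-1}"
  shows "AE t in lborel. \<forall>e>0. \<exists>d>0. \<forall>h. 0 < h \<and> h < d \<longrightarrow>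
      \<bar>LINT u:{0..h}|lborel. f (t + \<sigma> * u) - f t\<bar> \<le> e * h"
proof -
  define F where "F x = f (\<sigma> * x)" for x
  have \<sigma>0: "\<sigma> \<noteq> 0" and \<sigma>2: "\<sigma> * \<sigma> = 1"
    using \<sigma> by auto
  have "integrable lborel F"
    using lborel_integrable_real_affine[OF f \<sigma>0, of 0] by (simp add: F_def[abs_def])
  then have Fi: "set_integrable lborel {a..b} F" for a b
    unfolding set_integrable_def by (intro integrable_mult_indicator) auto
  then have "F integrable_on cbox a b" for a b
    using set_borel_integral_eq_integral(1) by auto
  then obtain N where N: "negligible N"
    and lim: "\<And>x e. \<lbrakk>x \<notin> N; 0 < e\<rbrakk> \<Longrightarrow>
       \<exists>d>0. \<forall>h. 0 < h \<and> h < d \<longrightarrow> norm (integral (cbox x (x + h *\<^sub>R One)) F /\<^sub>R h ^ DIM(real) - F x) < e"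
    using integrable_ccontinuous_explicit[of F] by blast
  have "negligible ((*) \<sigma> ` N)"
    using N by (intro negligible_differentiable_image_negligible) (auto intro!: derivative_intros)
  then have "(*) \<sigma> ` N \<in> null_sets (completion lborel)"
    by (simp add: negligible_iff_null_sets)
  then have "AE t in lborel. t \<notin> (*) \<sigma> ` N"
    using AE_not_in AE_completion_iff by blast
  then show ?thesis
  proof eventually_elim
    case (elim t)
    have tN: "\<sigma> * t \<notin> N"
    proof
      assume "\<sigma> * t \<in> N"
      then have "\<sigma> * (\<sigma> * t) \<in> (*) \<sigma> ` N"
        by blast
      then show False
        using elim \<sigma>2 by (simp flip: mult.assoc)
    qed
    show ?case
    proof (intro allI impI)
      fix e :: real assume "0 < e"
      then obtain d where d: "d > 0" "\<And>h. 0 < h \<Longrightarrow> h < d \<Longrightarrow>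
          norm (integral {\<sigma> * t..\<sigma> * t + h} F / h - F (\<sigma> * t)) < e"
        using lim[OF tN, of e] by (auto simp: field_simps)
      have "\<bar>LINT u:{0..h}|lborel. f (t + \<sigma> * u) - f t\<bar> \<le> e * h" if h: "0 < h" "h < d" for h
      proof -
        have fF: "f (t + \<sigma> * u) = F (\<sigma> * t + 1 * u)" for u
          by (simp add: F_def algebra_simps \<sigma>2 flip: mult.assoc)
        have i: "integrable lborel (\<lambda>u. indicator {0..h} u * F (\<sigma> * t + 1 * u))"
          using lborel_integrable_real_affine[OF Fi[of "\<sigma> * t" "\<sigma> * t + h", unfolded set_integrable_def], of 1 "\<sigma> * t"]
          by (simp add: indicator_def)
        have "(LINT u:{0..h}|lborel. f (t + \<sigma> * u) - f t) = (\<integral>u. indicator {0..h} u * F (\<sigma> * t + 1 * u) - indicator {0..h} u * f t \<partial>lborel)"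
          unfolding set_lebesgue_integral_def fF by (simp add: right_diff_distrib)
        also have "\<dots> = (\<integral>u. indicator {0..h} u * F (\<sigma> * t + 1 * u) \<partial>lborel) - h * f t"
          using h i by (subst Bochner_Integration.integral_diff) auto
        also have "(\<integral>u. indicator {0..h} u * F (\<sigma> * t + 1 * u) \<partial>lborel) = (LINT s:{\<sigma> * t..\<sigma> * t + h}|lborel. F s)"
          unfolding set_lebesgue_integral_def
          by (subst (2) lborel_integral_real_affine[of 1 _ "\<sigma> * t"]) (auto simp: indicator_def)
        also have "\<dots> = integral {\<sigma> * t..\<sigma> * t + h} F"
          by (rule set_borel_integral_eq_integral(2)[OF Fi])
        also have "\<dots> - h * f t = h * (integral {\<sigma> * t..\<sigma> * t + h} F / h - F (\<sigma> * t))"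
          using h by (simp add: right_diff_distrib F_def \<sigma>2 flip: mult.assoc)
        finally have "(LINT u:{0..h}|lborel. f (t + \<sigma> * u) - f t) = h * (integral {\<sigma> * t..\<sigma> * t + h} F / h - F (\<sigma> * t))" .
        then show ?thesis
          using d(2)[OF h] h by (simp add: abs_mult mult.commute)
      qed
      with d(1) show "\<exists>d>0. \<forall>h. 0 < h \<and> h < d \<longrightarrow> \<bar>LINT u:{0..h}|lborel. f (t + \<sigma> * u) - f t\<bar> \<le> e * h"
        by blast
    qed
  qed
qed

theorem Fatou_radial_AE:
  fixes \<phi> :: "real \<Rightarrow> real"
  assumes \<phi>m[measurable]: "\<phi> \<in> borel_measurable borel" and \<phi>: "integrable circ \<phi>"
  shows "AE t in circ. ((\<lambda>r. integral\<^sup>L circ (\<lambda>s. poisson_kernel (of_real r * cis t) s * \<phi> s)) \<longlongrightarrow> \<phi> t) (at_left 1)"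
proof -
  define f where "f s = indicator {0..2*pi} s * \<phi> s" for s
  have f: "integrable lborel f"
    using \<phi> \<phi>m integrable_circ_iff[OF \<phi>m] by (simp add: f_def[abs_def] set_integrable_def)
  have "AE t in lborel. t \<noteq> 0 \<and> t \<noteq> 2*pi"
    using AE_lborel_singleton[of 0] AE_lborel_singleton[of "2*pi"] by eventually_elim auto
  with Lebesgue_point_AE[OF f, of 1, simplified] Lebesgue_point_AE[OF f, of "-1", simplified]
  have "AE t in lborel. t \<in> {0..2*pi} \<longrightarrow>
     ((\<lambda>r. integral\<^sup>L circ (\<lambda>s. poisson_kernel (of_real r * cis t) s * \<phi> s)) \<longlongrightarrow> \<phi> t) (at_left 1)"
  proof eventually_elim
    case (elim t)
    show ?case
    proof
      assume "t \<in> {0..2*pi}"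
      with elim have t: "0 < t" "t < 2*pi"
        by auto
      show "((\<lambda>r. integral\<^sup>L circ (\<lambda>s. poisson_kernel (of_real r * cis t) s * \<phi> s)) \<longlongrightarrow> \<phi> t) (at_left 1)"
      proof (rule Fatou_point[OF \<phi>m \<phi> t])
        fix \<sigma> e :: real
        assume \<sigma>: "\<sigma> \<in> {1,-1}" and e: "0 < e"
        have "\<exists>d>0. \<forall>h. 0 < h \<and> h < d \<longrightarrow> \<bar>LINT u:{0..h}|lborel. f (t + \<sigma> * u) - f t\<bar> \<le> e * h"
          using elim(1,2) \<sigma> e by auto
        then obtain d where d: "d > 0" "\<And>h. 0 < h \<Longrightarrow> h < d \<Longrightarrow> \<bar>LINT u:{0..h}|lborel. f (t + \<sigma> * u) - f t\<bar> \<le> e * h"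
          by blast
        show "\<exists>d>0. \<forall>h. 0 < h \<and> h < d \<longrightarrow> \<bar>LINT u:{0..h}|lborel. \<phi> (t + \<sigma> * u) - \<phi> t\<bar> \<le> e * h"
        \<comment> \<open>The smaller bound keeps \<open>t + \<sigma> * u\<close> in the parameter
          interval, where \<open>f\<close> and \<open>\<phi>\<close> agree.\<close>
        proof (intro exI[of _ "min d (min t (2*pi - t))"] conjI allI impI)
          show "0 < min d (min t (2*pi - t))"
            using d(1) t by simp
          fix h assume h: "0 < h \<and> h < min d (min t (2*pi - t))"
          have "(LINT u:{0..h}|lborel. f (t + \<sigma> * u) - f t) = (LINT u:{0..h}|lborel. \<phi> (t + \<sigma> * u) - \<phi> t)"
            unfolding set_lebesgue_integral_def f_def using h t \<sigma>
            by (intro Bochner_Integration.integral_cong) (auto simp: indicator_def)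
          then show "\<bar>LINT u:{0..h}|lborel. \<phi> (t + \<sigma> * u) - \<phi> t\<bar> \<le> e * h"
            using d(2)[of h] h by simp
        qed
      qed
    qed
  qed
  then show ?thesis
    by (simp add: AE_circ)
qed

subsection \<open>Parseval's identity\<close>

text \<open>Orthonormality settles the partial sums; absolute summability bounds them uniformly, so
  dominated convergence gives the limit. Absolute summability is harmless because the identity is
  applied on circles inside the disk.\<close>

lemma Parseval_sums:
  fixes c :: "nat \<Rightarrow> complex"
  assumes c: "summable (\<lambda>m. cmod (c m))"
  shows "(\<lambda>m. (cmod (c m))\<^sup>2) sums integral\<^sup>L circ (\<lambda>t. (cmod (\<Sum>m. c m * cis (real m * t)))\<^sup>2)"
proof -
  define g where "g N t = (\<Sum>m<N. c m * cis (real m * t))" for N t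
  define S where "S = (\<Sum>m. cmod (c m))"
  have gc: "continuous_on UNIV (g N)" for N
    unfolding g_def by (intro continuous_intros)
  have bound: "cmod (g N t) \<le> S" for N t
  proof -
    have "cmod (g N t) \<le> (\<Sum>m<N. cmod (c m))"
      unfolding g_def by (rule order_trans[OF norm_sum]) (simp add: norm_mult)
    also have "\<dots> \<le> S"
      unfolding S_def by (rule sum_le_suminf[OF c]) auto
    finally show ?thesis .
  qed
  have lim: "(\<lambda>N. g N t) \<longlonglongrightarrow> (\<Sum>m. c m * cis (real m * t))" for t
    unfolding g_def by (rule summable_LIMSEQ, rule summable_norm_cancel) (simp add: norm_mult c)
  have int_g: "integral\<^sup>L circ (\<lambda>t. (cmod (g N t))\<^sup>2) = (\<Sum>m<N. (cmod (c m))\<^sup>2)" for N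
  proof -
    have eq: "complex_of_real ((cmod (g N t))\<^sup>2) = (\<Sum>m<N. \<Sum>n<N. (c m * cnj (c n)) * (cis (real m * t) * cis (- (real n * t))))" for t
      unfolding complex_norm_square g_def by (simp add: sum_product cis_cnj mult_ac)
    have "complex_of_real (integral\<^sup>L circ (\<lambda>t. (cmod (g N t))\<^sup>2)) = integral\<^sup>L circ (\<lambda>t. complex_of_real ((cmod (g N t))\<^sup>2))"
      by (rule integral_complex_of_real[symmetric])
    also have "\<dots> = (\<Sum>m<N. \<Sum>n<N. (c m * cnj (c n)) * (if m = n then 1 else 0))"
      unfolding eq
      by (subst Bochner_Integration.integral_sum, intro integrable_circ_continuous continuous_intros, 
          rule sum.cong[OF refl], subst Bochner_Integration.integral_sum,
          intro integrable_circ_continuous continuous_intros)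
        (simp only: integral_mult_right_zero integral_cis_int)
    also have "\<dots> = complex_of_real (\<Sum>m<N. (cmod (c m))\<^sup>2)"
      by (simp add: complex_norm_square if_distrib[of "\<lambda>x. _ * x"] flip: of_real_power cong: if_cong)
    finally show ?thesis
      by (simp only: of_real_eq_iff)
  qed
  have "(\<lambda>N. integral\<^sup>L circ (\<lambda>t. (cmod (g N t))\<^sup>2)) \<longlonglongrightarrow> integral\<^sup>L circ (\<lambda>t. (cmod (\<Sum>m. c m * cis (real m * t)))\<^sup>2)"
  proof (rule integral_dominated_convergence[where w = "\<lambda>_. S\<^sup>2"])
    have [measurable]: "g N \<in> borel_measurable borel" for N
      using gc by (rule borel_measurable_continuous_onI)
    then show "(\<lambda>t. (cmod (g N t))\<^sup>2) \<in> borel_measurable circ" for N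
      by simp
    have "(\<lambda>t. \<Sum>m. c m * cis (real m * t)) \<in> borel_measurable borel"
      by (rule borel_measurable_LIMSEQ_metric[where f = g]) (auto simp: lim)
    then show "(\<lambda>t. (cmod (\<Sum>m. c m * cis (real m * t)))\<^sup>2) \<in> borel_measurable circ"
      by simp
    show "AE t in circ. (\<lambda>N. (cmod (g N t))\<^sup>2) \<longlonglongrightarrow> (cmod (\<Sum>m. c m * cis (real m * t)))\<^sup>2"
      by (intro AE_I2 tendsto_intros lim)
    show "AE t in circ. norm ((cmod (g N t))\<^sup>2) \<le> S\<^sup>2" for N
      by (intro AE_I2) (auto intro!: power_mono bound)
  qed simp
  then show ?thesis
    unfolding sums_def int_g .
qed

definition tcoeff :: "(complex \<Rightarrow> complex) \<Rightarrow> nat \<Rightarrow> complex" where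
  "tcoeff f n = (deriv ^^ n) f 0 / fact n"

lemma tcoeff_sums:
  assumes "f holomorphic_on ball 0 1" "cmod z < 1"
  shows "(\<lambda>n. tcoeff f n * z ^ n) sums f z"
  using holomorphic_power_series[OF assms(1), of z] assms(2) by (simp add: tcoeff_def)

lemma tcoeff_summable:
  assumes "f holomorphic_on ball 0 1" "cmod z < 1"
  shows "summable (\<lambda>n. cmod (tcoeff f n * z ^ n))"
proof -
  obtain r where r: "cmod z < r" "r < 1"
    using assms(2) dense by blast
  then have "summable (\<lambda>n. tcoeff f n * of_real r ^ n)"
    using tcoeff_sums[OF assms(1), of "of_real r"] norm_ge_zero[of z] by (auto simp: sums_iff)
  then show ?thesis
    by (rule powser_insidea) (use r in auto)
qed

lemma Parseval_holomorphic:
  assumes f: "f holomorphic_on ball 0 1" and z: "cmod z < 1"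
  shows "(\<lambda>n. (cmod (tcoeff f n))\<^sup>2 * ((cmod z)\<^sup>2) ^ n) sums integral\<^sup>L circ (\<lambda>t. (cmod (f (z * cis t)))\<^sup>2)"
proof -
  have "f (z * cis t) = (\<Sum>n. tcoeff f n * z ^ n * cis (real n * t))" for t
    using tcoeff_sums[OF f, of "z * cis t"] z
    by (simp add: sums_iff norm_mult power_mult_distrib Complex.DeMoivre mult.assoc)
  with Parseval_sums[OF tcoeff_summable[OF f z]] show ?thesis
    by (simp add: norm_mult norm_power power_mult_distrib mult.commute flip: power_mult)
qed

lemma continuous_on_circle_of_ball:
  assumes "f holomorphic_on ball 0 1" "cmod z < 1"
  shows "continuous_on UNIV (\<lambda>t. f (z * cis t))"
  by (rule continuous_on_compose2[OF holomorphic_on_imp_continuous_on[OF assms(1)]])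
     (use assms(2) in \<open>auto intro!: continuous_intros simp: norm_mult\<close>)

text \<open>Coefficientwise this is (s^n - r^n)^2 <= s^(2n) - r^(2n). It shows that bounded circular
  means force the dilates to be Cauchy in the square mean.\<close>

lemma circ_mean_diff_le:
  assumes f: "f holomorphic_on ball 0 1" and r: "0 \<le> r" "r \<le> s" "s < 1"
  shows "integral\<^sup>L circ (\<lambda>t. (cmod (f (of_real s * cis t) - f (of_real r * cis t)))\<^sup>2)
     \<le> integral\<^sup>L circ (\<lambda>t. (cmod (f (of_real s * cis t)))\<^sup>2) - integral\<^sup>L circ (\<lambda>t. (cmod (f (of_real r * cis t)))\<^sup>2)"
proof -
  have cs: "cmod (of_real s) < 1" and cr: "cmod (of_real r) < 1"
    using r by auto
  define d where "d n = tcoeff f n * of_real s ^ n - tcoeff f n * of_real r ^ n" for n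
  have exp: "f (of_real x * cis t) = (\<Sum>n. tcoeff f n * of_real x ^ n * cis (real n * t))"
    and summ: "summable (\<lambda>n. tcoeff f n * of_real x ^ n * cis (real n * t))" if "cmod (of_real x) < 1" for x t
    using tcoeff_sums[OF f, of "of_real x * cis t"] that
    by (simp_all add: sums_iff norm_mult power_mult_distrib Complex.DeMoivre mult.assoc)
  have "summable (\<lambda>n. cmod (d n))"
    by (rule summable_comparison_test'[OF summable_add[OF tcoeff_summable[OF f cs] tcoeff_summable[OF f cr]], of 0])
       (auto simp: d_def intro!: norm_triangle_ineq4)
  from Parseval_sums[OF this]
  have "(\<lambda>n. (cmod (d n))\<^sup>2) sums integral\<^sup>L circ (\<lambda>t. (cmod (\<Sum>n. d n * cis (real n * t)))\<^sup>2)" .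
  also have "(\<lambda>t. (cmod (\<Sum>n. d n * cis (real n * t)))\<^sup>2) = (\<lambda>t. (cmod (f (of_real s * cis t) - f (of_real r * cis t)))\<^sup>2)"
    unfolding d_def exp[OF cs] exp[OF cr] by (subst suminf_diff[OF summ[OF cs] summ[OF cr]]) (simp add: left_diff_distrib)
  finally have D: "(\<lambda>n. (cmod (d n))\<^sup>2) sums integral\<^sup>L circ (\<lambda>t. (cmod (f (of_real s * cis t) - f (of_real r * cis t)))\<^sup>2)" .
  have E: "(\<lambda>n. (cmod (tcoeff f n))\<^sup>2 * ((cmod (of_real s))\<^sup>2) ^ n - (cmod (tcoeff f n))\<^sup>2 * ((cmod (of_real r))\<^sup>2) ^ n) sums
     (integral\<^sup>L circ (\<lambda>t. (cmod (f (of_real s * cis t)))\<^sup>2) - integral\<^sup>L circ (\<lambda>t. (cmod (f (of_real r * cis t)))\<^sup>2))"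
    by (intro sums_diff Parseval_holomorphic f cs cr)
  show ?thesis
  proof (rule sums_le[OF _ D E])
    fix n
    have rs: "r ^ n \<le> s ^ n" "0 \<le> r ^ n"
      using r by (auto intro!: power_mono)
    have "d n = tcoeff f n * of_real (s ^ n - r ^ n)"
      by (simp add: d_def algebra_simps)
    then have "(cmod (d n))\<^sup>2 = (cmod (tcoeff f n))\<^sup>2 * (s ^ n - r ^ n)\<^sup>2"
      by (simp add: norm_mult power_mult_distrib flip: of_real_power of_real_diff)
    also have "\<dots> \<le> (cmod (tcoeff f n))\<^sup>2 * ((s ^ n)\<^sup>2 - (r ^ n)\<^sup>2)"
    proof (rule mult_left_mono)
      have "0 \<le> 2 * r ^ n * (s ^ n - r ^ n)"
        using rs by simp
      then show "(s ^ n - r ^ n)\<^sup>2 \<le> (s ^ n)\<^sup>2 - (r ^ n)\<^sup>2"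
        by (simp add: power2_eq_square algebra_simps)
    qed simp
    finally show "(cmod (d n))\<^sup>2 \<le> (cmod (tcoeff f n))\<^sup>2 * ((cmod (of_real s))\<^sup>2) ^ n - (cmod (tcoeff f n))\<^sup>2 * ((cmod (of_real r))\<^sup>2) ^ n"
      by (simp add: right_diff_distrib flip: power_mult) (simp add: mult.commute)
  qed
qed


subsection \<open>Boundary values of bounded functions\<close>

text \<open>The dilates are continuous up to the circle and satisfy the Poisson formula; dominated
  convergence with the bound B passes to the limit. Convergence along one sequence of radii is
  enough, which avoids a circular argument: full radial limits are deduced later from this
  representation.\<close>

lemma Poisson_representation:
  assumes f: "f holomorphic_on ball 0 1" and B: "\<And>z. z \<in> ball 0 1 \<Longrightarrow> cmod (f z) \<le> B"
    and \<phi>[measurable]: "\<phi> \<in> borel_measurable borel"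
    and s: "\<And>j. 0 < s j \<and> s j < 1" "s \<longlonglongrightarrow> (1::real)"
    and lim: "AE t in circ. (\<lambda>j. f (of_real (s j) * cis t)) \<longlonglongrightarrow> \<phi> t"
    and z: "cmod z < 1"
  shows "f z = integral\<^sup>L circ (\<lambda>t. of_real (poisson_kernel z t) * \<phi> t)"
proof -
  have sb: "cmod (of_real (s j) * w) < 1" if "cmod w \<le> 1" for j w
  proof -
    have "s j * cmod w \<le> s j"
      using that s(1)[of j] by (intro mult_left_le) auto
    moreover have "cmod (of_real (s j) * w) = s j * cmod w"
      using s(1)[of j] by (simp add: norm_mult)
    ultimately show ?thesis
      using s(1)[of j] by linarith
  qed
  have eq: "integral\<^sup>L circ (\<lambda>t. of_real (poisson_kernel z t) * f (of_real (s j) * cis t)) = f (of_real (s j) * z)" for j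
  proof (rule Poisson_formula[of "\<lambda>w. f (of_real (s j) * w)"])
    show "continuous_on (cball 0 1) (\<lambda>w. f (of_real (s j) * w))"
      by (rule continuous_on_compose2[OF holomorphic_on_imp_continuous_on[OF f]])
         (auto intro!: continuous_intros sb)
    show "(\<lambda>w. f (of_real (s j) * w)) holomorphic_on ball 0 1"
      by (rule holomorphic_on_compose_gen[OF _ f, unfolded o_def])
         (auto intro!: holomorphic_intros sb)
  qed (rule z)
  have [measurable]: "poisson_kernel z \<in> borel_measurable borel"
    using continuous_poisson_kernel[OF z] by (rule borel_measurable_continuous_onI)
  have "(\<lambda>j. integral\<^sup>L circ (\<lambda>t. of_real (poisson_kernel z t) * f (of_real (s j) * cis t))) \<longlonglongrightarrow> integral\<^sup>L circ (\<lambda>t. of_real (poisson_kernel z t) * \<phi> t)"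
  proof (rule integral_dominated_convergence[where w = "\<lambda>t. poisson_kernel z t * B"])
    have fm: "(\<lambda>t. f (of_real (s j) * cis t)) \<in> borel_measurable borel" for j
      by (rule borel_measurable_continuous_onI, rule continuous_on_circle_of_ball[OF f]) (use s(1)[of j] in auto)
    show "(\<lambda>t. of_real (poisson_kernel z t) * \<phi> t) \<in> borel_measurable circ"
      by simp
    show "(\<lambda>t. of_real (poisson_kernel z t) * f (of_real (s j) * cis t)) \<in> borel_measurable circ" for j
      using fm[of j] by simp
    show "integrable circ (\<lambda>t. poisson_kernel z t * B)"
      by (intro integrable_circ_continuous continuous_intros continuous_poisson_kernel z)
    show "AE t in circ. norm (complex_of_real (poisson_kernel z t) * f (of_real (s j) * cis t)) \<le> poisson_kernel z t * B" for j
      using poisson_kernel_nonneg[OF z] B sb[of "cis _" j] by (intro AE_I2) (auto simp: norm_mult intro!: mult_left_mono)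
    show "AE t in circ. (\<lambda>j. complex_of_real (poisson_kernel z t) * f (of_real (s j) * cis t)) \<longlonglongrightarrow> of_real (poisson_kernel z t) * \<phi> t"
      using lim by eventually_elim (intro tendsto_intros)
  qed
  moreover have "(\<lambda>j. f (of_real (s j) * z)) \<longlonglongrightarrow> f (of_real 1 * z)"
  proof (rule isCont_tendsto_compose[of _ f])
    show "isCont f (of_real 1 * z)"
      using holomorphic_on_imp_continuous_on[OF f] z by (simp add: continuous_on_eq_continuous_at)
    show "(\<lambda>j. of_real (s j) * z) \<longlonglongrightarrow> of_real 1 * z"
      by (intro tendsto_intros s(2))
  qed
  ultimately show ?thesis
    unfolding eq using LIMSEQ_unique by auto
qed

text \<open>The circular means increase, so along a fast sequence of radii the functions
  \<open>t \<mapsto> f (s\<^sub>j e\<^sup>i\<^sup>t)\<close> have summable \<open>L\<^sup>1\<close>-distances.\<close>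

lemma fast_radii_limit:
  assumes f: "f holomorphic_on ball 0 1" and B: "\<And>z. z \<in> ball 0 1 \<Longrightarrow> cmod (f z) \<le> B"
  obtains s where "\<And>j. 0 < s j \<and> s j < 1" "s \<longlonglongrightarrow> (1::real)"
    "AE t in circ. convergent (\<lambda>j. f (of_real (s j) * cis t))"
proof -
  define \<rho> where "\<rho> k = 1 - 1 / (real k + 2)" for k
  have \<rho>: "0 < \<rho> k" "\<rho> k < 1" "k \<le> l \<Longrightarrow> \<rho> k \<le> \<rho> l" for k l
    by (auto simp: \<rho>_def field_simps)
  have \<rho>lim: "\<rho> \<longlonglongrightarrow> 1"
    unfolding \<rho>_def by real_asymp
  define N where "N k = integral\<^sup>L circ (\<lambda>t. (cmod (f (of_real (\<rho> k) * cis t)))\<^sup>2)" for k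
  have ci: "continuous_on UNIV (\<lambda>t. f (of_real (\<rho> k) * cis t))" for k
    by (rule continuous_on_circle_of_ball[OF f]) (use \<rho>[of k] in auto)
  have Ndiff: "integral\<^sup>L circ (\<lambda>t. (cmod (f (of_real (\<rho> l) * cis t) - f (of_real (\<rho> k) * cis t)))\<^sup>2) \<le> N l - N k" if "k \<le> l" for k l
    unfolding N_def using \<rho> that by (intro circ_mean_diff_le f) (auto intro: less_imp_le)
  have "incseq N"
  proof (rule monoI)
    fix k l :: nat assume "k \<le> l"
    have "0 \<le> integral\<^sup>L circ (\<lambda>t. (cmod (f (of_real (\<rho> l) * cis t) - f (of_real (\<rho> k) * cis t)))\<^sup>2)"
      by (rule Bochner_Integration.integral_nonneg) auto
    then show "N k \<le> N l"
      using Ndiff[OF \<open>k \<le> l\<close>] by linarith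
  qed
  moreover have "N k \<le> B\<^sup>2" for k
  proof -
    have "N k \<le> integral\<^sup>L circ (\<lambda>t. B\<^sup>2)"
      unfolding N_def using \<rho>[of k]
      by (intro integral_mono integrable_circ_continuous continuous_intros ci power_mono B) (auto simp: norm_mult)
    then show ?thesis by simp
  qed
  ultimately obtain L where L: "N \<longlonglongrightarrow> L" "\<And>k. N k \<le> L"
    using incseq_convergent[of N "B\<^sup>2"] by blast
  have "\<exists>K. \<forall>k\<ge>K. L - N k < (1/4) ^ j" for j :: nat
  proof -
    have "eventually (\<lambda>k. L - (1/4)^j < N k) sequentially"
      by (rule order_tendstoD(1)[OF L(1)]) simp
    then show ?thesis
      unfolding eventually_sequentially by (auto simp: algebra_simps)
  qed
  then obtain K where K: "\<And>j k. k \<ge> K j \<Longrightarrow> L - N k < (1/4) ^ j"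
    by metis
  \<comment> \<open>Summing the thresholds makes \<open>k\<close> monotone and at least
    \<open>K j\<close>; the added \<open>j\<close> drives it to infinity.\<close>
  define k where "k j = (\<Sum>i\<le>j. K i) + j" for j
  have kK: "k j \<ge> K j" for j
    unfolding k_def by (rule trans_le_add1, rule member_le_sum) auto
  have kj: "k j \<ge> j" and kS: "k j \<le> k (Suc j)" for j
    by (auto simp: k_def)
  define g where "g j t = f (of_real (\<rho> (k (Suc j))) * cis t) - f (of_real (\<rho> (k j)) * cis t)" for j t
  have gc: "continuous_on UNIV (g j)" for j
    unfolding g_def by (intro continuous_intros ci)
  then have [measurable]: "g j \<in> borel_measurable borel" for j
    by (rule borel_measurable_continuous_onI)
  have g2: "integral\<^sup>L circ (\<lambda>t. (cmod (g j t))\<^sup>2) \<le> (1/4) ^ j" for j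
    using Ndiff[OF kS, of j] K[OF kK, of j] L(2)[of "k (Suc j)"] unfolding g_def by linarith
  \<comment> \<open>The arithmetic-geometric mean inequality with weights (1/2)^j and 2^j is
    balanced against the square bound (1/4)^j, so that both halves become (1/2)^j / 2.\<close>
  have g1: "integral\<^sup>L circ (\<lambda>t. cmod (g j t)) \<le> (1/2) ^ j" for j
  proof -
    have "integral\<^sup>L circ (\<lambda>t. cmod (g j t)) \<le> integral\<^sup>L circ (\<lambda>t. ((1/2) ^ j + 2 ^ j * (cmod (g j t))\<^sup>2) / 2)"
    proof (intro integral_mono integrable_circ_continuous continuous_intros gc)
      fix t
      have "0 \<le> ((1/2) ^ j * (1 - 2 ^ j * cmod (g j t))\<^sup>2)"
        by simp
      also have "\<dots> = (1/2) ^ j - 2 * cmod (g j t) + 2 ^ j * (cmod (g j t))\<^sup>2"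
        by (simp add: power2_eq_square field_simps power_divide)
      finally show "cmod (g j t) \<le> ((1/2) ^ j + 2 ^ j * (cmod (g j t))\<^sup>2) / 2"
        by simp
    qed auto
    also have "\<dots> = ((1/2) ^ j + 2 ^ j * integral\<^sup>L circ (\<lambda>t. (cmod (g j t))\<^sup>2)) / 2"
    proof -
      have "integrable circ (\<lambda>t. 2 ^ j * (cmod (g j t))\<^sup>2)"
        by (intro integrable_circ_continuous continuous_intros gc)
      then show ?thesis
        by (simp add: add_divide_distrib)
    qed
    also have "\<dots> \<le> ((1/2) ^ j + 2 ^ j * (1/4) ^ j) / 2"
      using g2[of j] by (intro divide_right_mono add_left_mono mult_left_mono) auto
    also have "\<dots> = (1/2) ^ j"
      by (simp flip: power_mult_distrib)
    finally show ?thesis .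
  qed
  have "(\<integral>\<^sup>+t. (\<Sum>j. ennreal (cmod (g j t))) \<partial>circ) = (\<Sum>j. \<integral>\<^sup>+t. ennreal (cmod (g j t)) \<partial>circ)"
    by (rule nn_integral_suminf) simp
  also have "\<dots> \<le> (\<Sum>j. ennreal ((1/2) ^ j))"
  proof (rule suminf_le)
    fix j
    have "(\<integral>\<^sup>+t. ennreal (cmod (g j t)) \<partial>circ) = ennreal (integral\<^sup>L circ (\<lambda>t. cmod (g j t)))"
      by (rule nn_integral_eq_integral) (auto intro!: integrable_circ_continuous continuous_intros gc)
    with g1[of j] show "(\<integral>\<^sup>+t. ennreal (cmod (g j t)) \<partial>circ) \<le> ennreal ((1/2) ^ j)"
      by (simp add: ennreal_leI)
  qed auto
  also have "\<dots> = ennreal (\<Sum>j. (1/2) ^ j)"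
    by (rule suminf_ennreal2) (auto intro: summable_geometric)
  finally have "(\<integral>\<^sup>+t. (\<Sum>j. ennreal (cmod (g j t))) \<partial>circ) \<noteq> \<infinity>"
    by (metis ennreal_neq_top infinity_ennreal_def top.extremum_unique)
  then have "AE t in circ. (\<Sum>j. ennreal (cmod (g j t))) \<noteq> \<infinity>"
    by (intro nn_integral_PInf_AE) auto
  then have "AE t in circ. convergent (\<lambda>j. f (of_real (\<rho> (k j)) * cis t))"
  proof eventually_elim
    case (elim t)
    then have "summable (\<lambda>j. cmod (g j t))"
      by (intro summable_suminf_not_top) auto
    then have "summable (\<lambda>j. g j t)"
      by (rule summable_norm_cancel)
    then have "convergent (\<lambda>n. \<Sum>j<n. g j t)"
      by (simp add: summable_iff_convergent)
    moreover have "(\<Sum>j<n. g j t) = f (of_real (\<rho> (k n)) * cis t) - f (of_real (\<rho> (k 0)) * cis t)" for n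
      unfolding g_def by (rule sum_lessThan_telescope)
    ultimately have "convergent (\<lambda>n. f (of_real (\<rho> (k n)) * cis t) - f (of_real (\<rho> (k 0)) * cis t))"
      by simp
    then have "convergent (\<lambda>n. (f (of_real (\<rho> (k n)) * cis t) - f (of_real (\<rho> (k 0)) * cis t)) + f (of_real (\<rho> (k 0)) * cis t))"
      by (intro convergent_add convergent_const)
    then show ?case
      by simp
  qed
  moreover have "(\<lambda>j. \<rho> (k j)) \<longlonglongrightarrow> 1"
    by (rule filterlim_compose[OF \<rho>lim], rule filterlim_at_top_mono[OF filterlim_ident]) (simp add: kj)
  ultimately show ?thesis
    using that[of "\<lambda>j. \<rho> (k j)"] \<rho> by blast
qed

text \<open>The boundary function is first a limit along a fast sequence of radii. This already
  represents f as a Poisson integral, and Fatou's theorem for the real and imaginary parts then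
  upgrades the sequence to all radii.\<close>

theorem bounded_holomorphic_boundary:
  assumes f: "f holomorphic_on ball 0 1" and B: "\<And>z. z \<in> ball 0 1 \<Longrightarrow> cmod (f z) \<le> B"
  obtains \<phi> where "\<phi> \<in> borel_measurable borel" "\<And>t. cmod (\<phi> t) \<le> B"
    "AE t in circ. ((\<lambda>r. f (of_real r * cis t)) \<longlongrightarrow> \<phi> t) (at_left 1)"
    "\<And>z. cmod z < 1 \<Longrightarrow> f z = integral\<^sup>L circ (\<lambda>t. of_real (poisson_kernel z t) * \<phi> t)"
proof -
  obtain s where s: "\<And>j. 0 < s j \<and> s j < 1" "s \<longlonglongrightarrow> (1::real)"
    and conv: "AE t in circ. convergent (\<lambda>j. f (of_real (s j) * cis t))"
    using fast_radii_limit[OF f B] by metis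
  define \<psi> where "\<psi> t = lim (\<lambda>j. f (of_real (s j) * cis t))" for t
  \<comment> \<open>Off the convergence set \<open>lim\<close> is arbitrary; the cut-off makes the
    bound B hold at every t and keeps measurability.\<close>
  define \<phi> where "\<phi> t = (if cmod (\<psi> t) \<le> B then \<psi> t else 0)" for t
  have B0: "0 \<le> B"
    using B[of 0] norm_ge_zero[of "f 0"] by (simp del: norm_ge_zero)
  have "(\<lambda>t. f (of_real (s j) * cis t)) \<in> borel_measurable borel" for j
    by (rule borel_measurable_continuous_onI, rule continuous_on_circle_of_ball[OF f]) (use s(1)[of j] in auto)
  then have [measurable]: "\<psi> \<in> borel_measurable borel"
    unfolding \<psi>_def by (rule borel_measurable_lim_metric)
  have \<phi>m[measurable]: "\<phi> \<in> borel_measurable borel"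
    unfolding \<phi>_def by measurable
  have \<phi>B: "cmod (\<phi> t) \<le> B" for t
    using B0 by (simp add: \<phi>_def)
  have "AE t in circ. (\<lambda>j. f (of_real (s j) * cis t)) \<longlonglongrightarrow> \<phi> t"
    using conv
  proof eventually_elim
    case (elim t)
    then have l: "(\<lambda>j. f (of_real (s j) * cis t)) \<longlonglongrightarrow> \<psi> t"
      by (simp add: \<psi>_def convergent_LIMSEQ_iff)
    have "cmod (\<psi> t) \<le> B"
      by (rule tendsto_upperbound[OF tendsto_norm[OF l]])
         (use s(1) B in \<open>auto simp: norm_mult less_imp_le\<close>)
    with l show ?case
      by (simp add: \<phi>_def)
  qed
  then have rep: "f z = integral\<^sup>L circ (\<lambda>t. of_real (poisson_kernel z t) * \<phi> t)" if "cmod z < 1" for z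
    using Poisson_representation[OF f B \<phi>m s] that by blast
  have \<phi>i: "integrable circ (\<lambda>t. of_real (poisson_kernel z t) * \<phi> t)" if "cmod z < 1" for z
  proof (rule Bochner_Integration.integrable_bound)
    have [measurable]: "poisson_kernel z \<in> borel_measurable borel"
      using continuous_poisson_kernel[OF that] by (rule borel_measurable_continuous_onI)
    show "(\<lambda>t. of_real (poisson_kernel z t) * \<phi> t) \<in> borel_measurable circ"
      by simp
    show "integrable circ (\<lambda>t. poisson_kernel z t * B)"
      by (intro integrable_circ_continuous continuous_intros continuous_poisson_kernel that)
    show "AE t in circ. norm (complex_of_real (poisson_kernel z t) * \<phi> t) \<le> norm (poisson_kernel z t * B)"
      using poisson_kernel_nonneg[OF that] \<phi>B B0 by (intro AE_I2) (auto simp: norm_mult intro!: mult_left_mono)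
  qed
  have \<phi>i1: "integrable circ \<phi>"
    using \<phi>B by (intro circ.integrable_const_bound[where B = B]) auto
  have FRe: "AE t in circ. ((\<lambda>r. integral\<^sup>L circ (\<lambda>s. poisson_kernel (of_real r * cis t) s * Re (\<phi> s))) \<longlongrightarrow> Re (\<phi> t)) (at_left 1)"
    using \<phi>i1 by (intro Fatou_radial_AE) auto
  have FIm: "AE t in circ. ((\<lambda>r. integral\<^sup>L circ (\<lambda>s. poisson_kernel (of_real r * cis t) s * Im (\<phi> s))) \<longlongrightarrow> Im (\<phi> t)) (at_left 1)"
    using \<phi>i1 by (intro Fatou_radial_AE) auto
  have "AE t in circ. ((\<lambda>r. f (of_real r * cis t)) \<longlongrightarrow> \<phi> t) (at_left 1)"
    using FRe FIm
  proof eventually_elim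
    case (elim t)
    have "((\<lambda>r. Complex (integral\<^sup>L circ (\<lambda>s. poisson_kernel (of_real r * cis t) s * Re (\<phi> s))) (integral\<^sup>L circ (\<lambda>s. poisson_kernel (of_real r * cis t) s * Im (\<phi> s))))
        \<longlongrightarrow> Complex (Re (\<phi> t)) (Im (\<phi> t))) (at_left 1)"
      using elim by (intro tendsto_Complex)
    moreover have "eventually (\<lambda>r. Complex (integral\<^sup>L circ (\<lambda>s. poisson_kernel (of_real r * cis t) s * Re (\<phi> s))) (integral\<^sup>L circ (\<lambda>s. poisson_kernel (of_real r * cis t) s * Im (\<phi> s))) = f (of_real r * cis t)) (at_left 1)"
    proof (rule eventually_at_leftI[of 0])
      fix r :: real assume r: "r \<in> {0<..<1}"
      then have z: "cmod (of_real r * cis t) < 1"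
        by (simp add: norm_mult)
      show "Complex (integral\<^sup>L circ (\<lambda>s. poisson_kernel (of_real r * cis t) s * Re (\<phi> s))) (integral\<^sup>L circ (\<lambda>s. poisson_kernel (of_real r * cis t) s * Im (\<phi> s))) = f (of_real r * cis t)"
        using integral_Re[OF \<phi>i[OF z]] integral_Im[OF \<phi>i[OF z]] rep[OF z] by (simp add: complex_eq_iff)
    qed simp
    ultimately show ?case
      by (simp add: filterlim_cong)
  qed
  with \<phi>m \<phi>B rep show ?thesis
    using that by blast
qed

subsection \<open>Outer functions\<close>

definition herglotz_kernel :: "complex \<Rightarrow> real \<Rightarrow> complex" where
  "herglotz_kernel z t = (cis t + z) / (cis t - z)"

definition herglotz :: "(real \<Rightarrow> real) \<Rightarrow> complex \<Rightarrow> complex" where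
  "herglotz k z = integral\<^sup>L circ (\<lambda>t. herglotz_kernel z t * of_real (k t))"

lemma continuous_herglotz_kernel: "cmod z < 1 \<Longrightarrow> continuous_on UNIV (herglotz_kernel z)"
  unfolding herglotz_kernel_def using cis_ne_disc by (intro continuous_intros) auto

lemma herglotz_kernel_bound:
  assumes "cmod z < 1"
  shows "cmod (herglotz_kernel z t) \<le> 2 / (1 - cmod z)"
proof -
  have "1 - cmod z \<le> cmod (cis t - z)"
    using norm_triangle_ineq2[of "cis t" z] by simp
  moreover have "cmod (cis t + z) \<le> 2"
    using norm_triangle_ineq[of "cis t" z] assms by simp
  ultimately show ?thesis
    unfolding herglotz_kernel_def norm_divide using assms by (intro frac_le) auto
qed

lemma integrable_bounded_mult_complex:
  fixes k :: "real \<Rightarrow> real" and h :: "real \<Rightarrow> complex"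
  assumes k: "integrable M k" and h: "h \<in> borel_measurable M" "\<And>t. cmod (h t) \<le> B"
  shows "integrable M (\<lambda>t. h t * of_real (k t))"
proof (rule Bochner_Integration.integrable_bound)
  show "integrable M (\<lambda>t. B * \<bar>k t\<bar>)"
    using k by auto
  show "(\<lambda>t. h t * of_real (k t)) \<in> borel_measurable M"
    using h borel_measurable_integrable[OF k] by simp
  show "AE t in M. norm (h t * of_real (k t)) \<le> norm (B * \<bar>k t\<bar>)"
    using h(2) by (intro AE_I2) (auto simp: norm_mult abs_mult intro!: mult_right_mono intro: order_trans[OF _ abs_ge_self])
qed

lemma integrable_herglotz:
  assumes "integrable circ k" "cmod z < 1"
  shows "integrable circ (\<lambda>t. herglotz_kernel z t * of_real (k t))"
  using assms borel_measurable_continuous_onI[OF continuous_herglotz_kernel[OF assms(2)]]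
  by (intro integrable_bounded_mult_complex[OF assms(1), of "herglotz_kernel z", OF _ herglotz_kernel_bound]) auto

lemma integrable_poisson_kernel_mult:
  assumes "integrable circ k" "cmod z < 1"
  shows "integrable circ (\<lambda>t. poisson_kernel z t * k t)"
  using assms borel_measurable_continuous_onI[OF continuous_poisson_kernel[OF assms(2)]] poisson_kernel_nonneg[OF assms(2)] poisson_kernel_le[OF assms(2)]
  by (intro integrable_bounded_mult) auto

lemma Re_herglotz:
  assumes "integrable circ k" "cmod z < 1"
  shows "Re (herglotz k z) = integral\<^sup>L circ (\<lambda>t. poisson_kernel z t * k t)"
  unfolding herglotz_def using integral_Re[OF integrable_herglotz[OF assms]] poisson_kernel_eq_Re[OF assms(2), folded herglotz_kernel_def] by simp

lemma cmod_exp_herglotz: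
  assumes "integrable circ k" "cmod z < 1"
  shows "cmod (exp (herglotz k z)) = exp (integral\<^sup>L circ (\<lambda>t. poisson_kernel z t * k t))"
  using Re_herglotz[OF assms] by simp

text \<open>The kernel is (1 + w) / (1 - w) with w = z e^(-it), whose expansion 1 + 2 w + 2 w^2 +
  ... has the coefficients \<open>b n\<close>. Integrating it term by term against k exhibits the
  transform as a power series.\<close>

lemma herglotz_holomorphic:
  assumes k: "integrable circ k"
  shows "herglotz k holomorphic_on ball 0 1"
proof -
  define b where "b n = (if n = 0 then 1 else 2 :: complex)" for n :: nat
  define c where "c n = integral\<^sup>L circ (\<lambda>t. b n * cis (-t) ^ n * of_real (k t))" for n
  have bs: "(\<lambda>n. b n * w ^ n) sums ((1 + w) / (1 - w))" if "cmod w < 1" for w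
  proof -
    have "(\<lambda>n. 2 * w ^ n - (if n = 0 then 1 else 0)) sums (2 * (1 / (1 - w)) - 1)"
      using that sums_single[of 0 "\<lambda>_. 1::complex"] by (intro sums_diff sums_mult geometric_sums) auto
    moreover have "1 - w \<noteq> 0"
      using that by auto
    then have "2 * (1 / (1 - w)) - 1 = (1 + w) / (1 - w)"
      by (simp add: field_simps)
    moreover have "(\<lambda>n. 2 * w ^ n - (if n = 0 then 1 else 0)) = (\<lambda>n. b n * w ^ n)"
      by (auto simp: fun_eq_iff b_def)
    ultimately show ?thesis
      by simp
  qed
  have "(\<lambda>n. c n * (z - 0) ^ n) sums herglotz k z" if "z \<in> ball 0 1" for z
  proof -
    have z: "cmod z < 1"
      using that by simp
    have [measurable]: "k \<in> borel_measurable borel"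
      using borel_measurable_integrable[OF k] by simp
    define g where "g N t = (\<Sum>n<N. b n * (z * cis (-t)) ^ n) * of_real (k t)" for N t
    define q where "q = (\<Sum>n. 2 * cmod z ^ n)"
    have gint: "integral\<^sup>L circ (g N) = (\<Sum>n<N. c n * (z - 0) ^ n)" for N
    proof -
      have "integrable circ (\<lambda>t. b n * cis (-t) ^ n * of_real (k t))" for n
      proof (rule integrable_bounded_mult_complex[OF k, where B = 2])
        have "(\<lambda>t. b n * cis (-t) ^ n) \<in> borel_measurable borel"
          by (intro borel_measurable_continuous_onI continuous_intros)
        then show "(\<lambda>t. b n * cis (-t) ^ n) \<in> borel_measurable circ"
          by simp
        show "cmod (b n * cis (-t) ^ n) \<le> 2" for t
          by (simp add: norm_mult norm_power b_def)
      qed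
      then have ii: "integrable circ (\<lambda>t. z ^ n * (b n * cis (-t) ^ n * of_real (k t)))" for n
        by simp
      have "g N = (\<lambda>t. \<Sum>n<N. z ^ n * (b n * cis (-t) ^ n * of_real (k t)))"
        by (auto simp: g_def fun_eq_iff sum_distrib_left sum_distrib_right power_mult_distrib mult_ac)
      then show ?thesis
        using ii by (simp add: c_def Bochner_Integration.integral_sum mult.commute)
    qed
    have "(\<lambda>N. integral\<^sup>L circ (g N)) \<longlonglongrightarrow> herglotz k z"
      unfolding herglotz_def
    proof (rule integral_dominated_convergence[where w = "\<lambda>t. q * \<bar>k t\<bar>"])
      show "(\<lambda>t. herglotz_kernel z t * of_real (k t)) \<in> borel_measurable circ"
        using integrable_herglotz[OF k z] by (rule borel_measurable_integrable)
      show "g N \<in> borel_measurable circ" for N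
      proof -
        have "(\<lambda>t. \<Sum>n<N. b n * (z * cis (-t)) ^ n) \<in> borel_measurable borel"
          by (intro borel_measurable_continuous_onI continuous_intros)
        then show ?thesis
          unfolding g_def by simp
      qed
      show "integrable circ (\<lambda>t. q * \<bar>k t\<bar>)"
        using k by auto
      show "AE t in circ. (\<lambda>N. g N t) \<longlonglongrightarrow> herglotz_kernel z t * of_real (k t)"
      proof (rule AE_I2)
        fix t
        have "(\<lambda>N. \<Sum>n<N. b n * (z * cis (-t)) ^ n) \<longlonglongrightarrow> (1 + z * cis (-t)) / (1 - z * cis (-t))"
          using bs[of "z * cis (-t)"] z by (simp add: sums_def norm_mult)
        moreover have "(1 + z * cis (-t)) / (1 - z * cis (-t)) = (cis t * (1 + z * cis (-t))) / (cis t * (1 - z * cis (-t)))"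
          by simp
        then have "(1 + z * cis (-t)) / (1 - z * cis (-t)) = herglotz_kernel z t"
          by (simp add: herglotz_kernel_def distrib_left right_diff_distrib cis_mult mult.left_commute[of "cis t"])
        ultimately show "(\<lambda>N. g N t) \<longlonglongrightarrow> herglotz_kernel z t * of_real (k t)"
          unfolding g_def by (intro tendsto_intros) simp
      qed
      show "AE t in circ. norm (g N t) \<le> q * \<bar>k t\<bar>" for N
      proof (rule AE_I2)
        fix t
        have "cmod (\<Sum>n<N. b n * (z * cis (-t)) ^ n) \<le> (\<Sum>n<N. 2 * cmod z ^ n)"
          by (rule order_trans[OF norm_sum], rule sum_mono) (auto simp: norm_mult norm_power b_def)
        also have "\<dots> \<le> q"
          unfolding q_def using z by (intro sum_le_suminf summable_mult summable_geometric) auto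
        finally show "norm (g N t) \<le> q * \<bar>k t\<bar>"
          by (simp add: g_def norm_mult mult_right_mono)
      qed
    qed
    then show ?thesis
      unfolding gint sums_def .
  qed
  then show ?thesis
    by (rule power_series_holomorphic)
qed

lemma exp_herglotz_holomorphic: "integrable circ k \<Longrightarrow> (\<lambda>z. exp (herglotz k z)) holomorphic_on ball 0 1"
  by (intro holomorphic_intros herglotz_holomorphic)

lemma integral_poisson_kernel_mono:
  assumes "integrable circ k" "integrable circ l" "cmod z < 1" "AE t in circ. k t \<le> l t"
  shows "integral\<^sup>L circ (\<lambda>t. poisson_kernel z t * k t) \<le> integral\<^sup>L circ (\<lambda>t. poisson_kernel z t * l t)"
proof (rule integral_mono_AE)
  show "AE t in circ. poisson_kernel z t * k t \<le> poisson_kernel z t * l t"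
    using assms(4) by eventually_elim (simp add: mult_left_mono poisson_kernel_nonneg assms(3))
qed (intro integrable_poisson_kernel_mult assms)+

lemma integral_poisson_kernel_const: "cmod z < 1 \<Longrightarrow> integral\<^sup>L circ (\<lambda>t. poisson_kernel z t * c) = c"
  using integral_poisson_kernel by simp

text \<open>Existence of the limit, including its argument, comes from boundedness of the function;
  its modulus comes from Fatou's theorem for the weight, since the modulus inside is the exponential
  of the Poisson integral of k.\<close>

lemma exp_herglotz_boundary_bounded:
  assumes k: "integrable circ k" and M: "\<And>t. k t \<le> M"
  shows "AE t in circ. \<exists>L. ((\<lambda>r. exp (herglotz k (of_real r * cis t))) \<longlongrightarrow> L) (at_left 1) \<and> cmod L = exp (k t)"
proof -
  have km: "k \<in> borel_measurable borel"
    using borel_measurable_integrable[OF k] by simp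
  have B: "cmod (exp (herglotz k z)) \<le> exp M" if "z \<in> ball 0 1" for z
  proof -
    have z: "cmod z < 1"
      using that by simp
    have "integral\<^sup>L circ (\<lambda>t. poisson_kernel z t * k t) \<le> integral\<^sup>L circ (\<lambda>t. poisson_kernel z t * M)"
      using k M by (intro integral_poisson_kernel_mono z) auto
    then show ?thesis
      unfolding cmod_exp_herglotz[OF k z] integral_poisson_kernel_const[OF z] by simp
  qed
  obtain \<phi> where "\<phi> \<in> borel_measurable borel" "\<And>t. cmod (\<phi> t) \<le> exp M"
    and \<phi>: "AE t in circ. ((\<lambda>r. exp (herglotz k (of_real r * cis t))) \<longlongrightarrow> \<phi> t) (at_left 1)"
    and "\<And>z. cmod z < 1 \<Longrightarrow> exp (herglotz k z) = integral\<^sup>L circ (\<lambda>t. of_real (poisson_kernel z t) * \<phi> t)"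
  proof (rule bounded_holomorphic_boundary[where B = "exp M", OF exp_herglotz_holomorphic[OF k]], goal_cases)
    case (1 z)
    show ?case
      by (rule B[OF 1(2)])
  next
    case (2 \<phi>)
    show ?case
      by (rule 2(1)[OF 2(2-)])
  qed
  from \<phi> Fatou_radial_AE[OF km k] show ?thesis
  proof eventually_elim
    case (elim t)
    have "((\<lambda>r. cmod (exp (herglotz k (of_real r * cis t)))) \<longlongrightarrow> exp (k t)) (at_left 1)"
    proof (rule Lim_transform_eventually[OF tendsto_exp[OF elim(2)]])
      show "eventually (\<lambda>r. exp (integral\<^sup>L circ (\<lambda>s. poisson_kernel (of_real r * cis t) s * k s)) = cmod (exp (herglotz k (of_real r * cis t)))) (at_left 1)"
        by (rule eventually_at_leftI[of 0]) (auto simp: cmod_exp_herglotz[OF k] norm_mult simp del: norm_exp_eq_Re)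
    qed
    then have "cmod (\<phi> t) = exp (k t)"
      using tendsto_norm[OF elim(1)] by (intro tendsto_unique[of "at_left 1"]) auto
    with elim(1) show ?case
      by blast
  qed
qed

text \<open>A general weight is the difference of two weights bounded above, so the outer function
  is a quotient of two bounded ones.\<close>

lemma exp_herglotz_boundary:
  assumes k: "integrable circ k"
  shows "AE t in circ. \<exists>L. ((\<lambda>r. exp (herglotz k (of_real r * cis t))) \<longlongrightarrow> L) (at_left 1) \<and> cmod L = exp (k t)"
proof -
  define k1 k2 where "k1 t = min (k t) 0" and "k2 t = - max (k t) 0" for t
  have k1: "integrable circ k1" and k2: "integrable circ k2"
    unfolding k1_def k2_def using k by (auto intro!: integrable_min integrable_max)
  have k12: "k1 t - k2 t = k t" for t
    by (auto simp: k1_def k2_def)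
  have "herglotz k z = herglotz k1 z - herglotz k2 z" if "cmod z < 1" for z
    unfolding herglotz_def
    by (subst Bochner_Integration.integral_diff[symmetric, OF integrable_herglotz[OF k1 that] integrable_herglotz[OF k2 that]])
       (simp add: k12 flip: right_diff_distrib of_real_diff)
  then have quot: "exp (herglotz k z) = exp (herglotz k1 z) / exp (herglotz k2 z)" if "cmod z < 1" for z
    using that by (simp add: exp_diff)
  have "AE t in circ. \<exists>L. ((\<lambda>r. exp (herglotz k1 (of_real r * cis t))) \<longlongrightarrow> L) (at_left 1) \<and> cmod L = exp (k1 t)"
    by (rule exp_herglotz_boundary_bounded[OF k1, of 0]) (simp add: k1_def)
  moreover have "AE t in circ. \<exists>L. ((\<lambda>r. exp (herglotz k2 (of_real r * cis t))) \<longlongrightarrow> L) (at_left 1) \<and> cmod L = exp (k2 t)"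
    by (rule exp_herglotz_boundary_bounded[OF k2, of 0]) (simp add: k2_def)
  ultimately show ?thesis
  proof eventually_elim
    case (elim t)
    then obtain L1 L2 where L: "((\<lambda>r. exp (herglotz k1 (of_real r * cis t))) \<longlongrightarrow> L1) (at_left 1)" "cmod L1 = exp (k1 t)"
      "((\<lambda>r. exp (herglotz k2 (of_real r * cis t))) \<longlongrightarrow> L2) (at_left 1)" "cmod L2 = exp (k2 t)"
      by blast
    have "L2 \<noteq> 0"
      using L(4) by auto
    have "((\<lambda>r. exp (herglotz k (of_real r * cis t))) \<longlongrightarrow> L1 / L2) (at_left 1)"
    proof (rule Lim_transform_eventually[OF tendsto_divide[OF L(1) L(3) \<open>L2 \<noteq> 0\<close>]])
      show "eventually (\<lambda>r. exp (herglotz k1 (of_real r * cis t)) / exp (herglotz k2 (of_real r * cis t)) = exp (herglotz k (of_real r * cis t))) (at_left 1)"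
        by (rule eventually_at_leftI[of 0]) (auto simp: quot norm_mult)
    qed
    moreover have "cmod (L1 / L2) = exp (k t)"
      using L(2,4) k12[of t] by (simp add: norm_divide flip: exp_diff)
    ultimately show ?case
      by blast
  qed
qed

lemma bdry_eq: "((\<lambda>r. f (complex_of_real r * cis t)) \<longlongrightarrow> L) (at_left 1) \<Longrightarrow> bdry f t = L"
  unfolding bdry_def by (rule tendsto_Lim) auto

text \<open>The weight in \<open>is_outer\<close> is measurable only for the completed measure,
  whereas \<open>circ\<close> lives on the Borel sets; an almost everywhere equal Borel function
  bridges the gap.\<close>

lemma absolutely_integrable_borel_version:
  fixes k :: "real \<Rightarrow> real"
  assumes "k absolutely_integrable_on {0..2*pi}"
  obtains k' where "k' \<in> borel_measurable borel" "integrable circ k'"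
    "AE t in lborel. t \<in> {0..2*pi} \<longrightarrow> k t = k' t"
proof -
  define g where "g t = indicator {0..2*pi} t * k t" for t
  have g: "integrable (completion lborel) g"
    using assms by (simp add: set_integrable_def g_def[abs_def])
  then obtain k' where k': "k' \<in> borel_measurable lborel" "AE t in lborel. g t = k' t"
    using completion_ex_borel_measurable_real[OF borel_measurable_integrable[OF g]] by blast
  have k'm[measurable]: "k' \<in> borel_measurable borel"
    using k'(1) by simp
  have "integrable (completion lborel) k'"
  proof (rule integrable_cong_AE_imp[OF g])
    show "k' \<in> borel_measurable (completion lborel)"
      using k'(1) by (rule measurable_completion)
    show "AE t in completion lborel. g t = k' t"
      using k'(2) by (rule AE_completion)
  qed
  then have "integrable lborel k'"
    using k'(1) integrable_completion by blast
  then have "set_integrable lborel {0..2*pi} k'"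
    unfolding set_integrable_def by (intro integrable_mult_indicator) auto
  then have "integrable circ k'"
    by (simp add: integrable_circ_iff)
  moreover have "AE t in lborel. t \<in> {0..2*pi} \<longrightarrow> k t = k' t"
    using k'(2) by eventually_elim (auto simp: g_def)
  ultimately show ?thesis
    using that k'm by blast
qed

lemma outer_herglotz:
  assumes "is_outer a"
  obtains c k where "cmod c = 1" "integrable circ k" "\<And>z. z \<in> ball 0 1 \<Longrightarrow> a z = c * exp (herglotz k z)"
proof -
  obtain c k where c: "cmod c = 1" and k: "k absolutely_integrable_on {0..2*pi}"
    and a: "\<And>z. z \<in> ball 0 1 \<Longrightarrow> a z = c * exp (integral {0..2*pi} (\<lambda>t. (cis t + z) / (cis t - z) * of_real (k t)) / of_real (2*pi))"
    using assms unfolding is_outer_def by blast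
  obtain k' where k'm[measurable]: "k' \<in> borel_measurable borel" and k': "integrable circ k'"
    and eq: "AE t in lborel. t \<in> {0..2*pi} \<longrightarrow> k t = k' t"
    using absolutely_integrable_borel_version[OF k] by blast
  have "integral {0..2*pi} (\<lambda>t. (cis t + z) / (cis t - z) * of_real (k t)) / of_real (2*pi) = herglotz k' z" if "z \<in> ball 0 1" for z
  proof -
    have z: "cmod z < 1"
      using that by simp
    have "integral {0..2*pi} (\<lambda>t. (cis t + z) / (cis t - z) * of_real (k t)) = integral {0..2*pi} (\<lambda>t. (cis t + z) / (cis t - z) * of_real (k' t))"
    proof -
      obtain N where N: "N \<in> null_sets lborel" "{t. \<not> (t \<in> {0..2*pi} \<longrightarrow> k t = k' t)} \<subseteq> N"
        using eq unfolding eventually_ae_filter by auto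
      have "negligible N"
        using null_sets_completionI[OF N(1)] by (simp add: negligible_iff_null_sets)
      then have "negligible {t \<in> {0..2*pi}. k t \<noteq> k' t}"
        by (rule negligible_subset) (use N(2) in auto)
      then show ?thesis
        by (rule integral_spike) auto
    qed
    also have "\<dots> = of_real (2*pi) * herglotz k' z"
    proof -
      have "(\<lambda>t. herglotz_kernel z t * of_real (k' t)) \<in> borel_measurable borel"
        using borel_measurable_integrable[OF integrable_herglotz[OF k' z]] by simp
      then show ?thesis
        unfolding herglotz_def herglotz_kernel_def[symmetric] using integrable_herglotz[OF k' z]
        by (subst integral_circ_eq) (auto simp: scaleR_conv_of_real)
    qed
    finally show ?thesis
      by simp
  qed
  with a have "a z = c * exp (herglotz k' z)" if "z \<in> ball 0 1" for z
    using that by simp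
  with that c k' show ?thesis
    by blast
qed

text \<open>Jensen's inequality for the Poisson kernel as a probability weight. With m the weighted
  mean of |\<phi>|, the tangent bound |\<phi>|^2 >= 2 m |\<phi>| - m^2 is integrated, and its
  integral is m^2.\<close>

lemma cmod_square_le_Poisson:
  assumes [measurable]: "\<phi> \<in> borel_measurable borel" and B: "\<And>t. cmod (\<phi> t) \<le> B" and z: "cmod z < 1"
    and rep: "f z = integral\<^sup>L circ (\<lambda>t. of_real (poisson_kernel z t) * \<phi> t)"
  shows "(cmod (f z))\<^sup>2 \<le> integral\<^sup>L circ (\<lambda>t. poisson_kernel z t * (cmod (\<phi> t))\<^sup>2)"
proof -
  have B0: "0 \<le> B"
    using B[of 0] norm_ge_zero order_trans by blast
  have i1: "integrable circ (\<lambda>t. cmod (\<phi> t))"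
    using B by (intro circ.integrable_const_bound[where B = B]) auto
  have i2: "integrable circ (\<lambda>t. (cmod (\<phi> t))\<^sup>2)"
    using B B0 by (intro circ.integrable_const_bound[where B = "B\<^sup>2"]) (auto intro!: power_mono)
  define m where "m = integral\<^sup>L circ (\<lambda>t. poisson_kernel z t * cmod (\<phi> t))"
  have "cmod (f z) \<le> m"
    unfolding rep m_def
    by (rule order_trans[OF integral_norm_bound]) (simp add: norm_mult abs_of_nonneg poisson_kernel_nonneg[OF z])
  then have "(cmod (f z))\<^sup>2 \<le> m\<^sup>2"
    by (intro power_mono) auto
  also have "\<dots> = integral\<^sup>L circ (\<lambda>t. poisson_kernel z t * (2 * m * cmod (\<phi> t) - m\<^sup>2))"
  proof -
    have "integral\<^sup>L circ (\<lambda>t. poisson_kernel z t * (2 * m * cmod (\<phi> t) - m\<^sup>2)) =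
        integral\<^sup>L circ (\<lambda>t. 2 * m * (poisson_kernel z t * cmod (\<phi> t)) - poisson_kernel z t * m\<^sup>2)"
      by (rule Bochner_Integration.integral_cong) (auto simp: algebra_simps)
    also have "\<dots> = integral\<^sup>L circ (\<lambda>t. 2 * m * (poisson_kernel z t * cmod (\<phi> t))) - integral\<^sup>L circ (\<lambda>t. poisson_kernel z t * m\<^sup>2)"
      using integrable_poisson_kernel_mult[OF i1 z] integrable_poisson_kernel_mult[of "\<lambda>_. m\<^sup>2", OF _ z] by (intro Bochner_Integration.integral_diff) auto
    also have "\<dots> = 2 * m * m - m\<^sup>2"
      unfolding integral_poisson_kernel_const[OF z] integral_mult_right_zero m_def by simp
    finally show ?thesis
      by (simp add: power2_eq_square)
  qed
  also have "\<dots> \<le> integral\<^sup>L circ (\<lambda>t. poisson_kernel z t * (cmod (\<phi> t))\<^sup>2)"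
  proof (rule integral_poisson_kernel_mono[OF _ i2 z])
    show "integrable circ (\<lambda>t. 2 * m * cmod (\<phi> t) - m\<^sup>2)"
      using i1 by auto
    show "AE t in circ. 2 * m * cmod (\<phi> t) - m\<^sup>2 \<le> (cmod (\<phi> t))\<^sup>2"
    proof (rule AE_I2)
      fix t
      have "0 \<le> (cmod (\<phi> t) - m)\<^sup>2"
        by simp
      then show "2 * m * cmod (\<phi> t) - m\<^sup>2 \<le> (cmod (\<phi> t))\<^sup>2"
        by (simp add: power2_eq_square algebra_simps)
    qed
  qed
  finally show ?thesis .
qed

text \<open>\<open>bdry\<close> is meaningful only where radial limits exist. Once they are known
  almost everywhere for both functions, the Pythagorean identity becomes one between the weight k of
  the mate and an honest boundary function of b.\<close>

lemma mate_boundary: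
  assumes b: "b \<in> Hinf_ball" and mate: "pythagorean_mate b a"
  obtains c k \<phi> where "cmod c = 1" "integrable circ k" "\<And>z. z \<in> ball 0 1 \<Longrightarrow> a z = c * exp (herglotz k z)"
    "\<phi> \<in> borel_measurable borel" "\<And>t. cmod (\<phi> t) \<le> 1"
    "AE t in circ. ((\<lambda>r. b (of_real r * cis t)) \<longlongrightarrow> \<phi> t) (at_left 1)"
    "\<And>z. cmod z < 1 \<Longrightarrow> b z = integral\<^sup>L circ (\<lambda>t. of_real (poisson_kernel z t) * \<phi> t)"
    "AE t in circ. (exp (k t))\<^sup>2 + (cmod (\<phi> t))\<^sup>2 = 1"
proof -
  have bh: "b holomorphic_on ball 0 1" and b1: "\<And>z. z \<in> ball 0 1 \<Longrightarrow> cmod (b z) \<le> 1"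
    using b by (auto simp: Hinf_ball_def)
  obtain c k where c: "cmod c = 1" and k: "integrable circ k" and a: "\<And>z. z \<in> ball 0 1 \<Longrightarrow> a z = c * exp (herglotz k z)"
    using mate outer_herglotz unfolding pythagorean_mate_def by blast
  obtain \<phi> where \<phi>: "\<phi> \<in> borel_measurable borel" "\<And>t. cmod (\<phi> t) \<le> 1"
    and lim: "AE t in circ. ((\<lambda>r. b (of_real r * cis t)) \<longlongrightarrow> \<phi> t) (at_left 1)"
    and rep: "\<And>z. cmod z < 1 \<Longrightarrow> b z = integral\<^sup>L circ (\<lambda>t. of_real (poisson_kernel z t) * \<phi> t)"
  proof (rule bounded_holomorphic_boundary[where B = 1, OF bh], goal_cases)
    case (1 z)
    show ?case
      by (rule b1[OF 1(2)])
  next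
    case (2 \<phi>)
    show ?case
      by (rule 2(1)[OF 2(2-)])
  qed
  have pyth: "AE t in circ. (cmod (bdry a t))\<^sup>2 + (cmod (bdry b t))\<^sup>2 = 1"
    using mate by (simp add: pythagorean_mate_def AE_circ)
  have "AE t in circ. (exp (k t))\<^sup>2 + (cmod (\<phi> t))\<^sup>2 = 1"
    using lim pyth exp_herglotz_boundary[OF k]
  proof eventually_elim
    case (elim t)
    then obtain L where L: "((\<lambda>r. exp (herglotz k (of_real r * cis t))) \<longlongrightarrow> L) (at_left 1)" "cmod L = exp (k t)"
      by blast
    have "((\<lambda>r. a (of_real r * cis t)) \<longlongrightarrow> c * L) (at_left 1)"
    proof (rule Lim_transform_eventually[OF tendsto_mult[OF tendsto_const L(1)]])
      show "eventually (\<lambda>r. c * exp (herglotz k (of_real r * cis t)) = a (of_real r * cis t)) (at_left 1)"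
        by (rule eventually_at_leftI[of 0]) (auto simp: a norm_mult)
    qed
    then have "cmod (bdry a t) = exp (k t)"
      using c L(2) by (simp add: bdry_eq norm_mult)
    moreover have "bdry b t = \<phi> t"
      using elim(1) by (rule bdry_eq)
    ultimately show ?case
      using elim(2) by simp
  qed
  with c k a \<phi> lim rep show ?thesis
    by (rule that)
qed

text \<open>Jensen's inequality twice: once for |b|^2, and once for exp(2 k), since |a|^2 is the
  exponential of twice the Poisson integral m of k. The tangent
  \<open>e * (1 + 2 * (k t - m))\<close> of the exponential at m integrates to |a|^2 and lies below
  exp(2 k) = 1 - |\<phi>|^2, so it can be compared with the latter directly.\<close>

theorem mate_Pythagorean_le:
  assumes b: "b \<in> Hinf_ball" and mate: "pythagorean_mate b a" and z: "cmod z < 1"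
  shows "(cmod (a z))\<^sup>2 + (cmod (b z))\<^sup>2 \<le> 1"
proof -
  obtain c k \<phi> where c: "cmod c = 1" and k: "integrable circ k" and a: "\<And>z. z \<in> ball 0 1 \<Longrightarrow> a z = c * exp (herglotz k z)"
    and \<phi>[measurable]: "\<phi> \<in> borel_measurable borel" and \<phi>1: "\<And>t. cmod (\<phi> t) \<le> 1"
    and "AE t in circ. ((\<lambda>r. b (of_real r * cis t)) \<longlongrightarrow> \<phi> t) (at_left 1)"
    and rep: "\<And>z. cmod z < 1 \<Longrightarrow> b z = integral\<^sup>L circ (\<lambda>t. of_real (poisson_kernel z t) * \<phi> t)"
    and pyth: "AE t in circ. (exp (k t))\<^sup>2 + (cmod (\<phi> t))\<^sup>2 = 1"
  proof (rule mate_boundary[OF b mate], goal_cases)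
    case (1 c k \<phi>)
    show ?case
      by (rule 1(1)[OF 1(2-)])
  qed
  have ib: "integrable circ (\<lambda>t. (cmod (\<phi> t))\<^sup>2)"
    using \<phi>1 by (intro circ.integrable_const_bound[where B = 1]) (auto simp: power_le_one)
  define m where "m = integral\<^sup>L circ (\<lambda>t. poisson_kernel z t * k t)"
  define e where "e = (exp m)\<^sup>2"
  have "(cmod (a z))\<^sup>2 = e"
    using z c cmod_exp_herglotz[OF k z] by (simp add: a norm_mult e_def m_def)
  also have "e = integral\<^sup>L circ (\<lambda>t. poisson_kernel z t * (e * (1 + 2 * (k t - m))))"
  proof -
    have "integral\<^sup>L circ (\<lambda>t. poisson_kernel z t * (e * (1 + 2 * (k t - m)))) =
      integral\<^sup>L circ (\<lambda>t. poisson_kernel z t * (e * (1 - 2 * m)) + 2 * e * (poisson_kernel z t * k t))"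
      by (rule Bochner_Integration.integral_cong) (auto simp: algebra_simps)
    also have "\<dots> = integral\<^sup>L circ (\<lambda>t. poisson_kernel z t * (e * (1 - 2 * m))) + integral\<^sup>L circ (\<lambda>t. 2 * e * (poisson_kernel z t * k t))"
      using integrable_poisson_kernel_mult[OF k z] integrable_poisson_kernel_mult[of "\<lambda>_. e * (1 - 2 * m)", OF _ z] by (intro Bochner_Integration.integral_add) auto
    also have "\<dots> = e * (1 - 2 * m) + 2 * e * m"
      unfolding integral_poisson_kernel_const[OF z] integral_mult_right_zero m_def ..
    finally show ?thesis
      by (simp add: algebra_simps)
  qed
  also have "\<dots> \<le> integral\<^sup>L circ (\<lambda>t. poisson_kernel z t * (1 - (cmod (\<phi> t))\<^sup>2))"
  proof (rule integral_poisson_kernel_mono[OF _ _ z])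
    show "integrable circ (\<lambda>t. e * (1 + 2 * (k t - m)))"
      using k by auto
    show "integrable circ (\<lambda>t. 1 - (cmod (\<phi> t))\<^sup>2)"
      using ib by auto
    show "AE t in circ. e * (1 + 2 * (k t - m)) \<le> 1 - (cmod (\<phi> t))\<^sup>2"
      using pyth
    proof eventually_elim
      case (elim t)
      have "e * (1 + 2 * (k t - m)) \<le> e * exp (2 * (k t - m))"
        by (intro mult_left_mono exp_ge_add_one_self) (simp add: e_def)
      also have "\<dots> = (exp (k t))\<^sup>2"
        by (simp add: e_def power2_eq_square flip: exp_add)
      finally show ?case
        using elim by linarith
    qed
  qed
  also have "\<dots> = 1 - integral\<^sup>L circ (\<lambda>t. poisson_kernel z t * (cmod (\<phi> t))\<^sup>2)"
  proof -
    have "integral\<^sup>L circ (\<lambda>t. poisson_kernel z t * (1 - (cmod (\<phi> t))\<^sup>2)) = integral\<^sup>L circ (\<lambda>t. poisson_kernel z t * 1 - poisson_kernel z t * (cmod (\<phi> t))\<^sup>2)"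
      by (rule Bochner_Integration.integral_cong) (auto simp: algebra_simps)
    also have "\<dots> = integral\<^sup>L circ (\<lambda>t. poisson_kernel z t * 1) - integral\<^sup>L circ (\<lambda>t. poisson_kernel z t * (cmod (\<phi> t))\<^sup>2)"
      using integrable_poisson_kernel_mult[OF ib z] integrable_poisson_kernel_mult[of "\<lambda>_. 1", OF _ z] by (intro Bochner_Integration.integral_diff) auto
    finally show ?thesis
      unfolding integral_poisson_kernel_const[OF z] .
  qed
  finally show ?thesis
    using cmod_square_le_Poisson[where f = b and z = z and B = 1, OF \<phi> \<phi>1 z rep[OF z]] by linarith
qed

text \<open>Maximum principle for \<open>p / a\<close>, which is in the Smirnov class because \<open>a\<close> is outer; cutting
  the weight \<open>k\<close> off from below at \<open>- n\<close> replaces \<open>p / a\<close> by bounded functions.\<close>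

theorem dominated_by_mate:
  assumes b: "b \<in> Hinf_ball" and mate: "pythagorean_mate b a"
    and p: "p holomorphic_on UNIV" and C: "0 \<le> C"
    and le: "\<And>w. cmod w < 1 \<Longrightarrow> (cmod (p w))\<^sup>2 \<le> C * (1 - (cmod (b w))\<^sup>2)"
    and z: "cmod z < 1"
  shows "cmod (p z) \<le> sqrt C * cmod (a z)"
proof -
  obtain c k \<phi> where c: "cmod c = 1" and k: "integrable circ k" and a: "\<And>z. z \<in> ball 0 1 \<Longrightarrow> a z = c * exp (herglotz k z)"
    and "\<phi> \<in> borel_measurable borel" "\<And>t. cmod (\<phi> t) \<le> 1"
    and lim: "AE t in circ. ((\<lambda>r. b (of_real r * cis t)) \<longlongrightarrow> \<phi> t) (at_left 1)"
    and "\<And>z. cmod z < 1 \<Longrightarrow> b z = integral\<^sup>L circ (\<lambda>t. of_real (poisson_kernel z t) * \<phi> t)"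
    and pyth: "AE t in circ. (exp (k t))\<^sup>2 + (cmod (\<phi> t))\<^sup>2 = 1"
  proof (rule mate_boundary[OF b mate], goal_cases)
    case (1 c k \<phi>)
    show ?case
      by (rule 1(1)[OF 1(2-)])
  qed
  have pc: "continuous_on UNIV p"
    using p by (rule holomorphic_on_imp_continuous_on)
  \<comment> \<open>The bound in terms of b enters here: along almost every radius its right-hand
    side tends to C exp(2 k).\<close>
  have bd: "AE t in circ. cmod (p (cis t)) \<le> sqrt C * exp (k t)"
    using lim pyth
  proof eventually_elim
    case (elim t)
    have pl: "((\<lambda>r. p (of_real r * cis t)) \<longlongrightarrow> p (of_real 1 * cis t)) (at_left 1)"
      using pc by (intro isCont_tendsto_compose[of _ p] tendsto_intros) (simp add: continuous_on_eq_continuous_at)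
    have "(cmod (p (of_real 1 * cis t)))\<^sup>2 \<le> C * (1 - (cmod (\<phi> t))\<^sup>2)"
    proof (rule tendsto_le[of "at_left (1::real)"])
      show "((\<lambda>r. C * (1 - (cmod (b (of_real r * cis t)))\<^sup>2)) \<longlongrightarrow> C * (1 - (cmod (\<phi> t))\<^sup>2)) (at_left 1)"
        by (intro tendsto_intros elim)
      show "((\<lambda>r. (cmod (p (of_real r * cis t)))\<^sup>2) \<longlongrightarrow> (cmod (p (of_real 1 * cis t)))\<^sup>2) (at_left 1)"
        by (intro tendsto_intros pl)
      show "eventually (\<lambda>r. (cmod (p (of_real r * cis t)))\<^sup>2 \<le> C * (1 - (cmod (b (of_real r * cis t)))\<^sup>2)) (at_left 1)"
        by (rule eventually_at_leftI[of 0]) (auto simp: norm_mult intro!: le)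
    qed simp
    also have "\<dots> = (sqrt C * exp (k t))\<^sup>2"
    proof -
      have "1 - (cmod (\<phi> t))\<^sup>2 = (exp (k t))\<^sup>2"
        using elim(2) by linarith
      then show ?thesis
        using C by (simp add: power_mult_distrib)
    qed
    finally show ?case
      using C by (simp add: power2_le_iff_abs_le)
  qed
  have "bounded (p ` cball 0 1)"
    by (intro compact_imp_bounded compact_continuous_image continuous_on_subset[OF pc]) auto
  then obtain M where M: "\<And>w. cmod w \<le> 1 \<Longrightarrow> cmod (p w) \<le> M"
    unfolding bounded_iff by fastforce
  define kn where "kn n t = max (k t) (- real n)" for n t
  have kn: "integrable circ (kn n)" for n
    unfolding kn_def using k by (auto intro!: integrable_max)
  have main: "cmod (p z) \<le> sqrt C * exp (integral\<^sup>L circ (\<lambda>t. poisson_kernel z t * kn n t))" for n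
  proof -
    define F where "F w = p w / exp (herglotz (kn n) w)" for w
    have Fh: "F holomorphic_on ball 0 1"
      unfolding F_def by (intro holomorphic_intros exp_herglotz_holomorphic kn holomorphic_on_subset[OF p]) auto
    have FB: "cmod (F w) \<le> M * exp (real n)" if "w \<in> ball 0 1" for w
    proof -
      have w: "cmod w < 1"
        using that by simp
      have "integral\<^sup>L circ (\<lambda>t. poisson_kernel w t * - real n) \<le> integral\<^sup>L circ (\<lambda>t. poisson_kernel w t * kn n t)"
        by (rule integral_poisson_kernel_mono[OF _ kn w]) (auto simp: kn_def)
      then have "exp (- real n) \<le> cmod (exp (herglotz (kn n) w))"
        unfolding cmod_exp_herglotz[OF kn w] integral_poisson_kernel_const[OF w] by simp
      then have "cmod (p w) / cmod (exp (herglotz (kn n) w)) \<le> M / exp (- real n)"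
        using M[of w] w by (intro frac_le) (auto intro: order_trans[OF norm_ge_zero])
      then show ?thesis
        unfolding F_def norm_divide by (simp add: exp_minus field_simps)
    qed
    obtain \<psi> where \<psi>[measurable]: "\<psi> \<in> borel_measurable borel" and \<psi>B: "\<And>t. cmod (\<psi> t) \<le> M * exp (real n)"
      and \<psi>lim: "AE t in circ. ((\<lambda>r. F (of_real r * cis t)) \<longlongrightarrow> \<psi> t) (at_left 1)"
      and rep: "\<And>z. cmod z < 1 \<Longrightarrow> F z = integral\<^sup>L circ (\<lambda>t. of_real (poisson_kernel z t) * \<psi> t)"
    proof (rule bounded_holomorphic_boundary[where B = "M * exp (real n)", OF Fh], goal_cases)
    case (1 z)
    show ?case
      by (rule FB[OF 1(2)])
  next
    case (2 \<phi>)
    show ?case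
      by (rule 2(1)[OF 2(2-)])
  qed
    \<comment> \<open>Cutting off from below only enlarges the weight, so the boundary values are at
      most sqrt C exp(k - kn) <= sqrt C. This no longer depends on n, unlike the crude bound that
      made F bounded.\<close>
    have "AE t in circ. cmod (\<psi> t) \<le> sqrt C"
      using \<psi>lim bd exp_herglotz_boundary[OF kn[of n]]
    proof eventually_elim
      case (elim t)
      then obtain L where L: "((\<lambda>r. exp (herglotz (kn n) (of_real r * cis t))) \<longlongrightarrow> L) (at_left 1)" "cmod L = exp (kn n t)"
        by blast
      have "L \<noteq> 0"
        using L(2) by auto
      have "((\<lambda>r. p (of_real r * cis t)) \<longlongrightarrow> p (of_real 1 * cis t)) (at_left 1)"
        using pc by (intro isCont_tendsto_compose[of _ p] tendsto_intros) (simp add: continuous_on_eq_continuous_at)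
      then have "((\<lambda>r. F (of_real r * cis t)) \<longlongrightarrow> p (of_real 1 * cis t) / L) (at_left 1)"
        unfolding F_def using L(1) \<open>L \<noteq> 0\<close> by (rule tendsto_divide)
      with elim(1) have "\<psi> t = p (cis t) / L"
        using tendsto_unique[of "at_left (1::real)"] by fastforce
      then have "cmod (\<psi> t) = cmod (p (cis t)) / exp (kn n t)"
        by (simp add: norm_divide L(2))
      also have "\<dots> \<le> sqrt C"
      proof -
        have "exp (k t) \<le> exp (kn n t)"
          by (simp add: kn_def)
        then have "sqrt C * exp (k t) \<le> sqrt C * exp (kn n t)"
          using C by (intro mult_left_mono) auto
        with elim(2) show ?thesis
          by (simp add: pos_divide_le_eq)
      qed
      finally show ?case .
    qed
    have "cmod (F z) \<le> integral\<^sup>L circ (\<lambda>t. poisson_kernel z t * cmod (\<psi> t))"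
      unfolding rep[OF z]
      by (rule order_trans[OF integral_norm_bound]) (simp add: norm_mult abs_of_nonneg poisson_kernel_nonneg[OF z])
    also have "\<dots> \<le> integral\<^sup>L circ (\<lambda>t. poisson_kernel z t * sqrt C)"
    proof (rule integral_poisson_kernel_mono[OF _ _ z])
      show "integrable circ (\<lambda>t. cmod (\<psi> t))"
        using \<psi>B by (intro circ.integrable_const_bound[where B = "M * exp (real n)"]) auto
    qed (use \<open>AE t in circ. cmod (\<psi> t) \<le> sqrt C\<close> in auto)
    finally have "cmod (F z) \<le> sqrt C"
      unfolding integral_poisson_kernel_const[OF z] .
    then show ?thesis
      unfolding F_def norm_divide cmod_exp_herglotz[OF kn z] by (simp add: pos_divide_le_eq)
  qed
  have "(\<lambda>n. integral\<^sup>L circ (\<lambda>t. poisson_kernel z t * kn n t)) \<longlonglongrightarrow> integral\<^sup>L circ (\<lambda>t. poisson_kernel z t * k t)"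
  proof (rule integral_dominated_convergence[where w = "\<lambda>t. poisson_kernel z t * \<bar>k t\<bar>"])
    show "(\<lambda>t. poisson_kernel z t * k t) \<in> borel_measurable circ"
      using integrable_poisson_kernel_mult[OF k z] by (rule borel_measurable_integrable)
    show "(\<lambda>t. poisson_kernel z t * kn n t) \<in> borel_measurable circ" for n
      using integrable_poisson_kernel_mult[OF kn z] by (rule borel_measurable_integrable)
    show "integrable circ (\<lambda>t. poisson_kernel z t * \<bar>k t\<bar>)"
      using k by (intro integrable_poisson_kernel_mult z) auto
    show "AE t in circ. norm (poisson_kernel z t * kn n t) \<le> poisson_kernel z t * \<bar>k t\<bar>" for n
      by (intro AE_I2) (auto simp: abs_mult poisson_kernel_nonneg[OF z] kn_def intro!: mult_left_mono)
    show "AE t in circ. (\<lambda>n. poisson_kernel z t * kn n t) \<longlonglongrightarrow> poisson_kernel z t * k t"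
    proof (rule AE_I2)
      fix t
      obtain N :: nat where N: "\<bar>k t\<bar> \<le> real N"
        using real_arch_simple by blast
      have "eventually (\<lambda>n. k t = kn n t) sequentially"
        using eventually_ge_at_top[of N] by eventually_elim (use N in \<open>auto simp: kn_def max_def\<close>)
      then have "(\<lambda>n. kn n t) \<longlonglongrightarrow> k t"
        by (rule Lim_transform_eventually[OF tendsto_const])
      then show "(\<lambda>n. poisson_kernel z t * kn n t) \<longlonglongrightarrow> poisson_kernel z t * k t"
        by (intro tendsto_intros)
    qed
  qed
  then have "(\<lambda>n. sqrt C * exp (integral\<^sup>L circ (\<lambda>t. poisson_kernel z t * kn n t))) \<longlonglongrightarrow> sqrt C * exp (integral\<^sup>L circ (\<lambda>t. poisson_kernel z t * k t))"
    by (intro tendsto_intros)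
  then have "cmod (p z) \<le> sqrt C * exp (integral\<^sup>L circ (\<lambda>t. poisson_kernel z t * k t))"
    by (rule tendsto_lowerbound) (use main in \<open>simp_all add: always_eventually\<close>)
  then show ?thesis
    using z c cmod_exp_herglotz[OF k z] by (simp add: a norm_mult)
qed

lemma mate_holomorphic: "pythagorean_mate b a \<Longrightarrow> a holomorphic_on ball 0 1"
proof -
  assume "pythagorean_mate b a"
  then obtain c k where k: "integrable circ k" and a: "\<And>z. z \<in> ball 0 1 \<Longrightarrow> a z = c * exp (herglotz k z)"
    using outer_herglotz unfolding pythagorean_mate_def by blast
  have "(\<lambda>z. c * exp (herglotz k z)) holomorphic_on ball 0 1"
    by (intro holomorphic_intros exp_herglotz_holomorphic k)
  then show ?thesis
    by (rule holomorphic_transform) (simp add: a)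
qed

subsection \<open>Membership in de Branges--Rovnyak spaces\<close>

lemma Cauchy_Schwarz_circ:
  fixes u v :: "real \<Rightarrow> complex"
  assumes u: "continuous_on UNIV u" and v: "continuous_on UNIV v"
  shows "(cmod (integral\<^sup>L circ (\<lambda>t. u t * v t)))\<^sup>2 \<le>
    integral\<^sup>L circ (\<lambda>t. (cmod (u t))\<^sup>2) * integral\<^sup>L circ (\<lambda>t. (cmod (v t))\<^sup>2)"
proof -
  define A where "A = integral\<^sup>L circ (\<lambda>t. (cmod (u t))\<^sup>2)"
  define B where "B = integral\<^sup>L circ (\<lambda>t. (cmod (v t))\<^sup>2)"
  define m where "m = integral\<^sup>L circ (\<lambda>t. cmod (u t) * cmod (v t))"
  have iA: "integrable circ (\<lambda>t. (cmod (u t))\<^sup>2)" and iB: "integrable circ (\<lambda>t. (cmod (v t))\<^sup>2)"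
    and im: "integrable circ (\<lambda>t. cmod (u t) * cmod (v t))"
    by (intro integrable_circ_continuous continuous_intros u v)+
  have A0: "0 \<le> A" and m0: "0 \<le> m" and B0: "0 \<le> B"
    unfolding A_def m_def B_def by (auto intro!: Bochner_Integration.integral_nonneg)
  \<comment> \<open>A quadratic in s that is nonnegative everywhere. For A > 0 it is used at its
    minimizer m / A; for A = 0 a large s rules out m > 0.\<close>
  have q: "2 * s * m \<le> s\<^sup>2 * A + B" for s
  proof -
    have "integral\<^sup>L circ (\<lambda>t. 2 * s * (cmod (u t) * cmod (v t))) \<le> integral\<^sup>L circ (\<lambda>t. s\<^sup>2 * (cmod (u t))\<^sup>2 + (cmod (v t))\<^sup>2)"
    proof (rule integral_mono)
      fix t
      have "0 \<le> (s * cmod (u t) - cmod (v t))\<^sup>2"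
        by simp
      then show "2 * s * (cmod (u t) * cmod (v t)) \<le> s\<^sup>2 * (cmod (u t))\<^sup>2 + (cmod (v t))\<^sup>2"
        by (simp add: power2_eq_square algebra_simps)
    qed (use iA iB im in auto)
    then show ?thesis
      using iA iB unfolding A_def B_def m_def
      by (subst (asm) Bochner_Integration.integral_add) (auto simp only: integral_mult_right_zero integrable_mult_right)
  qed
  have "m\<^sup>2 \<le> A * B"
  proof (cases "A = 0")
    case True
    have "m = 0"
    proof (rule ccontr)
      assume "m \<noteq> 0"
      then have "m > 0"
        using m0 by simp
      with q[of "(B + 1) / m"] True B0 show False
        by simp
    qed
    then show ?thesis
      using True by simp
  next
    case False
    then have A: "A > 0"
      using A0 by simp
    have "2 * (m / A) * m \<le> (m / A)\<^sup>2 * A + B"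
      by (rule q)
    then show ?thesis
      using A by (simp add: power2_eq_square field_simps)
  qed
  moreover have "cmod (integral\<^sup>L circ (\<lambda>t. u t * v t)) \<le> m"
    unfolding m_def by (rule order_trans[OF integral_norm_bound]) (simp add: norm_mult)
  then have "(cmod (integral\<^sup>L circ (\<lambda>t. u t * v t)))\<^sup>2 \<le> m\<^sup>2"
    by (intro power_mono) auto
  ultimately show ?thesis
    unfolding A_def B_def by linarith
qed

text \<open>The test element of the Hardy space: pairing h with it evaluates the functional that
  occurs in \<open>deBR\<close>.\<close>

definition szego :: "nat \<Rightarrow> (nat \<Rightarrow> complex) \<Rightarrow> (nat \<Rightarrow> complex) \<Rightarrow> complex \<Rightarrow> complex" where
  "szego n w c u = (\<Sum>i<n. c i / (1 - cnj (w i) * u))"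

lemma one_minus_cnj_mult_neq_0:
  assumes "cmod w < 1" "cmod u \<le> 1"
  shows "1 - cnj w * u \<noteq> 0"
proof
  assume "1 - cnj w * u = 0"
  then have "1 = cmod w * cmod u"
    by (metis complex_mod_cnj eq_iff_diff_eq_0 norm_mult norm_one)
  also have "\<dots> \<le> cmod w"
    using assms by (simp add: mult_left_le)
  finally show False
    using assms by simp
qed

lemma cnj_mult_neq_1: "cmod w < 1 \<Longrightarrow> cmod u \<le> 1 \<Longrightarrow> cnj w * u \<noteq> 1"
  using one_minus_cnj_mult_neq_0 by fastforce

context
  fixes n :: nat and w :: "nat \<Rightarrow> complex"
  assumes w: "\<forall>i<n. w i \<in> ball 0 1"
begin

lemma szego_continuous: "continuous_on (cball 0 1) (szego n w c)"
  unfolding szego_def using w by (intro continuous_intros) (auto simp: cnj_mult_neq_1)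

lemma szego_holomorphic: "szego n w c holomorphic_on ball 0 1"
  unfolding szego_def using w by (intro holomorphic_intros) (auto simp: cnj_mult_neq_1)

lemma szego_circle: "continuous_on UNIV (\<lambda>t. szego n w c (cis t))"
  by (rule continuous_on_cis_compose, rule continuous_on_subset[OF szego_continuous]) auto

lemma szego_reproducing:
  assumes h: "continuous_on (cball 0 1) h" "h holomorphic_on ball 0 1"
  shows "integral\<^sup>L circ (\<lambda>t. h (cis t) * cnj (szego n w c (cis t))) = (\<Sum>i<n. cnj (c i) * h (w i))"
proof -
  have hc: "continuous_on UNIV (\<lambda>t. h (cis t))"
    by (rule continuous_on_cis_compose, rule continuous_on_subset[OF h(1)]) auto
  have ne: "1 - w i * cis (-t) \<noteq> 0" if "i < n" for i t
    using one_minus_cnj_mult_neq_0[of "cnj (w i)" "cis (-t)"] w that by auto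
  have eq: "(\<lambda>t. h (cis t) * cnj (szego n w c (cis t))) = (\<lambda>t. \<Sum>i<n. cnj (c i) * (h (cis t) / (1 - w i * cis (-t))))"
    by (auto simp: szego_def sum_distrib_left cis_cnj fun_eq_iff mult_ac intro!: sum.cong)
  have "integral\<^sup>L circ (\<lambda>t. \<Sum>i<n. cnj (c i) * (h (cis t) / (1 - w i * cis (-t)))) =
      (\<Sum>i<n. integral\<^sup>L circ (\<lambda>t. cnj (c i) * (h (cis t) / (1 - w i * cis (-t)))))"
    using ne by (intro Bochner_Integration.integral_sum integrable_circ_continuous continuous_intros hc) auto
  also have "\<dots> = (\<Sum>i<n. cnj (c i) * h (w i))"
  proof (rule sum.cong[OF refl])
    fix i assume "i \<in> {..<n}"
    then have "cmod (w i) < 1"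
      using w by auto
    from Cauchy_formula_circ[OF h this]
    show "integral\<^sup>L circ (\<lambda>t. cnj (c i) * (h (cis t) / (1 - w i * cis (-t)))) = cnj (c i) * h (w i)"
      by (simp only: integral_mult_right_zero)
  qed
  finally show ?thesis
    unfolding eq .
qed

text \<open>With \<open>F\<close> the test function and \<open>G = T\<^sub>b\<^sup>* F\<close>, the kernel form is \<open>\<parallel>F\<parallel>\<^sup>2 - \<parallel>G\<parallel>\<^sup>2\<close>, and
  \<open>\<parallel>G\<parallel> \<le> \<parallel>b F\<parallel>\<close> because \<open>G\<close> is the projection of \<open>cnj b F\<close>.\<close>

lemma mate_times_szego_le_kernel:
  assumes bc: "continuous_on (cball 0 1) b" and bh: "b holomorphic_on ball 0 1"
    and ac: "continuous_on UNIV (\<lambda>t. a (cis t))"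
    and ab: "\<And>t. (cmod (a (cis t)))\<^sup>2 + (cmod (b (cis t)))\<^sup>2 \<le> 1"
  shows "integral\<^sup>L circ (\<lambda>t. (cmod (a (cis t) * szego n w c (cis t)))\<^sup>2) \<le>
     Re (\<Sum>i<n. \<Sum>j<n. cnj (c i) * c j * kb b (w j) (w i))"
proof -
  define F where "F = szego n w c"
  \<comment> \<open>The adjoint of multiplication by b maps the Szego kernel at w to cnj (b w) times
    itself, which gives these coefficients.\<close>
  define d where "d j = c j * cnj (b (w j))" for j
  define G where "G = szego n w d"
  have bcis: "continuous_on UNIV (\<lambda>t. b (cis t))"
    by (rule continuous_on_cis_compose, rule continuous_on_subset[OF bc]) auto
  have Fc: "continuous_on UNIV (\<lambda>t. F (cis t))" and Gc: "continuous_on UNIV (\<lambda>t. G (cis t))"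
    unfolding F_def G_def by (rule szego_circle)+
  have FF: "integral\<^sup>L circ (\<lambda>t. F (cis t) * cnj (F (cis t))) = (\<Sum>i<n. cnj (c i) * F (w i))"
    unfolding F_def by (rule szego_reproducing[OF szego_continuous szego_holomorphic])
  have GG: "integral\<^sup>L circ (\<lambda>t. G (cis t) * cnj (G (cis t))) = (\<Sum>i<n. cnj (c i) * b (w i) * G (w i))"
    unfolding G_def by (subst szego_reproducing[OF szego_continuous szego_holomorphic]) (simp add: d_def)
  have bGF: "integral\<^sup>L circ (\<lambda>t. b (cis t) * G (cis t) * cnj (F (cis t))) = (\<Sum>i<n. cnj (c i) * b (w i) * G (w i))"
    unfolding F_def G_def
    by (subst szego_reproducing[of "\<lambda>z. b z * szego n w d z"])
       (auto intro!: continuous_intros holomorphic_intros bc bh szego_continuous szego_holomorphic simp: mult_ac)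
  define N where "N H = integral\<^sup>L circ (\<lambda>t. (cmod (H t))\<^sup>2)" for H :: "real \<Rightarrow> complex"
  have Nc: "complex_of_real (N H) = integral\<^sup>L circ (\<lambda>t. H t * cnj (H t))" for H
    unfolding N_def by (simp only: integral_complex_of_real[symmetric] complex_norm_square)
  \<comment> \<open>The cross term is the pairing of b G with F, which by reproduction is the
    squared norm of G; expanding the square therefore leaves ||bF||^2 - ||G||^2.\<close>
  have "0 \<le> N (\<lambda>t. G (cis t) - cnj (b (cis t)) * F (cis t))"
    unfolding N_def by (rule Bochner_Integration.integral_nonneg) auto
  also have "\<dots> = integral\<^sup>L circ (\<lambda>t. (cmod (G (cis t)))\<^sup>2 - 2 * Re (b (cis t) * G (cis t) * cnj (F (cis t))) + (cmod (b (cis t) * F (cis t)))\<^sup>2)"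
    unfolding N_def
  proof (rule Bochner_Integration.integral_cong[OF refl])
    fix t
    have sq: "(cmod (x - y))\<^sup>2 = (cmod x)\<^sup>2 - 2 * Re (x * cnj y) + (cmod y)\<^sup>2" for x y
      unfolding cmod_power2 by (simp add: power2_eq_square algebra_simps)
    have e: "G (cis t) * cnj (cnj (b (cis t)) * F (cis t)) = b (cis t) * G (cis t) * cnj (F (cis t))"
      by simp
    show "(cmod (G (cis t) - cnj (b (cis t)) * F (cis t)))\<^sup>2 =
       (cmod (G (cis t)))\<^sup>2 - 2 * Re (b (cis t) * G (cis t) * cnj (F (cis t))) + (cmod (b (cis t) * F (cis t)))\<^sup>2"
      using sq[of "G (cis t)" "cnj (b (cis t)) * F (cis t)"] unfolding e by (simp only: norm_mult complex_mod_cnj)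
  qed
  also have "\<dots> = N (\<lambda>t. G (cis t)) - 2 * Re (integral\<^sup>L circ (\<lambda>t. b (cis t) * G (cis t) * cnj (F (cis t)))) + N (\<lambda>t. b (cis t) * F (cis t))"
  proof -
    have i: "integrable circ (\<lambda>t. (cmod (G (cis t)))\<^sup>2)" "integrable circ (\<lambda>t. (cmod (b (cis t) * F (cis t)))\<^sup>2)"
      "integrable circ (\<lambda>t. b (cis t) * G (cis t) * cnj (F (cis t)))"
      by (intro integrable_circ_continuous continuous_intros Fc Gc bcis)+
    have i': "integrable circ (\<lambda>t. 2 * Re (b (cis t) * G (cis t) * cnj (F (cis t))))"
      by (intro integrable_circ_continuous continuous_intros Fc Gc bcis)
    show ?thesis
      unfolding N_def
      by (subst Bochner_Integration.integral_add, rule Bochner_Integration.integrable_diff[OF i(1) i'], rule i(2),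
          subst Bochner_Integration.integral_diff[OF i(1) i'])
         (simp only: integral_mult_right_zero integral_Re[OF i(3)])
  qed
  also have "Re (integral\<^sup>L circ (\<lambda>t. b (cis t) * G (cis t) * cnj (F (cis t)))) = N (\<lambda>t. G (cis t))"
    unfolding bGF GG[symmetric] using Nc[of "\<lambda>t. G (cis t)"] by (metis Re_complex_of_real)
  finally have GbF: "N (\<lambda>t. G (cis t)) \<le> N (\<lambda>t. b (cis t) * F (cis t))"
    by linarith
  have "integral\<^sup>L circ (\<lambda>t. (cmod (a (cis t) * F (cis t)))\<^sup>2) \<le> integral\<^sup>L circ (\<lambda>t. (cmod (F (cis t)))\<^sup>2 - (cmod (b (cis t) * F (cis t)))\<^sup>2)"
  proof (rule integral_mono)
    show "integrable circ (\<lambda>t. (cmod (a (cis t) * F (cis t)))\<^sup>2)"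
      "integrable circ (\<lambda>t. (cmod (F (cis t)))\<^sup>2 - (cmod (b (cis t) * F (cis t)))\<^sup>2)"
      by (intro integrable_circ_continuous continuous_intros Fc ac bcis)+
    fix t
    have "((cmod (a (cis t)))\<^sup>2 + (cmod (b (cis t)))\<^sup>2) * (cmod (F (cis t)))\<^sup>2 \<le> 1 * (cmod (F (cis t)))\<^sup>2"
      by (rule mult_right_mono[OF ab]) simp
    then show "(cmod (a (cis t) * F (cis t)))\<^sup>2 \<le> (cmod (F (cis t)))\<^sup>2 - (cmod (b (cis t) * F (cis t)))\<^sup>2"
      by (simp add: norm_mult power_mult_distrib algebra_simps)
  qed
  also have "\<dots> = N (\<lambda>t. F (cis t)) - N (\<lambda>t. b (cis t) * F (cis t))"
    unfolding N_def by (intro Bochner_Integration.integral_diff integrable_circ_continuous continuous_intros Fc bcis)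
  also have "\<dots> \<le> N (\<lambda>t. F (cis t)) - N (\<lambda>t. G (cis t))"
    using GbF by simp
  also have "\<dots> = Re ((\<Sum>i<n. cnj (c i) * F (w i)) - (\<Sum>i<n. cnj (c i) * b (w i) * G (w i)))"
    unfolding FF[symmetric] GG[symmetric] Nc[symmetric] by simp
  also have "(\<Sum>i<n. cnj (c i) * F (w i)) - (\<Sum>i<n. cnj (c i) * b (w i) * G (w i)) =
     (\<Sum>i<n. \<Sum>j<n. cnj (c i) * c j * kb b (w j) (w i))"
    unfolding F_def G_def szego_def d_def kb_def sum_subtractf[symmetric] sum_distrib_left
    by (intro sum.cong refl) (simp add: diff_divide_distrib algebra_simps)
  finally show ?thesis
    by (simp add: F_def)
qed

end

lemma scaled_disc:
  fixes r :: real
  assumes "0 < r" "r < 1" "cmod z \<le> 1"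
  shows "cmod (of_real r * z) < 1"
proof -
  have "cmod (of_real r * z) = r * cmod z" "r * cmod z \<le> r"
    using assms by (auto simp: norm_mult intro: mult_left_le)
  then show ?thesis
    using assms by linarith
qed

lemma holomorphic_scaled:
  fixes r :: real
  assumes f: "f holomorphic_on ball 0 1" and r: "0 < r" "r < 1"
  shows "continuous_on (cball 0 1) (\<lambda>z. f (of_real r * z))" "(\<lambda>z. f (of_real r * z)) holomorphic_on ball 0 1"
proof -
  show "continuous_on (cball 0 1) (\<lambda>z. f (of_real r * z))"
    by (rule continuous_on_compose2[OF holomorphic_on_imp_continuous_on[OF f]])
       (auto intro!: continuous_intros scaled_disc r)
  show "(\<lambda>z. f (of_real r * z)) holomorphic_on ball 0 1"
  proof (rule holomorphic_on_compose_gen[OF _ f, unfolded o_def])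
    show "(*) (of_real r) ` ball 0 1 \<subseteq> ball (0::complex) 1"
      using scaled_disc[OF r] by (auto simp: less_imp_le)
  qed (intro holomorphic_intros)
qed

lemma tendsto_scaled:
  assumes f: "f holomorphic_on ball 0 1" and z: "cmod z < 1"
  shows "((\<lambda>r::real. f (of_real r * z)) \<longlongrightarrow> f z) (at_left 1)"
proof -
  have "isCont f z"
    using holomorphic_on_imp_continuous_on[OF f] z by (simp add: continuous_on_eq_continuous_at)
  then have "((\<lambda>r::real. f (of_real r * z)) \<longlongrightarrow> f (of_real 1 * z)) (at_left 1)"
    by (intro isCont_tendsto_compose[of _ f] tendsto_intros) simp
  then show ?thesis
    by simp
qed

text \<open>Boundary values are avoided by dilation: for r < 1 the functions a(r z) and b(r z) are
  continuous on the closed disk, and the hypothesis inside the disk gives their inequality on the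
  circle. The kernel form is a finite sum, so it depends continuously on r and the constant survives
  the limit.\<close>

lemma deBR_limitI:
  assumes b: "b \<in> Hinf_ball" and a: "a holomorphic_on ball 0 1"
    and ab: "\<And>z. cmod z < 1 \<Longrightarrow> (cmod (a z))\<^sup>2 + (cmod (b z))\<^sup>2 \<le> 1" and C: "0 \<le> C"
    and le: "\<And>r n w c. 0 < r \<Longrightarrow> r < 1 \<Longrightarrow> \<forall>i<n. w i \<in> ball 0 1 \<Longrightarrow>
      (cmod (\<Sum>i<n. cnj (c i) * f r (w i)))\<^sup>2 \<le> C * integral\<^sup>L circ (\<lambda>t. (cmod (a (of_real r * cis t) * szego n w c (cis t)))\<^sup>2)"
    and lim: "\<And>z. cmod z < 1 \<Longrightarrow> ((\<lambda>r. f r z) \<longlongrightarrow> g z) (at_left (1::real))"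
  shows "g \<in> deBR b"
  unfolding deBR_def
proof (clarify, intro exI[of _ C] allI impI)
  fix n :: nat and w c :: "nat \<Rightarrow> complex"
  assume w: "\<forall>i<n. w i \<in> ball 0 1"
  have bh: "b holomorphic_on ball 0 1"
    using b by (simp add: Hinf_ball_def)
  let ?Q = "\<lambda>B. Re (\<Sum>i<n. \<Sum>j<n. cnj (c i) * c j * kb B (w j) (w i))"
  show "(cmod (\<Sum>i<n. cnj (c i) * g (w i)))\<^sup>2 \<le> C * ?Q b"
  proof (rule tendsto_le[of "at_left (1::real)"])
    show "((\<lambda>r. (cmod (\<Sum>i<n. cnj (c i) * f r (w i)))\<^sup>2) \<longlongrightarrow> (cmod (\<Sum>i<n. cnj (c i) * g (w i)))\<^sup>2) (at_left 1)"
      using w by (intro tendsto_intros lim) auto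
    show "((\<lambda>r. C * ?Q (\<lambda>z. b (of_real r * z))) \<longlongrightarrow> C * ?Q b) (at_left 1)"
      unfolding kb_def using w
      by (intro tendsto_intros tendsto_scaled[OF bh]) (auto simp: cnj_mult_neq_1 less_imp_le)
    show "eventually (\<lambda>r. (cmod (\<Sum>i<n. cnj (c i) * f r (w i)))\<^sup>2 \<le> C * ?Q (\<lambda>z. b (of_real r * z))) (at_left 1)"
    proof (rule eventually_at_leftI[of 0])
      fix r :: real assume "r \<in> {0<..<1}"
      then have r: "0 < r" "r < 1"
        by auto
      have "integral\<^sup>L circ (\<lambda>t. (cmod (a (of_real r * cis t) * szego n w c (cis t)))\<^sup>2) \<le> ?Q (\<lambda>z. b (of_real r * z))"
      proof (rule mate_times_szego_le_kernel[OF w, of "\<lambda>z. b (of_real r * z)" "\<lambda>z. a (of_real r * z)"])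
        show "continuous_on (cball 0 1) (\<lambda>z. b (of_real r * z))" "(\<lambda>z. b (of_real r * z)) holomorphic_on ball 0 1"
          by (rule holomorphic_scaled[OF bh r])+
        show "continuous_on UNIV (\<lambda>t. a (of_real r * cis t))"
          using r by (intro continuous_on_circle_of_ball[OF a]) auto
      qed (intro ab scaled_disc r, simp)
      then show "(cmod (\<Sum>i<n. cnj (c i) * f r (w i)))\<^sup>2 \<le> C * ?Q (\<lambda>z. b (of_real r * z))"
        using le[OF r w, of c] mult_left_mono[OF _ C] order_trans by blast
    qed simp
  qed simp
qed


section \<open>Linear operations on \<open>deBR b\<close>\<close>

lemma deBR_add:
  assumes "f \<in> deBR b" "g \<in> deBR b"
  shows "(\<lambda>z. f z + g z) \<in> deBR b"
proof -
  from assms obtain C D where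
    C: "\<And>(n::nat) (w::nat \<Rightarrow> complex) (c::nat \<Rightarrow> complex). \<forall>i<n. w i \<in> ball 0 1 \<Longrightarrow>
       (cmod (\<Sum>i<n. cnj (c i) * f (w i)))^2 \<le> C * Re (\<Sum>i<n. \<Sum>j<n. cnj (c i) * c j * kb b (w j) (w i))" and
    D: "\<And>(n::nat) (w::nat \<Rightarrow> complex) (c::nat \<Rightarrow> complex). \<forall>i<n. w i \<in> ball 0 1 \<Longrightarrow>
       (cmod (\<Sum>i<n. cnj (c i) * g (w i)))^2 \<le> D * Re (\<Sum>i<n. \<Sum>j<n. cnj (c i) * c j * kb b (w j) (w i))"
    unfolding deBR_def by blast
  have sq: "(cmod (x + y))\<^sup>2 \<le> 2 * (cmod x)\<^sup>2 + 2 * (cmod y)\<^sup>2" for x y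
  proof -
    have "(cmod (x + y))\<^sup>2 \<le> (cmod x + cmod y)\<^sup>2"
      by (intro power_mono norm_triangle_ineq) simp
    also have "\<dots> \<le> 2 * (cmod x)\<^sup>2 + 2 * (cmod y)\<^sup>2"
      using zero_le_power2[of "cmod x - cmod y"] by (simp add: power2_eq_square algebra_simps)
    finally show ?thesis .
  qed
  show ?thesis
    unfolding deBR_def
  proof (clarify, intro exI[of _ "2 * C + 2 * D"] allI impI)
    fix n :: nat and w c :: "nat \<Rightarrow> complex"
    assume w: "\<forall>i<n. w i \<in> ball 0 1"
    let ?Q = "Re (\<Sum>i<n. \<Sum>j<n. cnj (c i) * c j * kb b (w j) (w i))"
    have "(\<Sum>i<n. cnj (c i) * (f (w i) + g (w i))) = (\<Sum>i<n. cnj (c i) * f (w i)) + (\<Sum>i<n. cnj (c i) * g (w i))"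
      by (simp add: distrib_left sum.distrib)
    then have "(cmod (\<Sum>i<n. cnj (c i) * (f (w i) + g (w i))))\<^sup>2 \<le> 2 * (C * ?Q) + 2 * (D * ?Q)"
      using sq[of "\<Sum>i<n. cnj (c i) * f (w i)" "\<Sum>i<n. cnj (c i) * g (w i)"] C[OF w, of c] D[OF w, of c] by simp
    then show "(cmod (\<Sum>i<n. cnj (c i) * (f (w i) + g (w i))))\<^sup>2 \<le> (2 * C + 2 * D) * ?Q"
      by (simp add: algebra_simps)
  qed
qed

lemma deBR_scale:
  assumes "f \<in> deBR b"
  shows "(\<lambda>z. \<alpha> * f z) \<in> deBR b"
proof -
  from assms obtain C where
    C: "\<And>(n::nat) (w::nat \<Rightarrow> complex) (c::nat \<Rightarrow> complex). \<forall>i<n. w i \<in> ball 0 1 \<Longrightarrow>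
       (cmod (\<Sum>i<n. cnj (c i) * f (w i)))^2 \<le> C * Re (\<Sum>i<n. \<Sum>j<n. cnj (c i) * c j * kb b (w j) (w i))"
    unfolding deBR_def by blast
  show ?thesis
    unfolding deBR_def
  proof (clarify, intro exI[of _ "(cmod \<alpha>)\<^sup>2 * C"] allI impI)
    fix n :: nat and w c :: "nat \<Rightarrow> complex"
    assume w: "\<forall>i<n. w i \<in> ball 0 1"
    let ?Q = "Re (\<Sum>i<n. \<Sum>j<n. cnj (c i) * c j * kb b (w j) (w i))"
    have "(\<Sum>i<n. cnj (c i) * (\<alpha> * f (w i))) = \<alpha> * (\<Sum>i<n. cnj (c i) * f (w i))"
      by (simp add: sum_distrib_left mult_ac)
    then have "(cmod (\<Sum>i<n. cnj (c i) * (\<alpha> * f (w i))))\<^sup>2 = (cmod \<alpha>)\<^sup>2 * (cmod (\<Sum>i<n. cnj (c i) * f (w i)))\<^sup>2"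
      by (simp add: norm_mult power_mult_distrib)
    also have "\<dots> \<le> (cmod \<alpha>)\<^sup>2 * (C * ?Q)"
      by (intro mult_left_mono C[OF w]) simp
    finally show "(cmod (\<Sum>i<n. cnj (c i) * (\<alpha> * f (w i))))\<^sup>2 \<le> (cmod \<alpha>)\<^sup>2 * C * ?Q"
      by (simp only: mult.assoc)
  qed
qed

lemma deBR_zero: "(\<lambda>z. 0) \<in> deBR b"
  unfolding deBR_def by (auto intro!: exI[of _ 0])

lemma deBR_sum:
  assumes "finite A" "\<And>m. m \<in> A \<Longrightarrow> f m \<in> deBR b"
  shows "(\<lambda>z. \<Sum>m\<in>A. f m z) \<in> deBR b"
  using assms by (induction A rule: finite_induct) (auto intro: deBR_zero deBR_add)

lemma deBR_cong:
  assumes "f \<in> deBR b" "\<And>z. z \<in> ball 0 1 \<Longrightarrow> f z = g z"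
  shows "g \<in> deBR b"
proof -
  from assms(1) obtain C where
    C: "\<And>(n::nat) (w::nat \<Rightarrow> complex) (c::nat \<Rightarrow> complex). \<forall>i<n. w i \<in> ball 0 1 \<Longrightarrow>
       (cmod (\<Sum>i<n. cnj (c i) * f (w i)))^2 \<le> C * Re (\<Sum>i<n. \<Sum>j<n. cnj (c i) * c j * kb b (w j) (w i))"
    unfolding deBR_def by blast
  show ?thesis
    unfolding deBR_def
  proof (clarify, intro exI[of _ C] allI impI)
    fix n :: nat and w c :: "nat \<Rightarrow> complex"
    assume w: "\<forall>i<n. w i \<in> ball 0 1"
    have "(\<Sum>i<n. cnj (c i) * g (w i)) = (\<Sum>i<n. cnj (c i) * f (w i))"
      using assms(2) w by (intro sum.cong) auto
    then show "(cmod (\<Sum>i<n. cnj (c i) * g (w i)))\<^sup>2 \<le> C * Re (\<Sum>i<n. \<Sum>j<n. cnj (c i) * c j * kb b (w j) (w i))"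
      using C[OF w, of c] by simp
  qed
qed

section \<open>Products with the mate, and polynomials, in \<open>deBR b\<close>\<close>

lemma H2_iff:
  "f \<in> H2 \<longleftrightarrow> f holomorphic_on ball 0 1 \<and>
     (\<exists>C. \<forall>r\<in>{0..<1}. integral\<^sup>L circ (\<lambda>t. (cmod (f (of_real r * cis t)))\<^sup>2) \<le> C)"
proof -
  have eq: "integral {0..2*pi} (\<lambda>t. (cmod (f (of_real r * cis t)))\<^sup>2) = 2 * pi * integral\<^sup>L circ (\<lambda>t. (cmod (f (of_real r * cis t)))\<^sup>2)"
    if "f holomorphic_on ball 0 1" "r \<in> {0..<1}" for r
    using that by (subst integral_circ_continuous) (auto intro!: continuous_intros continuous_on_circle_of_ball)
  have "(\<exists>C. \<forall>r\<in>{0..<1}. integral {0..2*pi} (\<lambda>t. (cmod (f (of_real r * cis t)))\<^sup>2) \<le> C) \<longleftrightarrow>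
     (\<exists>C. \<forall>r\<in>{0..<1}. integral\<^sup>L circ (\<lambda>t. (cmod (f (of_real r * cis t)))\<^sup>2) \<le> C)" (is "?A = ?B")
    if h: "f holomorphic_on ball 0 1"
  proof
    assume ?A
    then obtain C where "\<forall>r\<in>{0..<1}. integral {0..2*pi} (\<lambda>t. (cmod (f (of_real r * cis t)))\<^sup>2) \<le> C"
      by blast
    then have "\<forall>r\<in>{0..<1}. 2 * pi * integral\<^sup>L circ (\<lambda>t. (cmod (f (of_real r * cis t)))\<^sup>2) \<le> C"
      using eq[OF h] by simp
    then show ?B
      by (intro exI[of _ "C / (2*pi)"]) (simp add: pos_le_divide_eq mult_ac)
  next
    assume ?B
    then obtain C where "\<forall>r\<in>{0..<1}. integral\<^sup>L circ (\<lambda>t. (cmod (f (of_real r * cis t)))\<^sup>2) \<le> C"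
      by blast
    then show ?A
      by (intro exI[of _ "2 * pi * C"]) (auto simp: eq[OF h])
  qed
  then show ?thesis
    unfolding H2_def by auto
qed

text \<open>Moving a to the other side, the functional pairs h with the product of cnj a and the
  test function. Cauchy-Schwarz leaves the norm of h times the norm of a F, and the latter is what
  the kernel form dominates.\<close>

lemma mate_times_H2_in_deBR:
  assumes b: "b \<in> Hinf_ball" and a: "a holomorphic_on ball 0 1"
    and ab: "\<And>z. cmod z < 1 \<Longrightarrow> (cmod (a z))\<^sup>2 + (cmod (b z))\<^sup>2 \<le> 1" and h: "h \<in> H2"
  shows "(\<lambda>z. a z * h z) \<in> deBR b"
proof -
  obtain C where hh: "h holomorphic_on ball 0 1" and C: "\<And>r. r \<in> {0..<1} \<Longrightarrow> integral\<^sup>L circ (\<lambda>t. (cmod (h (of_real r * cis t)))\<^sup>2) \<le> C"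
    using h unfolding H2_iff by blast
  have "0 \<le> integral\<^sup>L circ (\<lambda>t. (cmod (h (of_real 0 * cis t)))\<^sup>2)"
    by (rule Bochner_Integration.integral_nonneg) auto
  moreover have "integral\<^sup>L circ (\<lambda>t. (cmod (h (of_real 0 * cis t)))\<^sup>2) \<le> C"
    by (rule C) simp
  ultimately have C0: "0 \<le> C"
    by linarith
  show ?thesis
  proof (rule deBR_limitI[OF b a ab C0, where f = "\<lambda>r z. a (of_real r * z) * h (of_real r * z)"])
    fix r :: real and n and w c :: "nat \<Rightarrow> complex"
    assume r: "0 < r" "r < 1" and w: "\<forall>i<n. w i \<in> ball 0 1"
    note sa = holomorphic_scaled[OF a r] and sh = holomorphic_scaled[OF hh r]
    have "(\<Sum>i<n. cnj (c i) * (a (of_real r * w i) * h (of_real r * w i))) =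
      integral\<^sup>L circ (\<lambda>t. a (of_real r * cis t) * h (of_real r * cis t) * cnj (szego n w c (cis t)))"
      using sa sh by (intro szego_reproducing[OF w, of "\<lambda>z. a (of_real r * z) * h (of_real r * z)", symmetric] continuous_intros holomorphic_intros)
    also have "\<dots> = integral\<^sup>L circ (\<lambda>t. h (of_real r * cis t) * (a (of_real r * cis t) * cnj (szego n w c (cis t))))"
      by (simp add: mult_ac)
    finally have eq: "(\<Sum>i<n. cnj (c i) * (a (of_real r * w i) * h (of_real r * w i))) =
      integral\<^sup>L circ (\<lambda>t. h (of_real r * cis t) * (a (of_real r * cis t) * cnj (szego n w c (cis t))))" .
    have "(cmod (\<Sum>i<n. cnj (c i) * (a (of_real r * w i) * h (of_real r * w i))))\<^sup>2 \<le>
       integral\<^sup>L circ (\<lambda>t. (cmod (h (of_real r * cis t)))\<^sup>2) *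
       integral\<^sup>L circ (\<lambda>t. (cmod (a (of_real r * cis t) * cnj (szego n w c (cis t))))\<^sup>2)"
      unfolding eq using r
      by (intro Cauchy_Schwarz_circ continuous_intros continuous_on_circle_of_ball a hh szego_circle[OF w]) auto
    also have "\<dots> \<le> C * integral\<^sup>L circ (\<lambda>t. (cmod (a (of_real r * cis t) * cnj (szego n w c (cis t))))\<^sup>2)"
      using r by (intro mult_right_mono C Bochner_Integration.integral_nonneg) auto
    finally show "(cmod (\<Sum>i<n. cnj (c i) * (a (of_real r * w i) * h (of_real r * w i))))\<^sup>2 \<le>
       C * integral\<^sup>L circ (\<lambda>t. (cmod (a (of_real r * cis t) * szego n w c (cis t)))\<^sup>2)"
      by (simp add: norm_mult)
  next
    show "((\<lambda>r. a (of_real r * z) * h (of_real r * z)) \<longlongrightarrow> a z * h z) (at_left (1::real))" if "cmod z < 1" for z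
      by (intro tendsto_intros tendsto_scaled a hh that)
  qed
qed

text \<open>The function is \<open>T\<^sub>a\<^sup>* z\<^sup>n\<close>, the image of a monomial under the co-analytic Toeplitz operator.\<close>

lemma coanalytic_monomial_in_deBR:
  assumes b: "b \<in> Hinf_ball" and a: "a holomorphic_on ball 0 1"
    and ab: "\<And>z. cmod z < 1 \<Longrightarrow> (cmod (a z))\<^sup>2 + (cmod (b z))\<^sup>2 \<le> 1"
  shows "(\<lambda>z. \<Sum>m\<le>n. cnj (tcoeff a (n - m)) * z ^ m) \<in> deBR b"
proof -
  \<comment> \<open>The Cauchy integral of cnj a times the character of frequency n, that is, its
    analytic projection, taken on the circle of radius r.\<close>
  define T where "T n r z = integral\<^sup>L circ (\<lambda>t. cnj (a (of_real r * cis t)) * cis (real n * t) / (1 - z * cis (-t)))" for n r z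
  have ne: "1 - z * cis (-t) \<noteq> 0" if "cmod z < 1" for z t
    using one_minus_cnj_mult_neq_0[of "cnj z" "cis (-t)"] that by auto
  have T: "T n r z = (\<Sum>m\<le>n. cnj (of_real r ^ (n - m) * tcoeff a (n - m)) * z ^ m)"
    if r: "0 < r" "r < 1" and z: "cmod z < 1" for n r z
  proof (induction n)
    case 0
    have "T 0 r z = integral\<^sup>L circ (\<lambda>t. cnj (a (of_real r * cis t) / (1 - cnj z * cis t)))"
      by (simp add: T_def cis_cnj)
    also have "\<dots> = cnj (integral\<^sup>L circ (\<lambda>t. a (of_real r * cis t) / (1 - cnj z * cis t) / (1 - 0 * cis (-t))))"
      by (simp only: Bochner_Integration.integral_cnj mult_zero_left diff_zero div_by_1)
    also have "integral\<^sup>L circ (\<lambda>t. a (of_real r * cis t) / (1 - cnj z * cis t) / (1 - 0 * cis (-t))) = a (of_real r * 0) / (1 - cnj z * 0)"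
    proof (rule Cauchy_formula_circ[of "\<lambda>u. a (of_real r * u) / (1 - cnj z * u)"])
      show "continuous_on (cball 0 1) (\<lambda>u. a (of_real r * u) / (1 - cnj z * u))"
        using z by (intro continuous_intros holomorphic_scaled[OF a r]) (auto simp: cnj_mult_neq_1)
      show "(\<lambda>u. a (of_real r * u) / (1 - cnj z * u)) holomorphic_on ball 0 1"
        using z by (intro holomorphic_intros holomorphic_scaled[OF a r]) (auto simp: cnj_mult_neq_1)
    qed simp
    finally show ?case
      by (simp add: tcoeff_def)
  next
    case (Suc n)
    have ac: "continuous_on UNIV (\<lambda>t. a (of_real r * cis t))"
      using r by (intro continuous_on_circle_of_ball a) auto
    have "tcoeff (\<lambda>u. a (of_real r * u)) (Suc n) = of_real r ^ Suc n * tcoeff a (Suc n)"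
    proof -
      have "(deriv ^^ Suc n) (\<lambda>u. a (of_real r * u)) 0 = of_real r ^ Suc n * (deriv ^^ Suc n) a (of_real r * 0)"
        by (rule higher_deriv_compose_linear[OF a, of "ball 0 1"]) (use r in \<open>auto intro!: scaled_disc\<close>)
      then show ?thesis
        by (simp add: tcoeff_def)
    qed
    then have "integral\<^sup>L circ (\<lambda>t. a (of_real r * cis t) * cis (- (real (Suc n) * t))) = of_real r ^ Suc n * tcoeff a (Suc n)"
      using coeff_circ[OF holomorphic_scaled[OF a r], of "Suc n"] by (simp only: tcoeff_def)
    then have "cnj (integral\<^sup>L circ (\<lambda>t. a (of_real r * cis t) * cis (- (real (Suc n) * t)))) = cnj (of_real r ^ Suc n * tcoeff a (Suc n))"
      by simp
    then have I1: "integral\<^sup>L circ (\<lambda>t. cnj (a (of_real r * cis t)) * cis (real (Suc n) * t)) = cnj (of_real r ^ Suc n * tcoeff a (Suc n))"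
      by (simp only: Bochner_Integration.integral_cnj[symmetric] complex_cnj_mult cis_cnj minus_minus)
    \<comment> \<open>One term of the geometric series of the kernel is split off: it gives a
      coefficient of a, and the remainder is z times the integral with frequency n.\<close>
    have "T (Suc n) r z = integral\<^sup>L circ (\<lambda>t. cnj (a (of_real r * cis t)) * cis (real (Suc n) * t) +
       z * (cnj (a (of_real r * cis t)) * cis (real n * t) / (1 - z * cis (-t))))"
      unfolding T_def
    proof (rule Bochner_Integration.integral_cong[OF refl])
      fix t
      have "cis (real (Suc n) * t) * cis (-t) = cis (real n * t)"
        by (simp add: cis_mult algebra_simps)
      then have split: "A * cis (real (Suc n) * t) = (A * cis (real (Suc n) * t)) * (1 - z * cis (-t)) + z * (A * cis (real n * t))" for A
        by (simp add: algebra_simps)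
      have quot: "x / d = x + z * (y / d)" if "x = x * d + z * y" "d \<noteq> 0" for x y d
      proof -
        have "x / d = (x * d + z * y) / d"
          using that(1) by simp
        then show ?thesis
          using that(2) by (simp add: add_divide_distrib)
      qed
      show "cnj (a (of_real r * cis t)) * cis (real (Suc n) * t) / (1 - z * cis (-t)) =
          cnj (a (of_real r * cis t)) * cis (real (Suc n) * t) + z * (cnj (a (of_real r * cis t)) * cis (real n * t) / (1 - z * cis (-t)))"
        by (rule quot[OF split ne[OF z]])
    qed
    also have "\<dots> = integral\<^sup>L circ (\<lambda>t. cnj (a (of_real r * cis t)) * cis (real (Suc n) * t)) +
       integral\<^sup>L circ (\<lambda>t. z * (cnj (a (of_real r * cis t)) * cis (real n * t) / (1 - z * cis (-t))))"
      using ne[OF z] by (intro Bochner_Integration.integral_add integrable_circ_continuous continuous_intros ac) auto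
    also have "\<dots> = cnj (of_real r ^ Suc n * tcoeff a (Suc n)) + z * T n r z"
      unfolding I1 T_def by (simp only: integral_mult_right_zero)
    also have "\<dots> = (\<Sum>m\<le>Suc n. cnj (of_real r ^ (Suc n - m) * tcoeff a (Suc n - m)) * z ^ m)"
      unfolding Suc sum.atMost_Suc_shift sum_distrib_left by (simp add: mult_ac)
    finally show ?case .
  qed
  show ?thesis
  proof (rule deBR_limitI[OF b a ab zero_le_one, where f = "T n"])
    fix r :: real and N and w c :: "nat \<Rightarrow> complex"
    assume r: "0 < r" "r < 1" and w: "\<forall>i<N. w i \<in> ball 0 1"
    have ac: "continuous_on UNIV (\<lambda>t. a (of_real r * cis t))"
      using r by (intro continuous_on_circle_of_ball a) auto
    have "(\<Sum>i<N. cnj (c i) * T n r (w i)) = (\<Sum>i<N. integral\<^sup>L circ (\<lambda>t. cnj (c i) * (cnj (a (of_real r * cis t)) * cis (real n * t) / (1 - w i * cis (-t)))))"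
      unfolding T_def by (simp only: integral_mult_right_zero)
    also have "\<dots> = integral\<^sup>L circ (\<lambda>t. \<Sum>i<N. cnj (c i) * (cnj (a (of_real r * cis t)) * cis (real n * t) / (1 - w i * cis (-t))))"
      using w ne by (intro Bochner_Integration.integral_sum[symmetric] integrable_circ_continuous continuous_intros ac) auto
    also have "\<dots> = integral\<^sup>L circ (\<lambda>t. cis (real n * t) * (cnj (a (of_real r * cis t)) * cnj (szego N w c (cis t))))"
      by (simp add: szego_def sum_distrib_left cis_cnj mult_ac)
    finally have eq: "(\<Sum>i<N. cnj (c i) * T n r (w i)) = integral\<^sup>L circ (\<lambda>t. cis (real n * t) * (cnj (a (of_real r * cis t)) * cnj (szego N w c (cis t))))" .
    have "(cmod (\<Sum>i<N. cnj (c i) * T n r (w i)))\<^sup>2 \<le>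
       integral\<^sup>L circ (\<lambda>t. (cmod (cis (real n * t)))\<^sup>2) *
       integral\<^sup>L circ (\<lambda>t. (cmod (cnj (a (of_real r * cis t)) * cnj (szego N w c (cis t))))\<^sup>2)"
      unfolding eq by (intro Cauchy_Schwarz_circ continuous_intros ac szego_circle[OF w])
    then show "(cmod (\<Sum>i<N. cnj (c i) * T n r (w i)))\<^sup>2 \<le> 1 * integral\<^sup>L circ (\<lambda>t. (cmod (a (of_real r * cis t) * szego N w c (cis t)))\<^sup>2)"
      by (simp add: norm_mult)
  next
    fix z :: complex assume z: "cmod z < 1"
    have "((\<lambda>r::real. \<Sum>m\<le>n. cnj (of_real r ^ (n - m) * tcoeff a (n - m)) * z ^ m) \<longlongrightarrow>
        (\<Sum>m\<le>n. cnj (of_real 1 ^ (n - m) * tcoeff a (n - m)) * z ^ m)) (at_left 1)"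
      by (intro tendsto_intros)
    then have "((\<lambda>r. T n r z) \<longlongrightarrow> (\<Sum>m\<le>n. cnj (of_real 1 ^ (n - m) * tcoeff a (n - m)) * z ^ m)) (at_left 1)"
      by (rule Lim_transform_eventually) (auto intro!: eventually_at_leftI[of 0] simp: T z)
    then show "((\<lambda>r. T n r z) \<longlongrightarrow> (\<Sum>m\<le>n. cnj (tcoeff a (n - m)) * z ^ m)) (at_left 1)"
      by simp
  qed
qed

text \<open>The co-analytic image of z^n is cnj (a 0) z^n plus lower powers. The system is
  triangular with nonzero diagonal, so strong induction inverts it.\<close>

lemma monomial_in_deBR:
  assumes b: "b \<in> Hinf_ball" and a: "a holomorphic_on ball 0 1"
    and ab: "\<And>z. cmod z < 1 \<Longrightarrow> (cmod (a z))\<^sup>2 + (cmod (b z))\<^sup>2 \<le> 1" and a0: "a 0 \<noteq> 0"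
  shows "(\<lambda>z. z ^ n) \<in> deBR b"
proof (induction n rule: less_induct)
  case (less n)
  have "(\<lambda>z. (\<Sum>m\<le>n. cnj (tcoeff a (n - m)) * z ^ m) + (\<Sum>m<n. (- cnj (tcoeff a (n - m))) * z ^ m)) \<in> deBR b"
    by (intro deBR_add coanalytic_monomial_in_deBR[OF b a ab] deBR_sum deBR_scale less) auto
  then have "(\<lambda>z. inverse (cnj (a 0)) * ((\<Sum>m\<le>n. cnj (tcoeff a (n - m)) * z ^ m) + (\<Sum>m<n. (- cnj (tcoeff a (n - m))) * z ^ m))) \<in> deBR b"
    by (rule deBR_scale)
  then show ?case
    by (rule deBR_cong) (use a0 in \<open>simp add: sum_negf tcoeff_def flip: lessThan_Suc_atMost\<close>)
qed

lemma poly_in_deBR: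
  assumes "b \<in> Hinf_ball" "a holomorphic_on ball 0 1"
    "\<And>z. cmod z < 1 \<Longrightarrow> (cmod (a z))\<^sup>2 + (cmod (b z))\<^sup>2 \<le> 1" "a 0 \<noteq> 0"
  shows "poly q \<in> deBR b"
proof -
  have "(\<lambda>z. \<Sum>m\<le>degree q. coeff q m * z ^ m) \<in> deBR b"
    by (intro deBR_sum deBR_scale monomial_in_deBR[where a = a] assms) auto
  then show ?thesis
    by (rule deBR_cong) (simp add: poly_altdef)
qed

subsection \<open>Area integrals over the disk\<close>

text \<open>Comparison on boxes. It allows the plane to be integrated one real coordinate at a time,
  which is what the shears require.\<close>

lemma lborel_complex: "distr (lborel \<Otimes>\<^sub>M lborel) borel (\<lambda>(x, y). Complex x y) = lborel"
proof (rule lborel_eqI[symmetric])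
  have m[measurable]: "(\<lambda>p. Complex (fst p) (snd p)) \<in> borel_measurable borel"
    by (intro borel_measurable_continuous_onI continuous_intros)
  then have m2: "(\<lambda>(x, y). Complex x y) \<in> measurable (lborel \<Otimes>\<^sub>M lborel) borel"
    by (simp add: case_prod_beta' lborel_prod)
  fix l u :: complex
  assume lu: "\<And>b. b \<in> Basis \<Longrightarrow> l \<bullet> b \<le> u \<bullet> b"
  then have le: "Re l \<le> Re u" "Im l \<le> Im u"
    using lu[of 1] lu[of \<i>] by (auto simp: Basis_complex_def)
  have "emeasure (distr (lborel \<Otimes>\<^sub>M lborel) borel (\<lambda>(x, y). Complex x y)) (box l u) =
     emeasure (lborel \<Otimes>\<^sub>M lborel) ({Re l<..<Re u} \<times> {Im l<..<Im u})"
    by (subst emeasure_distr[OF m2])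
       (auto intro!: arg_cong[where f = "emeasure _"] simp: in_box_complex_iff space_pair_measure)
  also have "\<dots> = emeasure lborel {Re l<..<Re u} * emeasure lborel {Im l<..<Im u}"
    by (rule lborel.emeasure_pair_measure_Times) auto
  also have "\<dots> = ennreal (\<Prod>b\<in>Basis. (u - l) \<bullet> b)"
    using le by (simp add: Basis_complex_def ennreal_mult)
  finally show "emeasure (distr (lborel \<Otimes>\<^sub>M lborel) borel (\<lambda>(x, y). Complex x y)) (box l u) = ennreal (\<Prod>b\<in>Basis. (u - l) \<bullet> b)" .
qed simp

lemma nn_integral_complex:
  assumes [measurable]: "f \<in> borel_measurable borel"
  shows "(\<integral>\<^sup>+z. f z \<partial>lborel) = (\<integral>\<^sup>+x. \<integral>\<^sup>+y. f (Complex x y) \<partial>lborel \<partial>lborel)"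
    and "(\<integral>\<^sup>+z. f z \<partial>lborel) = (\<integral>\<^sup>+y. \<integral>\<^sup>+x. f (Complex x y) \<partial>lborel \<partial>lborel)"
proof -
  have "(\<lambda>p. Complex (fst p) (snd p)) \<in> borel_measurable borel"
    by (intro borel_measurable_continuous_onI continuous_intros)
  then have m[measurable]: "(\<lambda>(x, y). Complex x y) \<in> measurable (lborel \<Otimes>\<^sub>M lborel) borel"
    by (simp add: case_prod_beta' lborel_prod)
  have "(\<integral>\<^sup>+z. f z \<partial>lborel) = (\<integral>\<^sup>+p. f (Complex (fst p) (snd p)) \<partial>(lborel \<Otimes>\<^sub>M lborel))"
    by (subst lborel_complex[symmetric], subst nn_integral_distr) (auto simp: case_prod_beta')
  also have "\<dots> = (\<integral>\<^sup>+x. \<integral>\<^sup>+y. f (Complex x y) \<partial>lborel \<partial>lborel)"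
    by (subst lborel.nn_integral_fst[symmetric]) (use measurable_compose[OF m assms] in \<open>auto simp: case_prod_beta'\<close>)
  finally show *: "(\<integral>\<^sup>+z. f z \<partial>lborel) = (\<integral>\<^sup>+x. \<integral>\<^sup>+y. f (Complex x y) \<partial>lborel \<partial>lborel)" .
  also have "\<dots> = (\<integral>\<^sup>+y. \<integral>\<^sup>+x. f (Complex x y) \<partial>lborel \<partial>lborel)"
    by (rule lborel_pair.Fubini'[symmetric]) (use measurable_compose[OF m assms] in \<open>auto simp: case_prod_beta'\<close>)
  finally show "(\<integral>\<^sup>+z. f z \<partial>lborel) = (\<integral>\<^sup>+y. \<integral>\<^sup>+x. f (Complex x y) \<partial>lborel \<partial>lborel)" .
qed

lemma nn_integral_shear_Re:
  assumes [measurable]: "f \<in> borel_measurable borel"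
  shows "(\<integral>\<^sup>+z. f (Complex (Re z + k * Im z) (Im z)) \<partial>lborel) = (\<integral>\<^sup>+z. f z \<partial>lborel)"
proof -
  have [measurable]: "(\<lambda>z. Complex (Re z + k * Im z) (Im z)) \<in> borel_measurable borel" 
    "(\<lambda>x. Complex x y) \<in> borel_measurable borel" for y
    by (intro borel_measurable_continuous_onI continuous_intros)+
  have "(\<integral>\<^sup>+x. f (Complex (x + k * y) y) \<partial>lborel) = (\<integral>\<^sup>+x. f (Complex x y) \<partial>lborel)" for y
    using nn_integral_real_affine[of "\<lambda>x. f (Complex x y)" 1 "k * y"] by (simp add: add.commute)
  then show ?thesis
    by (subst (1 2) nn_integral_complex(2)) auto
qed

lemma nn_integral_shear_Im:
  assumes [measurable]: "f \<in> borel_measurable borel"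
  shows "(\<integral>\<^sup>+z. f (Complex (Re z) (Im z + k * Re z)) \<partial>lborel) = (\<integral>\<^sup>+z. f z \<partial>lborel)"
proof -
  have [measurable]: "(\<lambda>z. Complex (Re z) (Im z + k * Re z)) \<in> borel_measurable borel" 
    "(\<lambda>y. Complex x y) \<in> borel_measurable borel" for x
    by (intro borel_measurable_continuous_onI continuous_intros)+
  have "(\<integral>\<^sup>+y. f (Complex x (y + k * x)) \<partial>lborel) = (\<integral>\<^sup>+y. f (Complex x y) \<partial>lborel)" for x
    using nn_integral_real_affine[of "\<lambda>y. f (Complex x y)" 1 "k * x"] by (simp add: add.commute)
  then show ?thesis
    by (subst (1 2) nn_integral_complex(1)) auto
qed

text \<open>A rotation is a product of three shears.\<close>

lemma nn_integral_rotate: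
  assumes f[measurable]: "f \<in> borel_measurable borel"
  shows "(\<integral>\<^sup>+z. f (cis \<theta> * z) \<partial>lborel) = (\<integral>\<^sup>+z. f z \<partial>lborel)"
proof -
  have main: "(\<integral>\<^sup>+z. f (cis \<theta> * z) \<partial>lborel) = (\<integral>\<^sup>+z. f z \<partial>lborel)"
    if c: "cos \<theta> \<noteq> -1" and [measurable]: "f \<in> borel_measurable borel" for \<theta> and f :: "complex \<Rightarrow> ennreal"
  proof -
    \<comment> \<open>This is -tan (\<theta>/2), the coefficient of the two outer shears; the middle
      one has coefficient sin \<theta>.\<close>
    define k where "k = - sin \<theta> / (1 + cos \<theta>)"
    have c1: "1 + cos \<theta> \<noteq> 0"
      using c by linarith
    have sk: "1 + sin \<theta> * k = cos \<theta>"
    proof -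
      have "(1 + sin \<theta> * k) * (1 + cos \<theta>) = 1 + cos \<theta> - (sin \<theta>)\<^sup>2"
        using c1 by (simp add: k_def field_simps power2_eq_square)
      also have "\<dots> = cos \<theta> * (1 + cos \<theta>)"
        by (simp add: sin_squared_eq power2_eq_square algebra_simps)
      finally show ?thesis
        using c1 by simp
    qed
    have kc: "k * (1 + cos \<theta>) = - sin \<theta>"
      using c1 by (simp add: k_def)
    define S1 where "S1 z = Complex (Re z + k * Im z) (Im z)" for z
    define S2 where "S2 z = Complex (Re z) (Im z + sin \<theta> * Re z)" for z
    have [measurable]: "S1 \<in> borel_measurable borel" "S2 \<in> borel_measurable borel"
      unfolding S1_def S2_def by (intro borel_measurable_continuous_onI continuous_intros)+
    have rot: "cis \<theta> * z = S1 (S2 (S1 z))" for z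
    proof (rule complex_eqI)
      have "Re (S1 (S2 (S1 z))) = (1 + sin \<theta> * k) * Re z + k * (1 + (1 + sin \<theta> * k)) * Im z"
        by (simp add: S1_def S2_def algebra_simps)
      also have "\<dots> = cos \<theta> * Re z - sin \<theta> * Im z"
        unfolding sk kc by simp
      finally show "Re (cis \<theta> * z) = Re (S1 (S2 (S1 z)))"
        by simp
      have "Im (S1 (S2 (S1 z))) = sin \<theta> * Re z + (1 + sin \<theta> * k) * Im z"
        by (simp add: S1_def S2_def algebra_simps)
      then show "Im (cis \<theta> * z) = Im (S1 (S2 (S1 z)))"
        unfolding sk by simp
    qed
    have "(\<integral>\<^sup>+z. f (S1 (S2 (S1 z))) \<partial>lborel) = (\<integral>\<^sup>+z. f (S1 (S2 z)) \<partial>lborel)"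
      using nn_integral_shear_Re[of "\<lambda>z. f (S1 (S2 z))" k] by (simp add: S1_def[symmetric])
    also have "\<dots> = (\<integral>\<^sup>+z. f (S1 z) \<partial>lborel)"
      using nn_integral_shear_Im[of "\<lambda>z. f (S1 z)" "sin \<theta>"] by (simp add: S2_def[symmetric])
    also have "\<dots> = (\<integral>\<^sup>+z. f z \<partial>lborel)"
      using nn_integral_shear_Re[of f k] by (simp add: S1_def[symmetric])
    finally show ?thesis
      by (simp add: rot)
  qed
  show ?thesis
  proof (cases "cos \<theta> = -1")
    case False
    then show ?thesis
      by (rule main[OF _ f])
  next
    \<comment> \<open>A half turn has no such factorization; it is performed as two quarter
      turns.\<close>
    case True
    have "cos \<theta> = 2 * (cos (\<theta>/2))\<^sup>2 - 1"
      using cos_double_cos[of "\<theta>/2"] by simp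
    then have "cos (\<theta>/2) \<noteq> -1"
      using True by auto
    have [measurable]: "(\<lambda>z. f (cis (\<theta>/2) * z)) \<in> borel_measurable borel"
      by measurable
    have "(\<integral>\<^sup>+z. f (cis (\<theta>/2) * (cis (\<theta>/2) * z)) \<partial>lborel) = (\<integral>\<^sup>+z. f (cis (\<theta>/2) * z) \<partial>lborel)"
      by (rule main[OF \<open>cos (\<theta>/2) \<noteq> -1\<close>, of "\<lambda>z. f (cis (\<theta>/2) * z)"]) measurable
    also have "\<dots> = (\<integral>\<^sup>+z. f z \<partial>lborel)"
      by (rule main[OF \<open>cos (\<theta>/2) \<noteq> -1\<close> f])
    finally show ?thesis
      by (simp add: cis_mult flip: mult.assoc)
  qed
qed

text \<open>The annulus x < |z|^2 < 1 has area pi (1 - x), so |z|^2 is uniform with total mass pi.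
  Together with invariance under rotations this takes the place of polar coordinates.\<close>

lemma distr_disk_norm_square:
  "distr (density lborel (indicator (ball (0::complex) 1))) borel (\<lambda>z. (cmod z)\<^sup>2) =
   density lborel (\<lambda>s::real. ennreal pi * indicator {0..1} s)"
proof (rule measure_eqI_lessThan)
  have L: "emeasure (distr (density lborel (indicator (ball (0::complex) 1))) borel (\<lambda>z. (cmod z)\<^sup>2)) {x<..} =
     emeasure lborel {z \<in> ball (0::complex) 1. (cmod z)\<^sup>2 > x}" for x
  proof -
    have "emeasure (distr (density lborel (indicator (ball (0::complex) 1))) borel (\<lambda>z. (cmod z)\<^sup>2)) {x<..} =
      emeasure (density lborel (indicator (ball (0::complex) 1))) {z. (cmod z)\<^sup>2 > x}"
      by (subst emeasure_distr) (auto simp: vimage_def)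
    also have "\<dots> = (\<integral>\<^sup>+z. indicator (ball 0 1) z * indicator {z. (cmod z)\<^sup>2 > x} z \<partial>lborel)"
      by (rule emeasure_density[OF borel_measurable_indicator]) auto
    also have "\<dots> = (\<integral>\<^sup>+z. indicator {z \<in> ball (0::complex) 1. (cmod z)\<^sup>2 > x} z \<partial>lborel)"
      by (rule nn_integral_cong) (auto split: split_indicator)
    finally show ?thesis
      by simp
  qed
  have R: "emeasure (density lborel (\<lambda>s::real. ennreal pi * indicator {0..1} s)) {x<..} = ennreal pi * emeasure lborel ({0..1} \<inter> {x<..})" for x
    by (subst emeasure_density) (auto simp: mult.assoc nn_integral_cmult simp flip: indicator_inter_arith)
  fix x :: real
  have "emeasure lborel {z \<in> ball (0::complex) 1. (cmod z)\<^sup>2 > x} = ennreal pi * emeasure lborel ({0..1} \<inter> {x<..})"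
  proof -
    consider "x < 0" | "0 \<le> x" "x < 1" | "1 \<le> x"
      by linarith
    then show ?thesis
    proof cases
      case 1
      then have "{z \<in> ball (0::complex) 1. (cmod z)\<^sup>2 > x} = ball 0 1" "{0..1} \<inter> {x<..} = {0..1}"
        by (auto intro: less_le_trans[OF _ zero_le_power2])
      then show ?thesis
        by (simp add: emeasure_ball unit_ball_vol_2)
    next
      case 2
      have "{z \<in> ball (0::complex) 1. (cmod z)\<^sup>2 > x} = ball 0 1 - cball 0 (sqrt x)"
        using 2 by (auto simp: not_le real_less_lsqrt real_sqrt_less_iff intro: real_less_rsqrt) 
          (metis norm_ge_zero not_le real_sqrt_abs real_sqrt_less_iff abs_of_nonneg)+
      moreover have "{0..1} \<inter> {x<..} = {x<..1}"
        using 2 by auto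
      moreover have "emeasure lborel (ball 0 1 - cball (0::complex) (sqrt x)) = emeasure lborel (ball (0::complex) 1) - emeasure lborel (cball (0::complex) (sqrt x))"
      proof (rule emeasure_Diff)
        have "sqrt x < 1"
          using 2 by simp
        then show "cball (0::complex) (sqrt x) \<in> sets lborel" "cball 0 (sqrt x) \<subseteq> ball (0::complex) 1"
          using le_less_trans[OF _ \<open>sqrt x < 1\<close>] by (auto simp del: real_sqrt_lt_1_iff)
      qed (use 2 in \<open>auto simp: emeasure_cball\<close>)
      ultimately show ?thesis
        using 2 by (simp add: emeasure_ball emeasure_cball unit_ball_vol_2 ennreal_minus algebra_simps flip: ennreal_mult)
    next
      case 3
      have le: "(cmod z)\<^sup>2 \<le> x" if "cmod z < 1" for z
        using that 3 power_le_one[of "cmod z" 2] by simp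
      have "{z \<in> ball (0::complex) 1. (cmod z)\<^sup>2 > x} = {}"
      proof (rule equals0I)
        fix z assume "z \<in> {z \<in> ball (0::complex) 1. (cmod z)\<^sup>2 > x}"
        then have "cmod z < 1" "x < (cmod z)\<^sup>2"
          by auto
        with le[of z] show False
          by simp
      qed
      moreover have "{0..1} \<inter> {x<..} = {}"
        using 3 by auto
      ultimately show ?thesis
        by (simp only: emeasure_empty mult_zero_right)
    qed
  qed
  with L R show "emeasure (distr (density lborel (indicator (ball (0::complex) 1))) borel (\<lambda>z. (cmod z)\<^sup>2)) {x<..} =
     emeasure (density lborel (\<lambda>s::real. ennreal pi * indicator {0..1} s)) {x<..}"
    by simp
  have "emeasure lborel {z \<in> ball (0::complex) 1. (cmod z)\<^sup>2 > x} \<le> emeasure lborel (ball (0::complex) 1)"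
    by (rule emeasure_mono) auto
  also have "\<dots> < \<infinity>"
    by (simp add: emeasure_ball)
  finally show "emeasure (distr (density lborel (indicator (ball (0::complex) 1))) borel (\<lambda>z. (cmod z)\<^sup>2)) {x<..} < \<infinity>"
    unfolding L .
qed auto

lemma nn_integral_disk_radial:
  assumes [measurable]: "\<phi> \<in> borel_measurable borel"
  shows "(\<integral>\<^sup>+z. indicator (ball (0::complex) 1) z * \<phi> ((cmod z)\<^sup>2) \<partial>lborel) = ennreal pi * (\<integral>\<^sup>+s. \<phi> s * indicator {0..1} s \<partial>lborel)"
proof -
  have "(\<integral>\<^sup>+z. indicator (ball (0::complex) 1) z * \<phi> ((cmod z)\<^sup>2) \<partial>lborel) =
    (\<integral>\<^sup>+s. \<phi> s \<partial>distr (density lborel (indicator (ball (0::complex) 1))) borel (\<lambda>z. (cmod z)\<^sup>2))"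
    by (subst nn_integral_distr, simp, simp, subst nn_integral_density[OF borel_measurable_indicator]) auto
  also have "\<dots> = (\<integral>\<^sup>+s. ennreal pi * (\<phi> s * indicator {0..1} s) \<partial>lborel)"
    unfolding distr_disk_norm_square by (subst nn_integral_density) (auto simp: mult_ac)
  finally show ?thesis
    by (simp add: nn_integral_cmult)
qed

lemma nn_integral_power_mult_one_minus:
  "(\<integral>\<^sup>+s. ennreal (s ^ m * (1 - s)) * indicator {0..1} s \<partial>lborel) = ennreal (1 / ((real m + 1) * (real m + 2)))"
proof -
  have "(\<integral>\<^sup>+s. ennreal (s ^ m * (1 - s)) * indicator {0..1} s \<partial>lborel) =
     ennreal ((1 ^ (m+1) / (real m + 1) - 1 ^ (m+2) / (real m + 2)) - (0 ^ (m+1) / (real m + 1) - 0 ^ (m+2) / (real m + 2)))"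
  proof (rule nn_integral_FTC_Icc)
    show "((\<lambda>s. s ^ (m+1) / (real m + 1) - s ^ (m+2) / (real m + 2)) has_real_derivative x ^ m * (1 - x)) (at x)" for x :: real
    proof -
      have "((\<lambda>s. s ^ Suc n / real (Suc n)) has_real_derivative x ^ n) (at x)" for n
        by (rule derivative_eq_intros refl | simp)+
      from DERIV_diff[OF this[of m] this[of "Suc m"]] show ?thesis
        by (simp add: algebra_simps)
    qed
  qed auto
  also have "(1 ^ (m+1) / (real m + 1) - 1 ^ (m+2) / (real m + 2)) - (0 ^ (m+1) / (real m + 1) - 0 ^ (m+2) / (real m + 2)) = 1 / ((real m + 1) * (real m + 2))"
    by (simp add: field_simps)
  finally show ?thesis .
qed


text \<open>By rotation invariance the integrand may be averaged over all rotations; Tonelli moves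
  the average inside, Parseval on each circle separates the coefficients, and the moments of s^m (1
  - s) on the unit interval produce the weights.\<close>

lemma nn_integral_disk_weighted:
  assumes G: "G holomorphic_on ball 0 1"
  shows "(\<integral>\<^sup>+z. ennreal ((cmod (G z))\<^sup>2 * (1 - (cmod z)\<^sup>2)) * indicator (ball 0 1) z \<partial>lborel) =
     (\<Sum>m. ennreal (pi * ((cmod (tcoeff G m))\<^sup>2 / ((real m + 1) * (real m + 2)))))"
proof -
  define f where "f z = ennreal (indicator (ball 0 1) z *\<^sub>R ((cmod (G z))\<^sup>2 * (1 - (cmod z)\<^sup>2)))" for z
  have "(\<lambda>z. indicator (ball 0 1) z *\<^sub>R ((cmod (G z))\<^sup>2 * (1 - (cmod z)\<^sup>2))) \<in> borel_measurable borel"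
    by (intro borel_measurable_continuous_on_indicator continuous_intros holomorphic_on_imp_continuous_on[OF G]) auto
  then have [measurable]: "f \<in> borel_measurable borel"
    unfolding f_def by measurable
  have [measurable]: "cis \<in> borel_measurable borel"
    by (intro borel_measurable_continuous_onI continuous_intros)
  have sf: "sigma_finite_measure circ"
    using circ.sigma_finite_measure_axioms .
  interpret pair_sigma_finite circ "lborel :: complex measure"
    by (intro pair_sigma_finite.intro sf lborel.sigma_finite_measure_axioms)
  have inner: "(\<integral>\<^sup>+t. f (cis t * z) \<partial>circ) =
      (\<Sum>m. ennreal ((cmod (tcoeff G m))\<^sup>2) * (indicator (ball 0 1) z * ennreal (((cmod z)\<^sup>2) ^ m * (1 - (cmod z)\<^sup>2))))" for z
  proof (cases "z \<in> ball 0 1")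
    case True
    then have z: "cmod z < 1"
      by simp
    have i: "integrable circ (\<lambda>t. (1 - (cmod z)\<^sup>2) * (cmod (G (z * cis t)))\<^sup>2)"
      by (intro integrable_circ_continuous continuous_intros continuous_on_circle_of_ball G z)
    have "(\<integral>\<^sup>+t. f (cis t * z) \<partial>circ) = (\<integral>\<^sup>+t. ennreal ((1 - (cmod z)\<^sup>2) * (cmod (G (z * cis t)))\<^sup>2) \<partial>circ)"
      using z by (intro nn_integral_cong) (simp add: f_def norm_mult mult.commute)
    also have "\<dots> = ennreal (integral\<^sup>L circ (\<lambda>t. (1 - (cmod z)\<^sup>2) * (cmod (G (z * cis t)))\<^sup>2))"
      using z by (intro nn_integral_eq_integral[OF i]) (auto simp: power_le_one)
    also have "\<dots> = (\<Sum>m. ennreal ((1 - (cmod z)\<^sup>2) * ((cmod (tcoeff G m))\<^sup>2 * ((cmod z)\<^sup>2) ^ m)))"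
      using z by (intro suminf_ennreal_eq[symmetric])
        (auto simp: power_le_one intro!: sums_mult Parseval_holomorphic[OF G])
    finally show ?thesis
      using True z by (simp add: ennreal_mult power_le_one mult_ac)
  qed (simp add: f_def norm_mult)
  have "(\<integral>\<^sup>+z. ennreal ((cmod (G z))\<^sup>2 * (1 - (cmod z)\<^sup>2)) * indicator (ball 0 1) z \<partial>lborel) = (\<integral>\<^sup>+z. f z \<partial>lborel)"
    by (rule nn_integral_cong) (simp add: f_def split: split_indicator)
  also have "\<dots> = (\<integral>\<^sup>+t. (\<integral>\<^sup>+z. f z \<partial>lborel) \<partial>circ)"
    by (simp add: emeasure_circ_UNIV)
  also have "\<dots> = (\<integral>\<^sup>+t. (\<integral>\<^sup>+z. f (cis t * z) \<partial>lborel) \<partial>circ)"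
    by (simp add: nn_integral_rotate)
  also have "\<dots> = (\<integral>\<^sup>+z. (\<integral>\<^sup>+t. f (cis t * z) \<partial>circ) \<partial>lborel)"
    by (rule Fubini'[symmetric]) measurable
  also have "\<dots> = (\<Sum>m. \<integral>\<^sup>+z. ennreal ((cmod (tcoeff G m))\<^sup>2) * (indicator (ball 0 1) z * ennreal (((cmod z)\<^sup>2) ^ m * (1 - (cmod z)\<^sup>2))) \<partial>lborel)"
    unfolding inner by (intro nn_integral_suminf borel_measurable_times_ennreal borel_measurable_indicator) auto
  also have "\<dots> = (\<Sum>m. ennreal (pi * ((cmod (tcoeff G m))\<^sup>2 / ((real m + 1) * (real m + 2)))))"
  proof (rule suminf_cong)
    fix m
    have "(\<integral>\<^sup>+z. ennreal ((cmod (tcoeff G m))\<^sup>2) * (indicator (ball 0 1) z * ennreal (((cmod z)\<^sup>2) ^ m * (1 - (cmod z)\<^sup>2))) \<partial>lborel)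
      = ennreal ((cmod (tcoeff G m))\<^sup>2) * (\<integral>\<^sup>+z. indicator (ball 0 1) z * ennreal (((cmod z)\<^sup>2) ^ m * (1 - (cmod z)\<^sup>2)) \<partial>lborel)"
      by (intro nn_integral_cmult borel_measurable_times_ennreal borel_measurable_indicator) auto
    also have "\<dots> = ennreal ((cmod (tcoeff G m))\<^sup>2) * (ennreal pi * ennreal (1 / ((real m + 1) * (real m + 2))))"
      by (subst nn_integral_disk_radial) (auto simp: nn_integral_power_mult_one_minus)
    also have "\<dots> = ennreal (pi * ((cmod (tcoeff G m))\<^sup>2 / ((real m + 1) * (real m + 2))))"
      by (simp flip: ennreal_mult add: mult_ac)
    finally show "(\<integral>\<^sup>+z. ennreal ((cmod (tcoeff G m))\<^sup>2) * (indicator (ball 0 1) z * ennreal (((cmod z)\<^sup>2) ^ m * (1 - (cmod z)\<^sup>2))) \<partial>lborel)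
      = ennreal (pi * ((cmod (tcoeff G m))\<^sup>2 / ((real m + 1) * (real m + 2))))" .
  qed
  finally show ?thesis .
qed

subsection \<open>Taylor coefficients and the Hardy space\<close>

lemma tcoeff_unique:
  assumes "\<And>z. cmod z < 1 \<Longrightarrow> (\<lambda>n. c n * z ^ n) sums f z"
  shows "tcoeff f n = c n"
proof -
  have "f has_fps_expansion Abs_fps c"
  proof (rule has_fps_expansionI)
    have "eventually (\<lambda>u::complex. u \<in> ball 0 1) (nhds 0)"
      by (rule eventually_nhds_in_open) auto
    then show "eventually (\<lambda>u. (\<lambda>n. fps_nth (Abs_fps c) n * u ^ n) sums f u) (nhds 0)"
      by eventually_elim (simp add: assms)
  qed
  from fps_nth_fps_expansion[OF this, of n] show ?thesis
    by (simp add: tcoeff_def)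
qed

lemma tcoeff_deriv: "tcoeff (deriv f) n = of_nat (Suc n) * tcoeff f (Suc n)"
  by (simp add: tcoeff_def funpow_Suc_right del: funpow.simps of_nat_Suc)

text \<open>Serves for both relations at a point \<zeta>: f = \<gamma> + (z - \<zeta>) h, and f' =
  (1 - cnj \<zeta> z) G.\<close>

lemma tcoeff_linear_mult:
  assumes g: "g holomorphic_on ball 0 1" and f: "\<And>z. cmod z < 1 \<Longrightarrow> f z = \<gamma> + (\<alpha> + \<beta> * z) * g z"
  shows "tcoeff f (Suc n) = \<alpha> * tcoeff g (Suc n) + \<beta> * tcoeff g n" "tcoeff f 0 = \<gamma> + \<alpha> * tcoeff g 0"
proof -
  define c where "c n = (case n of 0 \<Rightarrow> \<gamma> + \<alpha> * tcoeff g 0 | Suc k \<Rightarrow> \<alpha> * tcoeff g (Suc k) + \<beta> * tcoeff g k)" for n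
  have "(\<lambda>n. c n * z ^ n) sums f z" if z: "cmod z < 1" for z
  proof -
    have s: "(\<lambda>n. tcoeff g n * z ^ n) sums g z"
      by (rule tcoeff_sums[OF g z])
    then have "(\<lambda>n. tcoeff g (Suc n) * z ^ Suc n) sums (g z - tcoeff g 0)"
      by (subst sums_Suc_iff) simp
    from sums_add[OF sums_mult[OF this, of \<alpha>] sums_mult[OF s, of "\<beta> * z"]]
    have "(\<lambda>n. c (Suc n) * z ^ Suc n) sums (f z - c 0 * z ^ 0)"
      by (simp add: c_def f[OF z] algebra_simps)
    then show ?thesis
      by (subst (asm) sums_Suc_iff) simp
  qed
  from tcoeff_unique[of c f, OF this]
  show "tcoeff f (Suc n) = \<alpha> * tcoeff g (Suc n) + \<beta> * tcoeff g n" "tcoeff f 0 = \<gamma> + \<alpha> * tcoeff g 0"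
    by (simp_all add: c_def)
qed

lemma H2_iff_summable:
  assumes f: "f holomorphic_on ball 0 1"
  shows "f \<in> H2 \<longleftrightarrow> summable (\<lambda>n. (cmod (tcoeff f n))\<^sup>2)"
proof
  assume "f \<in> H2"
  then obtain C where C: "\<forall>r\<in>{0..<1}. integral\<^sup>L circ (\<lambda>t. (cmod (f (of_real r * cis t)))\<^sup>2) \<le> C"
    unfolding H2_iff by blast
  have "(\<Sum>n<N. (cmod (tcoeff f n))\<^sup>2) \<le> C" for N
  proof (rule tendsto_upperbound[where F = "at_left (1::real)"])
    have "((\<lambda>r::real. \<Sum>n<N. (cmod (tcoeff f n))\<^sup>2 * (r\<^sup>2) ^ n) \<longlongrightarrow> (\<Sum>n<N. (cmod (tcoeff f n))\<^sup>2 * (1\<^sup>2) ^ n)) (at_left 1)"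
      by (intro tendsto_intros)
    then show "((\<lambda>r::real. \<Sum>n<N. (cmod (tcoeff f n))\<^sup>2 * (r\<^sup>2) ^ n) \<longlongrightarrow> (\<Sum>n<N. (cmod (tcoeff f n))\<^sup>2)) (at_left 1)"
      by simp
    show "eventually (\<lambda>r::real. (\<Sum>n<N. (cmod (tcoeff f n))\<^sup>2 * (r\<^sup>2) ^ n) \<le> C) (at_left 1)"
    proof (rule eventually_at_leftI[of 0])
      fix r :: real assume r: "r \<in> {0<..<1}"
      then have z: "cmod (of_real r) < 1"
        by simp
      have s: "(\<lambda>n. (cmod (tcoeff f n))\<^sup>2 * (r\<^sup>2) ^ n) sums integral\<^sup>L circ (\<lambda>t. (cmod (f (of_real r * cis t)))\<^sup>2)"
        using Parseval_holomorphic[OF f z] by simp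
      have "(\<Sum>n<N. (cmod (tcoeff f n))\<^sup>2 * (r\<^sup>2) ^ n) \<le> (\<Sum>n. (cmod (tcoeff f n))\<^sup>2 * (r\<^sup>2) ^ n)"
        by (rule sum_le_suminf) (use s in \<open>auto simp: sums_iff\<close>)
      also have "\<dots> \<le> C"
        using s C r by (auto simp: sums_iff)
      finally show "(\<Sum>n<N. (cmod (tcoeff f n))\<^sup>2 * (r\<^sup>2) ^ n) \<le> C" .
    qed simp
  qed simp
  then show "summable (\<lambda>n. (cmod (tcoeff f n))\<^sup>2)"
    by (intro summableI_nonneg_bounded) auto
next
  assume S: "summable (\<lambda>n. (cmod (tcoeff f n))\<^sup>2)"
  have "integral\<^sup>L circ (\<lambda>t. (cmod (f (of_real r * cis t)))\<^sup>2) \<le> (\<Sum>n. (cmod (tcoeff f n))\<^sup>2)" if "r \<in> {0..<1}" for r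
  proof (rule sums_le[OF _ Parseval_holomorphic[OF f] summable_sums[OF S]])
    show "cmod (of_real r) < 1"
      using that by simp
    show "(cmod (tcoeff f n))\<^sup>2 * ((cmod (of_real r))\<^sup>2) ^ n \<le> (cmod (tcoeff f n))\<^sup>2" for n
      using that by (intro mult_left_le power_le_one) auto
  qed
  then show "f \<in> H2"
    unfolding H2_iff using f by blast
qed

subsection \<open>Dirichlet-type spaces\<close>

text \<open>With \<open>A m = S m / m\<close> the averages of \<open>H\<close>, the summand on the right is
  \<open>m (m + 1) |A m - A (m + 1)|\<^sup>2\<close> for \<open>m = k + 1\<close>; the mixed terms telescope.\<close>

lemma sum_square_eq_average_increments:
  fixes H :: "nat \<Rightarrow> complex"
  defines "S m \<equiv> (\<Sum>j<m. H j)"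
  shows "(\<Sum>m\<le>M. (cmod (H m))\<^sup>2) =
    (\<Sum>k<M. (cmod (S (Suc k) - of_nat (Suc k) * H (Suc k)))\<^sup>2 / ((real k + 1) * (real k + 2))) + (cmod (S (Suc M)))\<^sup>2 / (real M + 1)"
proof (induction M)
  case 0
  then show ?case
    by (simp add: S_def)
next
  case (Suc M)
  \<comment> \<open>Pythagoras in the plane: the left side is the squared length of (s / sqrt m, h)
    in the orthonormal basis formed by (sqrt m, 1) and (1, - sqrt m), each divided by sqrt (m +
    1).\<close>
  have key: "(s + h)\<^sup>2 / (m + 1) + (s - m * h)\<^sup>2 / (m * (m + 1)) = s\<^sup>2 / m + h\<^sup>2" if "0 < m" for s h m :: real
    using that by (simp add: divide_simps) (simp add: power2_eq_square algebra_simps)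
  define m where "m = real M + 1"
  define s where "s = S (Suc M)"
  define h where "h = H (Suc M)"
  have m: "m > 0"
    by (simp add: m_def)
  have ckey: "(cmod (s + h))\<^sup>2 / (m + 1) + (cmod (s - of_real m * h))\<^sup>2 / (m * (m + 1)) = (cmod s)\<^sup>2 / m + (cmod h)\<^sup>2"
    using key[OF m, of "Re s" "Re h"] key[OF m, of "Im s" "Im h"]
    unfolding cmod_power2 by (simp add: add_divide_distrib)
  have "(\<Sum>m\<le>Suc M. (cmod (H m))\<^sup>2) = (\<Sum>k<M. (cmod (S (Suc k) - of_nat (Suc k) * H (Suc k)))\<^sup>2 / ((real k + 1) * (real k + 2)))
     + ((cmod s)\<^sup>2 / m + (cmod h)\<^sup>2)"
    using Suc by (simp add: s_def h_def m_def)
  also have "(cmod s)\<^sup>2 / m + (cmod h)\<^sup>2 = (cmod (s - of_nat (Suc M) * h))\<^sup>2 / ((real M + 1) * (real M + 2)) + (cmod (S (Suc (Suc M))))\<^sup>2 / (real (Suc M) + 1)"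
    unfolding ckey[symmetric] by (simp add: s_def h_def m_def S_def add.commute)
  finally show ?case
    by (simp add: s_def h_def)
qed

text \<open>The averages form a Cauchy sequence whose squared distance to the limit \<alpha> is at
  most D / (M + 1). Replacing H by H - \<alpha> leaves the increments unchanged and makes the end
  term of \<open>sum_square_eq_average_increments\<close> at most D; increments and end term
  together give 2 D.\<close>

lemma averages_converge_fast:
  fixes H :: "nat \<Rightarrow> complex"
  defines "S m \<equiv> (\<Sum>j<m. H j)"
  assumes D: "\<And>K. (\<Sum>k<K. (cmod (S (Suc k) - of_nat (Suc k) * H (Suc k)))\<^sup>2 / ((real k + 1) * (real k + 2))) \<le> D"
  obtains \<alpha> where "\<And>M. (\<Sum>m\<le>M. (cmod (H m - \<alpha>))\<^sup>2) \<le> 2 * D"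
proof -
  define A where "A k = S (Suc k) / of_nat (Suc k)" for k
  define E where "E k = S (Suc k) - of_nat (Suc k) * H (Suc k)" for k
  have AE: "A k - A (Suc k) = E k / (of_nat (Suc k) * of_nat (Suc (Suc k)))" for k
  proof -
    have "S (Suc (Suc k)) = S (Suc k) + H (Suc k)"
      by (simp add: S_def)
    moreover have "(of_nat (Suc k) :: complex) \<noteq> 0" "(of_nat (Suc (Suc k)) :: complex) \<noteq> 0"
      by (simp_all only: of_nat_eq_0_iff nat.distinct simp_thms)
    ultimately show ?thesis
      by (simp add: A_def E_def divide_simps del: of_nat_Suc) (simp add: algebra_simps)
  qed
  have D0: "0 \<le> D"
    using D[of 0] by simp
  have bound: "(cmod (A M - A N))\<^sup>2 \<le> D / real (Suc M)" if "M \<le> N" for M N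
  proof -
    have tele: "A M - A N = (\<Sum>k=M..<N. A k - A (Suc k))"
      using that by (induction N rule: dec_induct) (auto simp: diff_eq_eq)
    have "cmod (A M - A N) \<le> (\<Sum>k=M..<N. cmod (A k - A (Suc k)))"
      unfolding tele by (rule norm_sum)
    \<comment> \<open>The denominator is split evenly so that, after Cauchy-Schwarz, one factor
      telescopes to at most 1 / (M + 1) and the other is bounded by D.\<close>
    also have "\<dots> = (\<Sum>k=M..<N. (1 / sqrt ((real k + 1) * (real k + 2))) * (cmod (E k) / sqrt ((real k + 1) * (real k + 2))))"
    proof (rule sum.cong[OF refl])
      fix k
      have "cmod (A k - A (Suc k)) = cmod (E k) / ((real k + 1) * (real k + 2))"
        unfolding AE norm_divide norm_mult norm_of_nat by (simp add: algebra_simps)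
      also have "\<dots> = (1 / sqrt ((real k + 1) * (real k + 2))) * (cmod (E k) / sqrt ((real k + 1) * (real k + 2)))"
        by (simp flip: real_sqrt_mult)
      finally show "cmod (A k - A (Suc k)) = (1 / sqrt ((real k + 1) * (real k + 2))) * (cmod (E k) / sqrt ((real k + 1) * (real k + 2)))" .
    qed
    finally have "(cmod (A M - A N))\<^sup>2 \<le> (\<Sum>k=M..<N. (1 / sqrt ((real k + 1) * (real k + 2))) * (cmod (E k) / sqrt ((real k + 1) * (real k + 2))))\<^sup>2"
      by (intro power_mono) auto
    also have "\<dots> \<le> (\<Sum>k=M..<N. (1 / sqrt ((real k + 1) * (real k + 2)))\<^sup>2) * (\<Sum>k=M..<N. (cmod (E k) / sqrt ((real k + 1) * (real k + 2)))\<^sup>2)"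
      by (rule Cauchy_Schwarz_ineq_sum)
    also have "\<dots> \<le> (1 / real (Suc M)) * D"
    proof (rule mult_mono)
      have "(\<Sum>k=M..<N. (1 / sqrt ((real k + 1) * (real k + 2)))\<^sup>2) = (\<Sum>k=M..<N. 1 / real (Suc k) - 1 / real (Suc (Suc k)))"
        by (intro sum.cong refl) (simp add: power_divide field_simps)
      also have "\<dots> = 1 / real (Suc M) - 1 / real (Suc N)"
        using that by (induction N rule: dec_induct) auto
      finally show "(\<Sum>k=M..<N. (1 / sqrt ((real k + 1) * (real k + 2)))\<^sup>2) \<le> 1 / real (Suc M)"
        by simp
      have "(\<Sum>k=M..<N. (cmod (E k) / sqrt ((real k + 1) * (real k + 2)))\<^sup>2) \<le> (\<Sum>k<N. (cmod (E k) / sqrt ((real k + 1) * (real k + 2)))\<^sup>2)"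
        by (intro sum_mono2) auto
      also have "\<dots> = (\<Sum>k<N. (cmod (E k))\<^sup>2 / ((real k + 1) * (real k + 2)))"
        by (intro sum.cong refl) (simp add: power_divide)
      also have "\<dots> \<le> D"
        unfolding E_def by (rule D)
      finally show "(\<Sum>k=M..<N. (cmod (E k) / sqrt ((real k + 1) * (real k + 2)))\<^sup>2) \<le> D" .
    qed (auto intro: sum_nonneg)
    finally show ?thesis
      by simp
  qed
  have "Cauchy A"
  proof (rule metric_CauchyI)
    fix e :: real assume e: "0 < e"
    obtain K :: nat where K: "D / e\<^sup>2 < real K"
      using reals_Archimedean2 by blast
    have "dist (A M) (A N) < e" if "K \<le> M" "M \<le> N" for M N
    proof -
      have "D / e\<^sup>2 < real (Suc M)"
        using K that by linarith
      then have "D / real (Suc M) < e\<^sup>2"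
        using e by (simp add: pos_divide_less_eq mult.commute)
      with bound[OF that(2)] have "(cmod (A M - A N))\<^sup>2 < e\<^sup>2"
        by linarith
      then show ?thesis
        using e by (simp add: dist_norm power_less_imp_less_base)
    qed
    then show "\<exists>K. \<forall>m\<ge>K. \<forall>n\<ge>K. dist (A m) (A n) < e"
      by (metis dist_commute nle_le)
  qed
  then obtain \<alpha> where \<alpha>: "A \<longlonglongrightarrow> \<alpha>"
    using Cauchy_convergent convergent_def by blast
  have lim: "(cmod (A M - \<alpha>))\<^sup>2 \<le> D / real (Suc M)" for M
  proof (rule tendsto_upperbound)
    show "(\<lambda>N. (cmod (A M - A N))\<^sup>2) \<longlonglongrightarrow> (cmod (A M - \<alpha>))\<^sup>2"
      by (intro tendsto_intros \<alpha>)
    show "eventually (\<lambda>N. (cmod (A M - A N))\<^sup>2 \<le> D / real (Suc M)) sequentially"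
      using eventually_ge_at_top[of M] by eventually_elim (rule bound)
  qed simp
  have "(\<Sum>m\<le>M. (cmod (H m - \<alpha>))\<^sup>2) \<le> 2 * D" for M
  proof -
    have S': "(\<Sum>j<m. H j - \<alpha>) = S m - of_nat m * \<alpha>" for m
      by (simp add: S_def sum_subtractf)
    have E': "(\<Sum>j<Suc k. H j - \<alpha>) - of_nat (Suc k) * (H (Suc k) - \<alpha>) = S (Suc k) - of_nat (Suc k) * H (Suc k)" for k
      unfolding S' by (simp add: algebra_simps)
    have "(cmod (S (Suc M) - of_nat (Suc M) * \<alpha>))\<^sup>2 / (real M + 1) \<le> D"
    proof -
      have ne: "(of_nat (Suc M) :: complex) \<noteq> 0"
        by (simp only: of_nat_eq_0_iff nat.distinct simp_thms)
      have "S (Suc M) - of_nat (Suc M) * \<alpha> = of_nat (Suc M) * (A M - \<alpha>)"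
        using ne by (simp add: A_def right_diff_distrib del: of_nat_Suc)
      then have "(cmod (S (Suc M) - of_nat (Suc M) * \<alpha>))\<^sup>2 = (real (Suc M))\<^sup>2 * (cmod (A M - \<alpha>))\<^sup>2"
        by (simp only: norm_mult norm_of_nat power_mult_distrib)
      also have "\<dots> \<le> (real (Suc M))\<^sup>2 * (D / real (Suc M))"
        by (rule mult_left_mono[OF lim]) simp
      also have "\<dots> = (real M + 1) * D"
        by (simp add: power2_eq_square)
      finally show ?thesis
        by (simp add: pos_divide_le_eq mult.commute)
    qed
    moreover have "(\<Sum>m\<le>M. (cmod (H m - \<alpha>))\<^sup>2) =
      (\<Sum>k<M. (cmod (S (Suc k) - of_nat (Suc k) * H (Suc k)))\<^sup>2 / ((real k + 1) * (real k + 2))) + (cmod (S (Suc M) - of_nat (Suc M) * \<alpha>))\<^sup>2 / (real M + 1)"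
      using sum_square_eq_average_increments[of "\<lambda>j. H j - \<alpha>" M] unfolding E' unfolding S' .
    ultimately show ?thesis
      using D[of M] by linarith
  qed
  then show ?thesis
    by (rule that)
qed

section \<open>The local Dirichlet integral at one point of the circle\<close>

lemma cmod_one_minus_cnj_mult: "cmod \<zeta> = 1 \<Longrightarrow> cmod (1 - cnj \<zeta> * z) = cmod (\<zeta> - z)"
proof -
  assume z: "cmod \<zeta> = 1"
  then have "\<zeta> * cnj \<zeta> = 1"
    using complex_norm_square[of \<zeta>] by simp
  moreover have "\<zeta> * (1 - cnj \<zeta> * z) = \<zeta> - (\<zeta> * cnj \<zeta>) * z"
    by (simp only: right_diff_distrib mult.assoc mult_1_right)
  ultimately have "\<zeta> - z = \<zeta> * (1 - cnj \<zeta> * z)"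
    by simp
  then show ?thesis
    using z by (simp add: norm_mult)
qed

text \<open>For |\<zeta>| = 1 the distance |\<zeta> - z| is the modulus of the holomorphic function
  1 - cnj \<zeta> z. The singular part of the Poisson kernel can therefore be absorbed into f',
  which leaves the radial weight 1 - |z|^2.\<close>

lemma local_Dirichlet_integral:
  assumes f: "f holomorphic_on ball 0 1" and \<zeta>: "cmod \<zeta> = 1"
  defines "G \<equiv> (\<lambda>z. deriv f z / (1 - cnj \<zeta> * z))"
  shows "(\<integral>\<^sup>+ z\<in>ball 0 1. ennreal ((cmod (deriv f z))^2 * poisson_pts {\<zeta>} z) \<partial>lborel) =
     (\<Sum>m. ennreal (pi * ((cmod (tcoeff G m))\<^sup>2 / ((real m + 1) * (real m + 2)))))"
    and "G holomorphic_on ball 0 1"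
proof -
  have ne: "1 - cnj \<zeta> * z \<noteq> 0" if "cmod z < 1" for z
  proof -
    have "\<zeta> \<noteq> z"
      using \<zeta> that by auto
    then show ?thesis
      using cmod_one_minus_cnj_mult[OF \<zeta>, of z] by auto
  qed
  show G: "G holomorphic_on ball 0 1"
    unfolding G_def using ne by (intro holomorphic_intros f) auto
  have "(\<integral>\<^sup>+ z\<in>ball 0 1. ennreal ((cmod (deriv f z))^2 * poisson_pts {\<zeta>} z) \<partial>lborel) =
    (\<integral>\<^sup>+z. ennreal ((cmod (G z))\<^sup>2 * (1 - (cmod z)\<^sup>2)) * indicator (ball 0 1) z \<partial>lborel)"
  proof (intro nn_integral_cong)
    fix z
    have "(cmod (deriv f z))\<^sup>2 * poisson_pts {\<zeta>} z = (cmod (G z))\<^sup>2 * (1 - (cmod z)\<^sup>2)"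
      by (simp add: G_def poisson_pts_def norm_divide cmod_one_minus_cnj_mult[OF \<zeta>] power_divide)
    then show "ennreal ((cmod (deriv f z))\<^sup>2 * poisson_pts {\<zeta>} z) * indicator (ball 0 1) z =
      ennreal ((cmod (G z))\<^sup>2 * (1 - (cmod z)\<^sup>2)) * indicator (ball 0 1) z"
      by simp
  qed
  also have "\<dots> = (\<Sum>m. ennreal (pi * ((cmod (tcoeff G m))\<^sup>2 / ((real m + 1) * (real m + 2)))))"
    by (rule nn_integral_disk_weighted[OF G])
  finally show "(\<integral>\<^sup>+ z\<in>ball 0 1. ennreal ((cmod (deriv f z))^2 * poisson_pts {\<zeta>} z) \<partial>lborel) =
     (\<Sum>m. ennreal (pi * ((cmod (tcoeff G m))\<^sup>2 / ((real m + 1) * (real m + 2)))))" .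
qed

text \<open>The powers of \<open>\<zeta>\<close> rotate \<open>\<zeta>\<close> to \<open>1\<close>.\<close>

lemma coefficients_difference_quotient:
  assumes h: "h holomorphic_on ball 0 1" and f: "f holomorphic_on ball 0 1" and \<zeta>: "cmod \<zeta> = 1"
    and fh: "\<And>z. cmod z < 1 \<Longrightarrow> f z = \<gamma> + (z - \<zeta>) * h z"
  defines "G \<equiv> (\<lambda>z. deriv f z / (1 - cnj \<zeta> * z))" and "H m \<equiv> \<zeta> ^ Suc m * tcoeff h m"
  shows "\<zeta> ^ Suc m * tcoeff G m = (\<Sum>j<Suc m. H j) - of_nat (Suc m) * H (Suc m)"
proof -
  have \<zeta>c: "\<zeta> * cnj \<zeta> = 1"
    using \<zeta> complex_norm_square[of \<zeta>] by simp
  have G: "G holomorphic_on ball 0 1"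
    unfolding G_def by (rule local_Dirichlet_integral(2)[OF f \<zeta>])
  have ne: "1 - cnj \<zeta> * z \<noteq> 0" if "cmod z < 1" for z
  proof -
    have "\<zeta> \<noteq> z"
      using \<zeta> that by auto
    then show ?thesis
      using cmod_one_minus_cnj_mult[OF \<zeta>, of z] by auto
  qed
  have fG: "deriv f z = 0 + (1 + (- cnj \<zeta>) * z) * G z" if "cmod z < 1" for z
    using ne[OF that] by (simp add: G_def)
  have fh': "f z = \<gamma> + (- \<zeta> + 1 * z) * h z" if "cmod z < 1" for z
    using fh[OF that] by simp
  have fc: "\<zeta> ^ Suc n * tcoeff f (Suc n) = H n - H (Suc n)" for n
  proof -
    have t: "tcoeff f (Suc n) = (- \<zeta>) * tcoeff h (Suc n) + 1 * tcoeff h n"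
      by (rule tcoeff_linear_mult(1)[OF h fh'])
    show ?thesis
      unfolding H_def t by (simp add: algebra_simps)
  qed
  show ?thesis
  \<comment> \<open>The relation f' = (1 - cnj \<zeta> z) G is a first-order recursion for the
    coefficients of G. Its inhomogeneous terms are n (H (n - 1) - H n) after rotation, and summing
    them by parts gives the claim.\<close>
  proof (induction m)
    case 0
    have "tcoeff G 0 = tcoeff f 1"
      using tcoeff_linear_mult(2)[OF G fG] by (simp add: tcoeff_deriv)
    then show ?case
      using fc[of 0] by simp
  next
    case (Suc m)
    have "of_nat (Suc (Suc m)) * tcoeff f (Suc (Suc m)) = tcoeff G (Suc m) - cnj \<zeta> * tcoeff G m"
      using tcoeff_linear_mult(1)[OF G fG, of m] unfolding tcoeff_deriv by simp
    then have "\<zeta> ^ Suc (Suc m) * (of_nat (Suc (Suc m)) * tcoeff f (Suc (Suc m))) = \<zeta> ^ Suc (Suc m) * (tcoeff G (Suc m) - cnj \<zeta> * tcoeff G m)"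
      by simp
    also have "\<zeta> ^ Suc (Suc m) * (tcoeff G (Suc m) - cnj \<zeta> * tcoeff G m) = \<zeta> ^ Suc (Suc m) * tcoeff G (Suc m) - (\<zeta> * cnj \<zeta>) * (\<zeta> ^ Suc m * tcoeff G m)"
      by (simp add: algebra_simps)
    finally have "\<zeta> ^ Suc (Suc m) * tcoeff G (Suc m) = of_nat (Suc (Suc m)) * (\<zeta> ^ Suc (Suc m) * tcoeff f (Suc (Suc m))) + \<zeta> ^ Suc m * tcoeff G m"
      unfolding \<zeta>c by (simp add: algebra_simps)
    also have "\<dots> = of_nat (Suc (Suc m)) * (H (Suc m) - H (Suc (Suc m))) + ((\<Sum>j<Suc m. H j) - of_nat (Suc m) * H (Suc m))"
      unfolding fc Suc ..
    finally show ?case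
      by (simp add: algebra_simps)
  qed
qed

lemma suminf_ennreal_less_top_iff:
  assumes "\<And>n. 0 \<le> f n"
  shows "(\<Sum>n. ennreal (f n)) < \<infinity> \<longleftrightarrow> summable f"
proof
  assume "(\<Sum>n. ennreal (f n)) < \<infinity>"
  then show "summable f"
    using assms by (intro summable_suminf_not_top) auto
next
  assume "summable f"
  then show "(\<Sum>n. ennreal (f n)) < \<infinity>"
    using suminf_ennreal2[OF assms] by simp
qed

text \<open>Up to the factor pi, the partial sums of the area integral are those of
  \<open>sum_square_eq_average_increments\<close> without the nonnegative end term, so the squared
  Hardy norm of h bounds them.\<close>

lemma Dmu_singleton_mult:
  assumes h: "h \<in> H2" and \<zeta>: "cmod \<zeta> = 1" and f: "(\<lambda>z. (z - \<zeta>) * h z) \<in> H2"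
  shows "(\<lambda>z. (z - \<zeta>) * h z) \<in> Dmu {\<zeta>}"
proof -
  have hh: "h holomorphic_on ball 0 1"
    using h by (simp add: H2_iff)
  have fh: "(\<lambda>z. (z - \<zeta>) * h z) holomorphic_on ball 0 1"
    using f by (simp add: H2_iff)
  define G where "G z = deriv (\<lambda>z. (z - \<zeta>) * h z) z / (1 - cnj \<zeta> * z)" for z
  define H where "H m = \<zeta> ^ Suc m * tcoeff h m" for m
  have nH: "cmod (H m) = cmod (tcoeff h m)" for m
    using \<zeta> by (simp add: H_def norm_mult norm_power)
  have sH: "summable (\<lambda>m. (cmod (H m))\<^sup>2)"
    using H2_iff_summable[OF hh] h by (simp add: nH)
  have EG: "\<zeta> ^ Suc m * tcoeff G m = (\<Sum>j<Suc m. H j) - of_nat (Suc m) * H (Suc m)" for m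
    unfolding G_def H_def by (rule coefficients_difference_quotient[OF hh fh \<zeta>, of 0]) simp
  have GE: "cmod (tcoeff G m) = cmod ((\<Sum>j<Suc m. H j) - of_nat (Suc m) * H (Suc m))" for m
    using \<zeta> unfolding EG[symmetric] by (simp add: norm_mult norm_power)
  have "summable (\<lambda>m. (cmod (tcoeff G m))\<^sup>2 / ((real m + 1) * (real m + 2)))"
  proof (rule summableI_nonneg_bounded)
    fix M
    have "(\<Sum>m<M. (cmod (tcoeff G m))\<^sup>2 / ((real m + 1) * (real m + 2))) \<le> (\<Sum>m\<le>M. (cmod (H m))\<^sup>2)"
      unfolding GE sum_square_eq_average_increments[of H M] by simp
    also have "\<dots> \<le> (\<Sum>m. (cmod (H m))\<^sup>2)"
      by (rule sum_le_suminf[OF sH]) auto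
    finally show "(\<Sum>m<M. (cmod (tcoeff G m))\<^sup>2 / ((real m + 1) * (real m + 2))) \<le> (\<Sum>m. (cmod (H m))\<^sup>2)" .
  qed auto
  then have "summable (\<lambda>m. pi * ((cmod (tcoeff G m))\<^sup>2 / ((real m + 1) * (real m + 2))))"
    by (rule summable_mult)
  then have "(\<Sum>m. ennreal (pi * ((cmod (tcoeff G m))\<^sup>2 / ((real m + 1) * (real m + 2))))) < \<infinity>"
    by (subst suminf_ennreal_less_top_iff) auto
  then show ?thesis
    using f local_Dirichlet_integral(1)[OF fh \<zeta>] unfolding Dmu_def G_def by simp
qed

text \<open>The constant \<gamma> plays the part of a boundary value f(\<zeta>), whose existence is
  not known beforehand. The quotient is therefore formed with constant 0 first. Finiteness of the
  area integral makes the averages of its rotated coefficients converge to some \<alpha>, and the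
  constant -\<alpha> then makes the coefficients square summable.\<close>

lemma Dmu_singleton_quotient:
  assumes f: "f \<in> Dmu {\<zeta>}" and \<zeta>: "cmod \<zeta> = 1"
  obtains \<gamma> h where "h \<in> H2" "\<And>z. cmod z < 1 \<Longrightarrow> f z = \<gamma> + (z - \<zeta>) * h z"
proof -
  have fh: "f holomorphic_on ball 0 1"
    using f by (simp add: Dmu_def H2_iff)
  define G where "G z = deriv f z / (1 - cnj \<zeta> * z)" for z
  have ne: "z - \<zeta> \<noteq> 0" if "cmod z < 1" for z
    using \<zeta> that by auto
  have "(\<Sum>m. ennreal (pi * ((cmod (tcoeff G m))\<^sup>2 / ((real m + 1) * (real m + 2))))) < \<infinity>"
    using f local_Dirichlet_integral(1)[OF fh \<zeta>] unfolding Dmu_def G_def by simp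
  then have "summable (\<lambda>m. pi * ((cmod (tcoeff G m))\<^sup>2 / ((real m + 1) * (real m + 2))))"
    by (subst (asm) suminf_ennreal_less_top_iff) auto
  from summable_mult[OF this, of "1/pi"]
  have sG: "summable (\<lambda>m. (cmod (tcoeff G m))\<^sup>2 / ((real m + 1) * (real m + 2)))"
    by simp
  define q where "q c z = (f z - c) / (z - \<zeta>)" for c z
  define H where "H c m = \<zeta> ^ Suc m * tcoeff (q c) m" for c m
  have qh: "q c holomorphic_on ball 0 1" for c
    unfolding q_def using ne by (intro holomorphic_intros fh) auto
  have fq: "f z = c + (z - \<zeta>) * q c z" if "cmod z < 1" for z c
    using ne[OF that] by (simp add: q_def)
  have EG: "\<zeta> ^ Suc m * tcoeff G m = (\<Sum>j<Suc m. H 0 j) - of_nat (Suc m) * H 0 (Suc m)" for m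
    unfolding G_def H_def by (rule coefficients_difference_quotient[OF qh fh \<zeta> fq])
  have GE: "cmod (tcoeff G m) = cmod ((\<Sum>j<Suc m. H 0 j) - of_nat (Suc m) * H 0 (Suc m))" for m
    using \<zeta> unfolding EG[symmetric] by (simp add: norm_mult norm_power)
  define D where "D = (\<Sum>m. (cmod (tcoeff G m))\<^sup>2 / ((real m + 1) * (real m + 2)))"
  have "(\<Sum>k<K. (cmod ((\<Sum>j<Suc k. H 0 j) - of_nat (Suc k) * H 0 (Suc k)))\<^sup>2 / ((real k + 1) * (real k + 2))) \<le> D" for K
    unfolding GE[symmetric] D_def by (rule sum_le_suminf[OF sG]) auto
  from averages_converge_fast[OF this]
  obtain \<alpha> where \<alpha>: "\<And>M. (\<Sum>m\<le>M. (cmod (H 0 m - \<alpha>))\<^sup>2) \<le> 2 * D"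
    by blast
  \<comment> \<open>The function c / (\<zeta> - z) has coefficients c / \<zeta>^(m+1), which the
    factor \<open>\<zeta> ^ Suc m\<close> in \<open>H\<close> turns into the constant c.\<close>
  have Hc: "H c m = H 0 m + c" for c m
  proof (induction m)
    case 0
    have q: "f z = c + (- \<zeta> + 1 * z) * q c z" if "cmod z < 1" for z c
      using fq[OF that] by simp
    have "c - \<zeta> * tcoeff (q c) 0 = 0 - \<zeta> * tcoeff (q 0) 0"
      using tcoeff_linear_mult(2)[OF qh q, of c] tcoeff_linear_mult(2)[OF qh q, of 0] by simp
    then show ?case
      by (simp add: H_def algebra_simps)
  next
    case (Suc m)
    have q: "f z = c + (- \<zeta> + 1 * z) * q c z" if "cmod z < 1" for z c
      using fq[OF that] by simp
    have "H c m - H c (Suc m) = \<zeta> ^ Suc m * tcoeff f (Suc m)" for c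
    proof -
      have t: "tcoeff f (Suc m) = (- \<zeta>) * tcoeff (q c) (Suc m) + 1 * tcoeff (q c) m"
        by (rule tcoeff_linear_mult(1)[OF qh q])
      show ?thesis
        unfolding H_def t by (simp add: algebra_simps)
    qed
    from this[of c] this[of 0] have "H c m - H c (Suc m) = H 0 m - H 0 (Suc m)"
      by simp
    with Suc show ?case
      by (simp add: algebra_simps)
  qed
  have "summable (\<lambda>m. (cmod (tcoeff (q (- \<alpha>)) m))\<^sup>2)"
  proof (rule summableI_nonneg_bounded)
    fix M
    have "(\<Sum>m<M. (cmod (tcoeff (q (- \<alpha>)) m))\<^sup>2) = (\<Sum>m<M. (cmod (H (- \<alpha>) m))\<^sup>2)"
      using \<zeta> by (simp add: H_def norm_mult norm_power)
    also have "\<dots> = (\<Sum>m<M. (cmod (H 0 m - \<alpha>))\<^sup>2)"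
      by (simp add: Hc[of "- \<alpha>"])
    also have "\<dots> \<le> (\<Sum>m\<le>M. (cmod (H 0 m - \<alpha>))\<^sup>2)"
      by (intro sum_mono2) auto
    also have "\<dots> \<le> 2 * D"
      by (rule \<alpha>)
    finally show "(\<Sum>m<M. (cmod (tcoeff (q (- \<alpha>)) m))\<^sup>2) \<le> 2 * D" .
  qed auto
  then have "q (- \<alpha>) \<in> H2"
    using H2_iff_summable[OF qh] by simp
  then show ?thesis
    using fq that by blast
qed

section \<open>Sums and bounded multiples in the Hardy space\<close>

lemma H2_holomorphic: "h \<in> H2 \<Longrightarrow> h holomorphic_on ball 0 1"
  by (simp add: H2_iff)

lemma H2_add:
  assumes f: "f \<in> H2" and g: "g \<in> H2"
  shows "(\<lambda>z. f z + g z) \<in> H2"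
proof -
  obtain C D where C: "\<forall>r\<in>{0..<1}. integral\<^sup>L circ (\<lambda>t. (cmod (f (of_real r * cis t)))\<^sup>2) \<le> C"
    and D: "\<forall>r\<in>{0..<1}. integral\<^sup>L circ (\<lambda>t. (cmod (g (of_real r * cis t)))\<^sup>2) \<le> D"
    using f g unfolding H2_iff by blast
  note h = H2_holomorphic[OF f] H2_holomorphic[OF g]
  have "integral\<^sup>L circ (\<lambda>t. (cmod (f (of_real r * cis t) + g (of_real r * cis t)))\<^sup>2) \<le> 2 * C + 2 * D" if r: "r \<in> {0..<1}" for r
  proof -
    have r': "cmod (of_real r) < 1"
      using r by simp
    have i: "integrable circ (\<lambda>t. (cmod (f (of_real r * cis t)))\<^sup>2)" "integrable circ (\<lambda>t. (cmod (g (of_real r * cis t)))\<^sup>2)"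
      by (intro integrable_circ_continuous continuous_intros continuous_on_circle_of_ball h r')+
    have "integral\<^sup>L circ (\<lambda>t. (cmod (f (of_real r * cis t) + g (of_real r * cis t)))\<^sup>2) \<le>
      integral\<^sup>L circ (\<lambda>t. 2 * (cmod (f (of_real r * cis t)))\<^sup>2 + 2 * (cmod (g (of_real r * cis t)))\<^sup>2)"
    proof (rule integral_mono)
      show "integrable circ (\<lambda>t. (cmod (f (of_real r * cis t) + g (of_real r * cis t)))\<^sup>2)"
        by (intro integrable_circ_continuous continuous_intros continuous_on_circle_of_ball h r')
      show "integrable circ (\<lambda>t. 2 * (cmod (f (of_real r * cis t)))\<^sup>2 + 2 * (cmod (g (of_real r * cis t)))\<^sup>2)"
        using i by simp
      fix t
      let ?x = "f (of_real r * cis t)" and ?y = "g (of_real r * cis t)"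
      have "(cmod (?x + ?y))\<^sup>2 \<le> (cmod ?x + cmod ?y)\<^sup>2"
        by (intro power_mono norm_triangle_ineq) simp
      also have "\<dots> \<le> 2 * (cmod ?x)\<^sup>2 + 2 * (cmod ?y)\<^sup>2"
        using zero_le_power2[of "cmod ?x - cmod ?y"] by (simp add: power2_eq_square algebra_simps)
      finally show "(cmod (?x + ?y))\<^sup>2 \<le> 2 * (cmod ?x)\<^sup>2 + 2 * (cmod ?y)\<^sup>2" .
    qed
    also have "\<dots> = 2 * integral\<^sup>L circ (\<lambda>t. (cmod (f (of_real r * cis t)))\<^sup>2) + 2 * integral\<^sup>L circ (\<lambda>t. (cmod (g (of_real r * cis t)))\<^sup>2)"
      using i by simp
    also have "\<dots> \<le> 2 * C + 2 * D"
      using C D r by (intro add_mono mult_left_mono) auto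
    finally show ?thesis .
  qed
  then show ?thesis
    unfolding H2_iff by (intro conjI exI[of _ "2 * C + 2 * D"] ballI holomorphic_intros h)
qed

lemma H2_mult_bounded:
  assumes f: "f \<in> H2" and u: "u holomorphic_on ball 0 1" and B: "\<And>z. cmod z < 1 \<Longrightarrow> cmod (u z) \<le> B"
  shows "(\<lambda>z. u z * f z) \<in> H2"
proof -
  obtain C where C: "\<forall>r\<in>{0..<1}. integral\<^sup>L circ (\<lambda>t. (cmod (f (of_real r * cis t)))\<^sup>2) \<le> C"
    using f unfolding H2_iff by blast
  note h = H2_holomorphic[OF f]
  have "integral\<^sup>L circ (\<lambda>t. (cmod (u (of_real r * cis t) * f (of_real r * cis t)))\<^sup>2) \<le> B\<^sup>2 * C" if r: "r \<in> {0..<1}" for r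
  proof -
    have r': "cmod (of_real r) < 1"
      using r by simp
    have "integral\<^sup>L circ (\<lambda>t. (cmod (u (of_real r * cis t) * f (of_real r * cis t)))\<^sup>2) \<le>
      integral\<^sup>L circ (\<lambda>t. B\<^sup>2 * (cmod (f (of_real r * cis t)))\<^sup>2)"
    proof (rule integral_mono)
      show "integrable circ (\<lambda>t. (cmod (u (of_real r * cis t) * f (of_real r * cis t)))\<^sup>2)"
        "integrable circ (\<lambda>t. B\<^sup>2 * (cmod (f (of_real r * cis t)))\<^sup>2)"
        by (intro integrable_circ_continuous continuous_intros continuous_on_circle_of_ball h u r')+
      fix t
      have "(cmod (u (of_real r * cis t)))\<^sup>2 \<le> B\<^sup>2"
        using r by (intro power_mono B) (auto simp: norm_mult)
      then show "(cmod (u (of_real r * cis t) * f (of_real r * cis t)))\<^sup>2 \<le> B\<^sup>2 * (cmod (f (of_real r * cis t)))\<^sup>2"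
        by (simp add: norm_mult power_mult_distrib mult_right_mono)
    qed
    also have "\<dots> = B\<^sup>2 * integral\<^sup>L circ (\<lambda>t. (cmod (f (of_real r * cis t)))\<^sup>2)"
      by (rule integral_mult_right_zero)
    also have "\<dots> \<le> B\<^sup>2 * C"
      using C r by (intro mult_left_mono) auto
    finally show ?thesis .
  qed
  then show ?thesis
    unfolding H2_iff by (intro conjI exI[of _ "B\<^sup>2 * C"] ballI holomorphic_intros h u)
qed

lemma H2_scale: "f \<in> H2 \<Longrightarrow> (\<lambda>z. c * f z) \<in> H2"
  by (rule H2_mult_bounded[where B = "cmod c"]) auto

lemma poly_holomorphic: "poly q holomorphic_on S"
  for q :: "complex poly"
  by (simp add: poly_altdef[abs_def]) (intro holomorphic_intros)

lemma poly_bounded_disk: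
  fixes q :: "complex poly"
  obtains B where "\<And>z. cmod z \<le> 1 \<Longrightarrow> cmod (poly q z) \<le> B"
proof -
  have "bounded (poly q ` cball 0 1)"
    by (intro compact_imp_bounded compact_continuous_image continuous_intros) auto
  then show ?thesis
    using that unfolding bounded_iff by fastforce
qed

lemma H2_poly_mult: "f \<in> H2 \<Longrightarrow> (\<lambda>z. poly q z * f z) \<in> H2"
proof -
  assume f: "f \<in> H2"
  obtain B where B: "\<And>z. cmod z \<le> 1 \<Longrightarrow> cmod (poly q z) \<le> B"
    using poly_bounded_disk by blast
  show ?thesis
    by (rule H2_mult_bounded[OF f poly_holomorphic, of q B]) (simp add: B)
qed

lemma H2_poly: "poly q \<in> H2"
proof -
  have "(\<lambda>z. 1) \<in> H2"
    unfolding H2_iff by auto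
  from H2_poly_mult[OF this, of q] show ?thesis
    by simp
qed

section \<open>Finitely many points on the circle\<close>

definition zeros_poly :: "complex set \<Rightarrow> complex poly" where
  "zeros_poly Z = (\<Prod>\<zeta>\<in>Z. [:- \<zeta>, 1:])"

lemma poly_zeros_poly: "poly (zeros_poly Z) z = (\<Prod>\<zeta>\<in>Z. z - \<zeta>)"
  by (simp add: zeros_poly_def poly_prod)

lemma Dmu_subset_singleton:
  assumes Z: "finite Z" "\<zeta> \<in> Z"
  shows "Dmu Z \<subseteq> Dmu {\<zeta>}"
proof
  fix f assume f: "f \<in> Dmu Z"
  have "poisson_pts {\<zeta>} z \<le> poisson_pts Z z" if "z \<in> ball 0 1" for z
    unfolding poisson_pts_def using Z that by (intro sum_mono2) (auto simp: power_le_one)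
  then have "(\<integral>\<^sup>+ z\<in>ball 0 1. ennreal ((cmod (deriv f z))^2 * poisson_pts {\<zeta>} z) \<partial>lborel) \<le>
     (\<integral>\<^sup>+ z\<in>ball 0 1. ennreal ((cmod (deriv f z))^2 * poisson_pts Z z) \<partial>lborel)"
    by (intro nn_integral_mono) (auto split: split_indicator intro!: ennreal_leI mult_left_mono)
  with f show "f \<in> Dmu {\<zeta>}"
    unfolding Dmu_def by (auto intro: le_less_trans)
qed

lemma Dmu_from_singletons:
  assumes Z: "finite Z" "Z \<subseteq> sphere 0 1" and f: "f \<in> H2" and fz: "\<And>\<zeta>. \<zeta> \<in> Z \<Longrightarrow> f \<in> Dmu {\<zeta>}"
  shows "f \<in> Dmu Z"
proof -
  have fh: "f holomorphic_on ball 0 1"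
    using f by (rule H2_holomorphic)
  define F where "F \<zeta> z = ennreal ((cmod (deriv f z))^2 * poisson_pts {\<zeta>} z) * indicator (ball 0 1) z" for \<zeta> z
  have Fm: "F \<zeta> \<in> borel_measurable lborel" if "\<zeta> \<in> Z" for \<zeta>
  proof -
    have ne: "\<zeta> \<noteq> z" if "cmod z < 1" for z
      using \<open>\<zeta> \<in> Z\<close> Z(2) that by auto
    have "(\<lambda>z. indicator (ball 0 1) z *\<^sub>R ((cmod (deriv f z))^2 * poisson_pts {\<zeta>} z)) \<in> borel_measurable borel"
      unfolding poisson_pts_def
      by (intro borel_measurable_continuous_on_indicator continuous_intros holomorphic_on_imp_continuous_on holomorphic_deriv fh)
         (use ne in auto)
    then have "(\<lambda>z. ennreal (indicator (ball 0 1) z *\<^sub>R ((cmod (deriv f z))^2 * poisson_pts {\<zeta>} z))) \<in> borel_measurable lborel"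
      by simp
    moreover have "F \<zeta> = (\<lambda>z. ennreal (indicator (ball 0 1) z *\<^sub>R ((cmod (deriv f z))^2 * poisson_pts {\<zeta>} z)))"
      by (auto simp: F_def fun_eq_iff split: split_indicator)
    ultimately show ?thesis
      by simp
  qed
  have "(\<integral>\<^sup>+ z\<in>ball 0 1. ennreal ((cmod (deriv f z))^2 * poisson_pts Z z) \<partial>lborel) = (\<integral>\<^sup>+z. (\<Sum>\<zeta>\<in>Z. F \<zeta> z) \<partial>lborel)"
  proof (rule nn_integral_cong)
    fix z :: complex
    show "ennreal ((cmod (deriv f z))^2 * poisson_pts Z z) * indicator (ball 0 1) z = (\<Sum>\<zeta>\<in>Z. F \<zeta> z)"
    proof (cases "z \<in> ball 0 1")
      case True
      then have "ennreal ((cmod (deriv f z))^2 * poisson_pts Z z) = (\<Sum>\<zeta>\<in>Z. ennreal ((cmod (deriv f z))^2 * poisson_pts {\<zeta>} z))"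
        by (subst sum_ennreal) (auto simp: poisson_pts_def sum_distrib_left power_le_one intro!: mult_nonneg_nonneg divide_nonneg_nonneg)
      with True show ?thesis
        by (simp add: F_def)
    qed (simp add: F_def)
  qed
  also have "\<dots> = (\<Sum>\<zeta>\<in>Z. \<integral>\<^sup>+z. F \<zeta> z \<partial>lborel)"
    by (rule nn_integral_sum) (rule Fm)
  also have "\<dots> < \<infinity>"
    using fz Z(1) by (auto simp: Dmu_def F_def)
  finally show ?thesis
    using f by (simp add: Dmu_def)
qed

text \<open>The integral is additive over the points. For each of them the other linear factors are
  bounded and can be moved into the Hardy space function, which leaves the case of one
  point.\<close>

lemma zeros_mult_H2_in_Dmu:
  assumes Z: "finite Z" "Z \<subseteq> sphere 0 1" and h: "h \<in> H2"
  shows "(\<lambda>z. (\<Prod>\<zeta>\<in>Z. z - \<zeta>) * h z) \<in> Dmu Z"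
proof (rule Dmu_from_singletons[OF Z])
  show H: "(\<lambda>z. (\<Prod>\<zeta>\<in>Z. z - \<zeta>) * h z) \<in> H2"
    using H2_poly_mult[OF h, of "zeros_poly Z"] by (simp add: poly_zeros_poly)
  fix \<zeta> assume \<zeta>: "\<zeta> \<in> Z"
  have eq: "(\<lambda>z. (\<Prod>\<zeta>\<in>Z. z - \<zeta>) * h z) = (\<lambda>z. (z - \<zeta>) * (poly (zeros_poly (Z - {\<zeta>})) z * h z))"
    by (simp add: poly_zeros_poly mult.assoc prod.remove[OF Z(1) \<zeta>])
  show "(\<lambda>z. (\<Prod>\<zeta>\<in>Z. z - \<zeta>) * h z) \<in> Dmu {\<zeta>}"
    unfolding eq
  proof (rule Dmu_singleton_mult)
    show "(\<lambda>z. poly (zeros_poly (Z - {\<zeta>})) z * h z) \<in> H2"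
      by (rule H2_poly_mult[OF h])
    show "cmod \<zeta> = 1"
      using \<zeta> Z(2) by auto
    show "(\<lambda>z. (z - \<zeta>) * (poly (zeros_poly (Z - {\<zeta>})) z * h z)) \<in> H2"
      using H unfolding eq .
  qed
qed

text \<open>For a new point \<xi>, the old remainder h inherits a quotient at \<xi>. Indeed P h = f
  - q is a constant plus (z - \<xi>) times a Hardy function, and P differs from P(\<xi>) by a
  multiple of z - \<xi>. As P(\<xi>) is nonzero for distinct points, h = d + (z - \<xi>) h' follows,
  and d P joins the polynomial.\<close>

lemma Dmu_decomposition:
  assumes Z: "finite Z" "Z \<subseteq> sphere 0 1" and f: "f \<in> H2" and fz: "\<And>\<zeta>. \<zeta> \<in> Z \<Longrightarrow> f \<in> Dmu {\<zeta>}"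
  shows "\<exists>q h. h \<in> H2 \<and> (\<forall>z\<in>ball 0 1. f z = poly q z + poly (zeros_poly Z) z * h z)"
  using Z fz
proof (induction Z rule: finite_induct)
  case empty
  show ?case
    by (rule exI[of _ 0], rule exI[of _ f]) (simp add: f zeros_poly_def)
next
  case (insert \<xi> Z)
  then obtain q h where h: "h \<in> H2" and fq: "\<And>z. z \<in> ball 0 1 \<Longrightarrow> f z = poly q z + poly (zeros_poly Z) z * h z"
    by auto
  have \<xi>: "cmod \<xi> = 1"
    using insert.prems by auto
  obtain \<gamma> k where k: "k \<in> H2" and fk: "\<And>z. cmod z < 1 \<Longrightarrow> f z = \<gamma> + (z - \<xi>) * k z"
    using Dmu_singleton_quotient[OF insert.prems(2)[of \<xi>] \<xi>] by blast
  define P where "P = zeros_poly Z"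
  define q1 where "q1 = synthetic_div q \<xi>"
  define P1 where "P1 = synthetic_div P \<xi>"
  have div: "poly r z = poly r \<xi> + (z - \<xi>) * poly (synthetic_div r \<xi>) z" for r z
  proof -
    have "poly ([:- \<xi>, 1:] * synthetic_div r \<xi> + [:poly r \<xi>:]) z = poly r z"
      by (simp only: synthetic_div_correct')
    then show ?thesis
      by (simp add: algebra_simps)
  qed
  have P\<xi>: "poly P \<xi> \<noteq> 0"
    using insert.hyps by (auto simp: P_def poly_zeros_poly)
  \<comment> \<open>Formally the value of h at \<xi>, from \<gamma> = q(\<xi>) + P(\<xi>)
    h(\<xi>).\<close>
  define d where "d = (\<gamma> - poly q \<xi>) / poly P \<xi>"
  define h' where "h' z = inverse (poly P \<xi>) * (k z + (poly (- q1) z + poly (- P1) z * h z))" for z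
  have "h' \<in> H2"
    unfolding h'_def by (intro H2_scale H2_add k H2_poly H2_poly_mult h)
  moreover have "f z = poly (q + smult d P) z + poly (zeros_poly (insert \<xi> Z)) z * h' z" if z: "z \<in> ball 0 1" for z
  proof -
    have e1: "poly q z + poly P z * h z = \<gamma> + (z - \<xi>) * k z"
      using fq[OF z] fk[of z] z by (simp add: P_def)
    have e2: "poly q z = poly q \<xi> + (z - \<xi>) * poly q1 z" and e3: "poly P z = poly P \<xi> + (z - \<xi>) * poly P1 z"
      unfolding q1_def P1_def by (rule div)+
    have "poly P \<xi> * h z = poly P z * h z - (z - \<xi>) * poly P1 z * h z"
      unfolding e3 by (simp add: algebra_simps)
    also have "poly P z * h z = \<gamma> + (z - \<xi>) * k z - poly q z"
      using e1 by (simp add: algebra_simps)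
    finally have X: "poly P \<xi> * h z = (\<gamma> - poly q \<xi>) + (z - \<xi>) * (k z + (poly (- q1) z + poly (- P1) z * h z))"
      unfolding e2 by (simp add: algebra_simps)
    have "h z = inverse (poly P \<xi>) * (poly P \<xi> * h z)"
      using P\<xi> by simp
    also have "\<dots> = d + (z - \<xi>) * h' z"
      unfolding X d_def h'_def divide_inverse by (simp only: distrib_left mult_ac)
    finally have hE: "h z = d + (z - \<xi>) * h' z" .
    have PE: "poly (zeros_poly (insert \<xi> Z)) z = (z - \<xi>) * poly P z"
      using insert.hyps by (simp add: P_def poly_zeros_poly)
    show ?thesis
      unfolding fq[OF z] PE hE P_def[symmetric] by (simp add: algebra_simps)
  qed
  ultimately show ?case
    by blast
qed

subsection \<open>A gliding hump\<close>

text \<open>Two numbers at distance 2 e cannot both have modulus below e; the sign picks an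
  admissible one of s + e and s - e for e = (1/3)^n.\<close>

definition hump_sign :: "complex \<Rightarrow> nat \<Rightarrow> real" where
  "hump_sign s n = (if (1/3) ^ n \<le> cmod (s + (1/3) ^ n) then 1 else -1)"

text \<open>The sign at stage n is decided in column n alone but applied to all columns, so the
  recursion carries whole functions of l.\<close>

primrec hump_sum :: "(nat \<Rightarrow> nat \<Rightarrow> complex) \<Rightarrow> nat \<Rightarrow> nat \<Rightarrow> complex" where
  "hump_sum A 0 l = 0"
| "hump_sum A (Suc n) l = hump_sum A n l + of_real (hump_sign (hump_sum A n n) n * (1/3) ^ n) * A n l"

lemma hump_sign_le: "(1/3) ^ n \<le> cmod (s + of_real (hump_sign s n * (1/3) ^ n))"
proof (cases "(1/3) ^ n \<le> cmod (s + (1/3) ^ n)")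
  case True
  then show ?thesis
    by (simp add: hump_sign_def)
next
  case False
  have "2 * (1/3) ^ n = cmod ((s + (1/3) ^ n) - (s - (1/3) ^ n))"
    by (simp add: norm_power norm_divide flip: mult_2)
  also have "\<dots> \<le> cmod (s + (1/3) ^ n) + cmod (s - (1/3) ^ n)"
    by (rule norm_triangle_ineq4)
  finally show ?thesis
    using False by (simp add: hump_sign_def)
qed

text \<open>At stage j the sign makes the partial sum in column j at least (1/3)^j. With ratio 1/3
  all later terms add up to at most (1/3)^j / 2, so half of the hump survives whatever signs come
  later.\<close>

lemma gliding_hump:
  fixes A :: "nat \<Rightarrow> nat \<Rightarrow> complex"
  assumes A: "\<And>i j. cmod (A i j) \<le> 1" and diag: "\<And>j. A j j = 1"
  obtains \<theta> :: "nat \<Rightarrow> real" where "\<And>i. \<bar>\<theta> i\<bar> = (1/3) ^ i"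
    "\<And>j. (1/3) ^ j / 2 \<le> cmod (\<Sum>i. of_real (\<theta> i) * A i j)"
proof -
  define \<theta> where "\<theta> i = hump_sign (hump_sum A i i) i * (1/3) ^ i" for i
  have abs\<theta>: "\<bar>\<theta> i\<bar> = (1/3) ^ i" for i
    by (simp add: \<theta>_def hump_sign_def abs_mult)
  have part: "hump_sum A n l = (\<Sum>i<n. of_real (\<theta> i) * A i l)" for n l
    by (induction n) (simp_all add: \<theta>_def)
  have le: "cmod (of_real (\<theta> i) * A i j) \<le> (1/3) ^ i" for i j
    using mult_mono[of "\<bar>\<theta> i\<bar>" "(1/3) ^ i" "cmod (A i j)" 1] A abs\<theta> by (simp add: norm_mult)
  have geo: "summable (\<lambda>i. (1/3 :: real) ^ i)"
    by (rule summable_geometric) simp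
  have summ: "summable (\<lambda>i. cmod (of_real (\<theta> i) * A i j))" for j
    by (rule summable_comparison_test'[OF geo, of 0]) (use le in auto)
  have "(1/3) ^ j / 2 \<le> cmod (\<Sum>i. of_real (\<theta> i) * A i j)" for j
  proof -
    let ?f = "\<lambda>i. of_real (\<theta> i) * A i j"
    have s: "summable (\<lambda>i. cmod (?f (i + Suc j)))"
      using summ[of j] by (subst summable_iff_shift)
    have g3: "(\<lambda>i. (1/3 :: real) ^ (i + Suc j)) sums ((1/3) ^ j / 2)"
      using sums_mult[OF geometric_sums[of "1/3 :: real"], of "(1/3) ^ Suc j"] by (simp add: power_add mult_ac)
    have "cmod (\<Sum>i. ?f (i + Suc j)) \<le> (\<Sum>i. cmod (?f (i + Suc j)))"
      by (rule summable_norm[OF s])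
    also have "\<dots> \<le> (\<Sum>i. (1/3) ^ (i + Suc j))"
      using g3 by (intro suminf_le s le) (auto simp: sums_iff)
    also have "\<dots> = (1/3) ^ j / 2"
      using g3 by (simp add: sums_iff)
    finally have tail: "cmod (\<Sum>i. ?f (i + Suc j)) \<le> (1/3) ^ j / 2" .
    have "(\<Sum>i. ?f i) = (\<Sum>i. ?f (i + Suc j)) + (\<Sum>i<Suc j. ?f i)"
      by (rule suminf_split_initial_segment[OF summable_norm_cancel[OF summ]])
    moreover have "(\<Sum>i<Suc j. ?f i) = hump_sum A j j + of_real (\<theta> j)"
      by (simp add: part diag)
    moreover have "(1/3) ^ j \<le> cmod (hump_sum A j j + of_real (\<theta> j))"
      unfolding \<theta>_def by (rule hump_sign_le)
    ultimately show ?thesis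
      using tail norm_diff_ineq[of "hump_sum A j j + of_real (\<theta> j)" "\<Sum>i. ?f (i + Suc j)"] by (simp add: add.commute)
  qed
  with abs\<theta> show ?thesis
    by (rule that)
qed

section \<open>Normalized Szego kernels\<close>

definition normalized_szego :: "complex \<Rightarrow> complex \<Rightarrow> complex" where
  "normalized_szego w z = of_real (sqrt (1 - (cmod w)\<^sup>2)) / (1 - cnj w * z)"

lemma normalized_szego_holomorphic: "cmod w < 1 \<Longrightarrow> normalized_szego w holomorphic_on ball 0 1"
  unfolding normalized_szego_def by (intro holomorphic_intros) (auto simp: cnj_mult_neq_1)

lemma normalized_szego_bound:
  assumes w: "cmod w < 1" and z: "cmod z \<le> \<rho>" and \<rho>: "\<rho> < 1"
  shows "cmod (normalized_szego w z) \<le> 1 / (1 - \<rho>)"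
proof -
  have "cmod w * cmod z \<le> 1 * \<rho>"
    using assms by (intro mult_mono) auto
  then have "1 - \<rho> \<le> cmod (1 - cnj w * z)"
    using norm_triangle_ineq2[of 1 "cnj w * z"] by (simp add: norm_mult)
  moreover have "sqrt (1 - (cmod w)\<^sup>2) \<le> 1"
    by simp
  moreover have "0 \<le> 1 - (cmod w)\<^sup>2"
    using w by (simp add: power_le_one)
  ultimately show ?thesis
    unfolding normalized_szego_def norm_divide using \<rho> by (intro frac_le) auto
qed

text \<open>On the circle of radius r the squared modulus is the Poisson kernel at r w times (1 -
  |w|^2) / (1 - |r w|^2), and this factor is at most 1.\<close>

lemma normalized_szego_Hardy_norm:
  assumes w: "cmod w < 1" and r: "0 \<le> r" "r < 1"
  shows "integral\<^sup>L circ (\<lambda>t. (cmod (normalized_szego w (of_real r * cis t)))\<^sup>2) \<le> 1"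
proof -
  define u where "u = of_real r * w"
  have ru: "cmod u = r * cmod w"
    using r by (simp add: u_def norm_mult)
  have le: "r * cmod w \<le> cmod w"
    using r by (simp add: mult_left_le_one_le)
  then have u: "cmod u < 1" "cmod u \<le> cmod w"
    using w ru by auto
  have u2: "(cmod u)\<^sup>2 \<le> (cmod w)\<^sup>2" "(cmod u)\<^sup>2 < 1" "(cmod w)\<^sup>2 < 1"
    using u w by (auto intro: power_mono simp: power_less_one_iff)
  have "(cmod (normalized_szego w (of_real r * cis t)))\<^sup>2 = (1 - (cmod w)\<^sup>2) / (1 - (cmod u)\<^sup>2) * poisson_kernel u t" for t
  proof -
    have f1: "cmod (1 - cnj (cis t) * u) = cmod (cis t - u)"
      by (rule cmod_one_minus_cnj_mult) simp
    have f2: "1 - cnj w * (of_real r * cis t) = cnj (1 - cnj (cis t) * u)"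
      by (simp add: u_def mult_ac)
    have "cmod (1 - cnj w * (of_real r * cis t)) = cmod (cis t - u)"
      unfolding f2 complex_mod_cnj by (rule f1)
    then show ?thesis
      unfolding normalized_szego_def poisson_kernel_def norm_divide power_divide using u2 by simp
  qed
  then have "integral\<^sup>L circ (\<lambda>t. (cmod (normalized_szego w (of_real r * cis t)))\<^sup>2) = (1 - (cmod w)\<^sup>2) / (1 - (cmod u)\<^sup>2)"
    using integral_poisson_kernel[OF u(1)] by (simp only: integral_mult_right_zero mult_1_right)
  also have "\<dots> \<le> 1"
    using u2 by simp
  finally show ?thesis .
qed

text \<open>The left side is the modulus of the inner product of two unit vectors. The bound follows
  from |1 - cnj w v|^2 - (1 - |w|^2)(1 - |v|^2) = |w - v|^2.\<close>

lemma normalized_szego_correlation: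
  assumes w: "cmod w < 1" and v: "cmod v < 1"
  shows "cmod (normalized_szego w v * of_real (sqrt (1 - (cmod v)\<^sup>2))) \<le> 1"
proof -
  have w2: "0 \<le> 1 - (cmod w)\<^sup>2" and v2: "0 \<le> 1 - (cmod v)\<^sup>2"
    using w v by (auto simp: power_le_one)
  have id: "(cmod (1 - cnj w * v))\<^sup>2 - (1 - (cmod w)\<^sup>2) * (1 - (cmod v)\<^sup>2) = (cmod (w - v))\<^sup>2"
    unfolding cmod_power2 by (simp add: power2_eq_square algebra_simps)
  have "(1 - (cmod w)\<^sup>2) * (1 - (cmod v)\<^sup>2) \<le> (cmod (1 - cnj w * v))\<^sup>2"
    using id zero_le_power2[of "cmod (w - v)"] by linarith
  then have "sqrt ((1 - (cmod w)\<^sup>2) * (1 - (cmod v)\<^sup>2)) \<le> cmod (1 - cnj w * v)"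
    by (intro real_le_lsqrt) auto
  moreover have "1 - cnj w * v \<noteq> 0"
    using w v by (intro one_minus_cnj_mult_neq_0) auto
  ultimately show ?thesis
    using w2 v2 by (simp add: normalized_szego_def norm_mult norm_divide real_sqrt_mult)
qed

lemma normalized_szego_series_in_H2:
  fixes \<theta> :: "nat \<Rightarrow> real"
  assumes w: "\<And>j. cmod (w j) < 1" and \<theta>: "\<And>i. \<bar>\<theta> i\<bar> = (1/3) ^ i"
  shows "(\<lambda>z. \<Sum>j. of_real (\<theta> j) * normalized_szego (w j) z) \<in> H2"
    and "cmod z < 1 \<Longrightarrow> summable (\<lambda>j. of_real (\<theta> j) * normalized_szego (w j) z)"
proof -
  define h where "h N z = (\<Sum>j<N. of_real (\<theta> j) * normalized_szego (w j) z)" for N z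
  have geo: "summable (\<lambda>i. (1/3 :: real) ^ i)"
    by (rule summable_geometric) simp
  have term_le: "cmod (of_real (\<theta> j) * normalized_szego (w j) z) \<le> (1/3) ^ j * (1 / (1 - \<rho>))" if "cmod z \<le> \<rho>" "\<rho> < 1" for j z \<rho>
    unfolding norm_mult norm_of_real \<theta> by (intro mult_left_mono normalized_szego_bound[OF w that]) simp
  show "summable (\<lambda>j. of_real (\<theta> j) * normalized_szego (w j) z)" if "cmod z < 1" for z
    by (rule summable_comparison_test'[OF summable_mult2[OF geo, of "1 / (1 - cmod z)"], of 0]) (use term_le[of z "cmod z"] that in auto)
  have unif: "uniform_limit (cball 0 \<rho>) h (\<lambda>z. \<Sum>j. of_real (\<theta> j) * normalized_szego (w j) z) sequentially" if \<rho>: "\<rho> < 1" for \<rho>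
    unfolding h_def
    by (rule Weierstrass_m_test[OF _ summable_mult2[OF geo, of "1 / (1 - \<rho>)"]]) (use term_le \<rho> in auto)
  have hh: "h N holomorphic_on ball 0 1" for N
    unfolding h_def by (intro holomorphic_intros normalized_szego_holomorphic w)
  have hol: "(\<lambda>z. \<Sum>j. of_real (\<theta> j) * normalized_szego (w j) z) holomorphic_on ball 0 1"
  proof (rule holomorphic_uniform_sequence[OF open_ball hh])
    fix x :: complex assume x: "x \<in> ball 0 1"
    define d where "d = (1 - cmod x) / 2"
    have sub: "cball x d \<subseteq> cball 0 ((1 + cmod x) / 2)"
    proof
      fix y assume "y \<in> cball x d"
      then have "cmod (x - y) \<le> d"
        by (simp add: dist_norm)
      then show "y \<in> cball 0 ((1 + cmod x) / 2)"
        using norm_triangle_ineq2[of y x] by (simp add: d_def norm_minus_commute) 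
    qed
    have lt: "(1 + cmod x) / 2 < 1"
      using x by simp
    show "\<exists>d>0. cball x d \<subseteq> ball 0 1 \<and> uniform_limit (cball x d) h (\<lambda>z. \<Sum>j. of_real (\<theta> j) * normalized_szego (w j) z) sequentially"
    proof (intro exI[of _ d] conjI)
      show "0 < d"
        using x by (simp add: d_def)
      show "cball x d \<subseteq> ball 0 1"
        using sub lt by (force dest: subsetD)
      show "uniform_limit (cball x d) h (\<lambda>z. \<Sum>j. of_real (\<theta> j) * normalized_szego (w j) z) sequentially"
        by (rule uniform_limit_on_subset[OF unif[OF lt] sub])
    qed
  qed
  have geoN: "(\<Sum>j<N. (1/3 :: real) ^ j) \<le> 2" for N
  proof -
    have "(\<Sum>j<N. (1/3 :: real) ^ j) \<le> (\<Sum>j. (1/3) ^ j)"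
      by (rule sum_le_suminf[OF geo]) auto
    also have "\<dots> = 1 / (1 - 1/3)"
      by (rule suminf_geometric) simp
    finally show ?thesis
      by simp
  qed
  have "integral\<^sup>L circ (\<lambda>t. (cmod (\<Sum>j. of_real (\<theta> j) * normalized_szego (w j) (of_real r * cis t)))\<^sup>2) \<le> 4" if r: "r \<in> {0..<1}" for r
  proof (rule tendsto_upperbound)
    have r': "cmod (of_real r) < 1" "0 \<le> r" "r < 1"
      using r by auto
    have hc: "continuous_on UNIV (\<lambda>t. h N (of_real r * cis t))" for N
      by (rule continuous_on_circle_of_ball[OF hh r'(1)])
    show "(\<lambda>N. integral\<^sup>L circ (\<lambda>t. (cmod (h N (of_real r * cis t)))\<^sup>2)) \<longlonglongrightarrow>
       integral\<^sup>L circ (\<lambda>t. (cmod (\<Sum>j. of_real (\<theta> j) * normalized_szego (w j) (of_real r * cis t)))\<^sup>2)"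
    proof (rule integral_dominated_convergence[where w = "\<lambda>_. (2 * (1 / (1 - r)))\<^sup>2"])
      have "(\<lambda>t. (cmod (\<Sum>j. of_real (\<theta> j) * normalized_szego (w j) (of_real r * cis t)))\<^sup>2) \<in> borel_measurable borel"
        by (intro borel_measurable_continuous_onI continuous_intros continuous_on_circle_of_ball[OF hol r'(1)])
      then show "(\<lambda>t. (cmod (\<Sum>j. of_real (\<theta> j) * normalized_szego (w j) (of_real r * cis t)))\<^sup>2) \<in> borel_measurable circ"
        by simp
      have "(\<lambda>t. (cmod (h N (of_real r * cis t)))\<^sup>2) \<in> borel_measurable borel" for N
        by (intro borel_measurable_continuous_onI continuous_intros hc)
      then show "(\<lambda>t. (cmod (h N (of_real r * cis t)))\<^sup>2) \<in> borel_measurable circ" for N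
        by simp
      show "AE t in circ. (\<lambda>N. (cmod (h N (of_real r * cis t)))\<^sup>2) \<longlonglongrightarrow> (cmod (\<Sum>j. of_real (\<theta> j) * normalized_szego (w j) (of_real r * cis t)))\<^sup>2"
      proof (intro AE_I2 tendsto_intros)
        fix t
        show "(\<lambda>N. h N (of_real r * cis t)) \<longlonglongrightarrow> (\<Sum>j. of_real (\<theta> j) * normalized_szego (w j) (of_real r * cis t))"
          by (rule tendsto_uniform_limitI[OF unif[OF r'(3)]]) (use r' in \<open>simp add: norm_mult\<close>)
      qed
      show "AE t in circ. norm ((cmod (h N (of_real r * cis t)))\<^sup>2) \<le> (2 * (1 / (1 - r)))\<^sup>2" for N
      proof (rule AE_I2)
        fix t
        have "cmod (h N (of_real r * cis t)) \<le> (\<Sum>j<N. (1/3) ^ j * (1 / (1 - r)))"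
          unfolding h_def by (rule order_trans[OF norm_sum], rule sum_mono, rule term_le) (use r' in \<open>auto simp: norm_mult\<close>)
        also have "\<dots> \<le> 2 * (1 / (1 - r))"
          unfolding sum_distrib_right[symmetric] using r' by (intro mult_right_mono geoN) auto
        finally show "norm ((cmod (h N (of_real r * cis t)))\<^sup>2) \<le> (2 * (1 / (1 - r)))\<^sup>2"
          by (simp add: power_mono)
      qed
    qed simp
    show "eventually (\<lambda>N. integral\<^sup>L circ (\<lambda>t. (cmod (h N (of_real r * cis t)))\<^sup>2) \<le> 4) sequentially"
    proof (rule always_eventually, rule allI)
      fix N
      have kc: "continuous_on UNIV (\<lambda>t. normalized_szego (w j) (of_real r * cis t))" for j
        by (rule continuous_on_circle_of_ball[OF normalized_szego_holomorphic[OF w] r'(1)])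
      have ki: "integrable circ (\<lambda>t. (1/3) ^ j * (cmod (normalized_szego (w j) (of_real r * cis t)))\<^sup>2)" for j
        by (intro integrable_circ_continuous continuous_intros kc)
      have "integral\<^sup>L circ (\<lambda>t. (cmod (h N (of_real r * cis t)))\<^sup>2) \<le>
         integral\<^sup>L circ (\<lambda>t. 2 * (\<Sum>j<N. (1/3) ^ j * (cmod (normalized_szego (w j) (of_real r * cis t)))\<^sup>2))"
      proof (rule integral_mono)
        show "integrable circ (\<lambda>t. (cmod (h N (of_real r * cis t)))\<^sup>2)"
          by (intro integrable_circ_continuous continuous_intros hc)
        show "integrable circ (\<lambda>t. 2 * (\<Sum>j<N. (1/3) ^ j * (cmod (normalized_szego (w j) (of_real r * cis t)))\<^sup>2))"
          by (intro integrable_circ_continuous continuous_intros kc)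
        fix t
        let ?k = "\<lambda>j. cmod (normalized_szego (w j) (of_real r * cis t))"
        \<comment> \<open>Each weight is shared evenly between the two factors of Cauchy-Schwarz.
          One factor is a geometric sum; the other integrates to at most such a sum because the
          kernels are normalized. Both are at most 2, whence the bound 4.\<close>
        have "cmod (h N (of_real r * cis t)) \<le> (\<Sum>j<N. sqrt ((1/3) ^ j) * (sqrt ((1/3) ^ j) * ?k j))"
          unfolding h_def by (rule order_trans[OF norm_sum]) (simp add: norm_mult \<theta> flip: mult.assoc)
        then have "(cmod (h N (of_real r * cis t)))\<^sup>2 \<le> (\<Sum>j<N. sqrt ((1/3) ^ j) * (sqrt ((1/3) ^ j) * ?k j))\<^sup>2"
          by (intro power_mono) auto
        also have "\<dots> \<le> (\<Sum>j<N. (sqrt ((1/3) ^ j))\<^sup>2) * (\<Sum>j<N. (sqrt ((1/3) ^ j) * ?k j)\<^sup>2)"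
          by (rule Cauchy_Schwarz_ineq_sum)
        also have "\<dots> = (\<Sum>j<N. (1/3) ^ j) * (\<Sum>j<N. (1/3) ^ j * (?k j)\<^sup>2)"
          by (simp add: power_mult_distrib)
        also have "\<dots> \<le> 2 * (\<Sum>j<N. (1/3) ^ j * (?k j)\<^sup>2)"
          by (intro mult_right_mono geoN sum_nonneg) auto
        finally show "(cmod (h N (of_real r * cis t)))\<^sup>2 \<le> 2 * (\<Sum>j<N. (1/3) ^ j * (?k j)\<^sup>2)" .
      qed
      also have "\<dots> = 2 * (\<Sum>j<N. (1/3) ^ j * integral\<^sup>L circ (\<lambda>t. (cmod (normalized_szego (w j) (of_real r * cis t)))\<^sup>2))"
        using ki by (simp only: integral_mult_right_zero Bochner_Integration.integral_sum)
      also have "\<dots> \<le> 2 * (\<Sum>j<N. (1/3) ^ j * 1)"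
        using r' by (intro mult_left_mono sum_mono normalized_szego_Hardy_norm w) auto
      also have "\<dots> \<le> 4"
        using geoN[of N] by simp
      finally show "integral\<^sup>L circ (\<lambda>t. (cmod (h N (of_real r * cis t)))\<^sup>2) \<le> 4" .
    qed
  qed simp
  then show "(\<lambda>z. \<Sum>j. of_real (\<theta> j) * normalized_szego (w j) z) \<in> H2"
    unfolding H2_iff by (intro conjI hol exI[of _ 4] ballI)
qed

text \<open>The closed graph theorem, by hand: a failure of the bound at points \<open>w j\<close> with factors
  \<open>81 ^ j\<close> yields a multiplier \<open>h\<close> that violates membership.\<close>

lemma multiples_in_deBR_bound:
  assumes b: "b \<in> Hinf_ball" and mem: "\<And>h. h \<in> H2 \<Longrightarrow> (\<lambda>z. p z * h z) \<in> deBR b"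
  obtains C where "0 \<le> C" "\<And>w. cmod w < 1 \<Longrightarrow> (cmod (p w))\<^sup>2 \<le> C * (1 - (cmod (b w))\<^sup>2)"
proof -
  have b1: "(cmod (b z))\<^sup>2 \<le> 1" if "cmod z < 1" for z
    using b that by (auto simp: Hinf_ball_def power_le_one)
  have "\<exists>C\<ge>0. \<forall>w. cmod w < 1 \<longrightarrow> (cmod (p w))\<^sup>2 \<le> C * (1 - (cmod (b w))\<^sup>2)"
  proof (rule ccontr)
    assume neg: "\<not> ?thesis"
    \<comment> \<open>The hump enters squared, as 9^(-j) / 4; growth by 81^j leaves 9^j / 4, which
      no constant can dominate.\<close>
    have "\<exists>w. cmod w < 1 \<and> 81 ^ j * (1 - (cmod (b w))\<^sup>2) < (cmod (p w))\<^sup>2" for j :: nat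
      using neg by (auto simp: not_le dest: spec[of _ "81 ^ j"])
    then obtain w where w: "\<And>j. cmod (w j) < 1" and big: "\<And>j. 81 ^ j * (1 - (cmod (b (w j)))\<^sup>2) < (cmod (p (w j)))\<^sup>2"
      by metis
    define s where "s j = sqrt (1 - (cmod (w j))\<^sup>2)" for j
    have w2: "0 < 1 - (cmod (w j))\<^sup>2" for j
      using w[of j] by (simp add: power_less_one_iff)
    have s2: "s j * s j = 1 - (cmod (w j))\<^sup>2" for j
      using w2[of j] by (simp add: s_def)
    \<comment> \<open>The inner product of the normalized kernels at \<open>w i\<close> and
      \<open>w j\<close>, so a large column sum means a large value of h at \<open>w j\<close>
      relative to the size of the kernel there.\<close>
    define A where "A i j = normalized_szego (w i) (w j) * of_real (s j)" for i j
    have A1: "cmod (A i j) \<le> 1" for i j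
      unfolding A_def s_def by (rule normalized_szego_correlation[OF w w])
    have Ad: "A j j = 1" for j
    proof -
      have "A j j = of_real (s j * s j) / (1 - cnj (w j) * w j)"
        by (simp add: A_def normalized_szego_def s_def[symmetric])
      also have "1 - cnj (w j) * w j = of_real (s j * s j)"
        unfolding s2 using complex_norm_square[of "w j"] by (simp add: mult.commute)
      finally have quot: "A j j = of_real (s j * s j) / of_real (s j * s j)" .
      have ne: "complex_of_real (s j * s j) \<noteq> 0"
        using w2[of j] unfolding s2 of_real_eq_0_iff by linarith
      show ?thesis
        unfolding quot by (rule divide_self[OF ne])
    qed
    obtain \<theta> :: "nat \<Rightarrow> real" where \<theta>: "\<And>i. \<bar>\<theta> i\<bar> = (1/3) ^ i" and hump: "\<And>j. (1/3) ^ j / 2 \<le> cmod (\<Sum>i. of_real (\<theta> i) * A i j)"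
      using gliding_hump[of A, OF A1 Ad] by blast
    define h where "h z = (\<Sum>j. of_real (\<theta> j) * normalized_szego (w j) z)" for z
    have hH: "h \<in> H2"
      unfolding h_def by (rule normalized_szego_series_in_H2[OF w \<theta>])
    obtain C where C: "\<And>(n::nat) (v::nat \<Rightarrow> complex) (c::nat \<Rightarrow> complex). \<forall>i<n. v i \<in> ball 0 1 \<Longrightarrow>
       (cmod (\<Sum>i<n. cnj (c i) * (p (v i) * h (v i))))^2 \<le> C * Re (\<Sum>i<n. \<Sum>j<n. cnj (c i) * c j * kb b (v j) (v i))"
      using mem[OF hH] unfolding deBR_def by blast
    \<comment> \<open>The constant in \<open>deBR\<close> comes without a sign, and the estimates
      below multiply by it.\<close>
    define C' where "C' = max C 0"
    have "9 ^ j \<le> 4 * C'" for j :: nat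
    proof -
      let ?B = "1 - (cmod (b (w j)))\<^sup>2" and ?P = "(cmod (p (w j)))\<^sup>2"
      have B0: "0 \<le> ?B"
        using b1[OF w, of j] by simp
      have "(\<Sum>i. of_real (\<theta> i) * A i j) = (\<Sum>i. (of_real (\<theta> i) * normalized_szego (w i) (w j)) * of_real (s j))"
        by (simp add: A_def mult.assoc)
      also have "\<dots> = h (w j) * of_real (s j)"
        unfolding h_def by (rule suminf_mult2[symmetric, OF normalized_szego_series_in_H2(2)[OF w \<theta> w]])
      finally have "(1/3) ^ j / 2 \<le> cmod (h (w j) * of_real (s j))"
        using hump[of j] by simp
      then have "((1/3) ^ j / 2)\<^sup>2 \<le> (cmod (h (w j) * of_real (s j)))\<^sup>2"
        by (intro power_mono) auto
      also have "\<dots> = (cmod (h (w j)))\<^sup>2 * (1 - (cmod (w j))\<^sup>2)"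
        unfolding s2[symmetric] by (simp add: norm_mult power_mult_distrib power2_eq_square)
      finally have hs: "((1/3) ^ j / 2)\<^sup>2 \<le> (cmod (h (w j)))\<^sup>2 * (1 - (cmod (w j))\<^sup>2)" .
      have "kb b (w j) (w j) = of_real (?B / (1 - (cmod (w j))\<^sup>2))"
        using complex_norm_square[of "w j"] complex_norm_square[of "b (w j)"]
        by (simp add: kb_def mult.commute)
      \<comment> \<open>Kernel domination is tested on the single point \<open>w j\<close>; this is
        the pointwise growth bound for the space.\<close>
      then have "(cmod (p (w j) * h (w j)))\<^sup>2 \<le> C * (?B / (1 - (cmod (w j))\<^sup>2))"
        using C[of 1 "\<lambda>_. w j" "\<lambda>_. 1"] w[of j] by simp
      also have "\<dots> \<le> C' * (?B / (1 - (cmod (w j))\<^sup>2))"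
        using B0 w2[of j] by (intro mult_right_mono) (auto simp: C'_def)
      finally have "?P * ((cmod (h (w j)))\<^sup>2 * (1 - (cmod (w j))\<^sup>2)) \<le> C' * ?B"
        using w2[of j] by (simp add: norm_mult power_mult_distrib field_simps)
      then have "?P * ((1/3) ^ j / 2)\<^sup>2 \<le> C' * ?B"
        using mult_left_mono[OF hs, of ?P] by simp
      then have "81 ^ j * (?P * ((1/3) ^ j / 2)\<^sup>2) \<le> 81 ^ j * (C' * ?B)"
        by (intro mult_left_mono) auto
      also have "\<dots> \<le> C' * ?P"
        using mult_left_mono[OF less_imp_le[OF big[of j]], of C'] by (simp add: C'_def mult_ac)
      also have "81 ^ j * (?P * ((1/3) ^ j / 2)\<^sup>2) = (9 ^ j / 4) * ?P"
      proof -
        have "(81::real) ^ j * ((1/3) ^ j / 2)\<^sup>2 = 9 ^ j / 4"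
          by (simp add: power2_eq_square flip: power_mult_distrib)
        then show ?thesis
          by (metis mult.assoc mult.commute)
      qed
      finally have "(9 ^ j / 4) * ?P \<le> C' * ?P" .
      moreover have "0 < ?P"
        using big[of j] B0 by (meson le_less_trans mult_nonneg_nonneg zero_le_numeral zero_le_power)
      ultimately show ?thesis
        by simp
    qed
    moreover obtain j :: nat where "4 * C' < 9 ^ j"
      using real_arch_pow[of 9 "4 * C'"] by auto
    ultimately show False
      using not_le by blast
  qed
  then show ?thesis
    using that by blast
qed

subsection \<open>The equivalences\<close>

text \<open>This sum is the potential times |p|^2 with denominators cleared. It has no zeros: at a
  point of Z the summand that omits this point survives, and elsewhere every summand is positive.
  Compactness of the closed disk gives both bounds.\<close>

lemma cofactor_sum_bounds:
  assumes Z: "finite Z" "Z \<noteq> {}"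
  obtains c1 c2 :: real where "0 < c1" "0 < c2"
    "\<And>z. cmod z \<le> 1 \<Longrightarrow> c1 \<le> (\<Sum>\<zeta>\<in>Z. \<Prod>\<eta>\<in>Z - {\<zeta>}. (cmod (z - \<eta>))\<^sup>2)"
    "\<And>z. cmod z \<le> 1 \<Longrightarrow> (\<Sum>\<zeta>\<in>Z. \<Prod>\<eta>\<in>Z - {\<zeta>}. (cmod (z - \<eta>))\<^sup>2) \<le> c2"
proof -
  define W where "W z = (\<Sum>\<zeta>\<in>Z. \<Prod>\<eta>\<in>Z - {\<zeta>}. (cmod (z - \<eta>))\<^sup>2)" for z
  have Wc: "continuous_on (cball 0 1) W"
    unfolding W_def by (intro continuous_intros)
  have Wpos: "0 < W z" for z
  proof -
    obtain \<zeta> where \<zeta>: "\<zeta> \<in> Z" "z \<in> Z \<Longrightarrow> \<zeta> = z"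
      using Z(2) by blast
    have "0 < (\<Prod>\<eta>\<in>Z - {\<zeta>}. (cmod (z - \<eta>))\<^sup>2)"
      using \<zeta> by (intro prod_pos) auto
    also have "\<dots> \<le> W z"
      unfolding W_def by (rule member_le_sum) (use \<zeta> Z in \<open>auto intro: prod_nonneg\<close>)
    finally show ?thesis .
  qed
  obtain x where x: "x \<in> cball 0 1" "\<And>y. y \<in> cball 0 1 \<Longrightarrow> W x \<le> W y"
    using continuous_attains_inf[OF _ _ Wc] by auto
  obtain y where y: "y \<in> cball 0 1" "\<And>z. z \<in> cball 0 1 \<Longrightarrow> W z \<le> W y"
    using continuous_attains_sup[OF _ _ Wc] by auto
  show ?thesis
    by (rule that[of "W x" "W y"]) (use x y Wpos in \<open>auto simp: W_def[symmetric]\<close>)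
qed

lemma potential_mult_zeros:
  assumes Z: "finite Z" and z: "z \<notin> Z"
  shows "potential_pts Z z * (cmod (\<Prod>\<zeta>\<in>Z. z - \<zeta>))\<^sup>2 = (\<Sum>\<zeta>\<in>Z. \<Prod>\<eta>\<in>Z - {\<zeta>}. (cmod (z - \<eta>))\<^sup>2)"
  unfolding potential_pts_def sum_distrib_right
proof (rule sum.cong[OF refl])
  fix \<zeta> assume \<zeta>: "\<zeta> \<in> Z"
  have "cmod (z - \<zeta>) \<noteq> 0"
    using \<zeta> z by auto
  moreover have "(cmod (\<Prod>\<zeta>\<in>Z. z - \<zeta>))\<^sup>2 = (cmod (z - \<zeta>))\<^sup>2 * (\<Prod>\<eta>\<in>Z - {\<zeta>}. (cmod (z - \<eta>))\<^sup>2)"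
    using prod.remove[OF Z \<zeta>, of "\<lambda>\<eta>. (cmod (z - \<eta>))\<^sup>2"] by (simp add: prod_norm prod_power_distrib flip: prod_norm)
  ultimately show "1 / (cmod (z - \<zeta>))\<^sup>2 * (cmod (\<Prod>\<zeta>\<in>Z. z - \<zeta>))\<^sup>2 = (\<Prod>\<eta>\<in>Z - {\<zeta>}. (cmod (z - \<eta>))\<^sup>2)"
    by simp
qed

lemma INF_pos_iff:
  fixes f :: "complex \<Rightarrow> real"
  assumes "\<And>z. z \<in> ball 0 1 \<Longrightarrow> 0 \<le> f z"
  shows "0 < (INF z\<in>ball 0 1. f z) \<longleftrightarrow> (\<exists>m>0. \<forall>z\<in>ball 0 1. m \<le> f z)"
proof
  assume pos: "0 < (INF z\<in>ball 0 1. f z)"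
  have "bdd_below (f ` ball 0 1)"
    using assms by (intro bdd_belowI[of _ 0]) auto
  with pos show "\<exists>m>0. \<forall>z\<in>ball 0 1. m \<le> f z"
    by (meson cINF_lower)
next
  assume "\<exists>m>0. \<forall>z\<in>ball 0 1. m \<le> f z"
  then obtain m where m: "m > 0" "\<And>z. z \<in> ball 0 1 \<Longrightarrow> m \<le> f z"
    by blast
  have "m \<le> (INF z\<in>ball 0 1. f z)"
    by (rule cINF_greatest) (use m in auto)
  with m(1) show "0 < (INF z\<in>ball 0 1. f z)"
    by simp
qed

theorem theoremB:
  fixes b a :: "complex \<Rightarrow> complex" and Z :: "complex set"
  assumes "b \<in> Hinf_ball" and "non_extreme b" and "Hinf_norm b = 1"
    and "pythagorean_mate b a"
    and "finite Z" and "Z \<noteq> {}" and "Z \<subseteq> sphere 0 1"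
  shows "(Dmu Z \<subseteq> deBR b \<longleftrightarrow>
           (\<exists>g. g holomorphic_on ball 0 1 \<and> (INF z\<in>ball 0 1. cmod (g z)) > 0 \<and>
                (\<forall>z\<in>ball 0 1. a z = (\<Prod>\<zeta>\<in>Z. z - \<zeta>) * g z)))
       \<and> (Dmu Z \<subseteq> deBR b \<longleftrightarrow>
           (INF z\<in>ball 0 1. (cmod (a z))^2 * potential_pts Z z) > 0)"
proof -
  define p where "p z = (\<Prod>\<zeta>\<in>Z. z - \<zeta>)" for z
  have ah: "a holomorphic_on ball 0 1"
    by (rule mate_holomorphic[OF assms(4)])
  have ab: "(cmod (a z))\<^sup>2 + (cmod (b z))\<^sup>2 \<le> 1" if "cmod z < 1" for z
    by (rule mate_Pythagorean_le[OF assms(1) assms(4) that])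
  have a0: "a 0 \<noteq> 0"
    using assms(4) by (auto simp: pythagorean_mate_def)
  have pp: "p = poly (zeros_poly Z)"
    by (auto simp: p_def poly_zeros_poly)
  have ph: "p holomorphic_on S" for S
    unfolding pp by (rule poly_holomorphic)
  have notZ: "z \<notin> Z" if "z \<in> ball 0 1" for z
    using assms(7) that by auto
  have p0: "p z \<noteq> 0" if "z \<in> ball 0 1" for z
    using notZ[OF that] assms(5) by (auto simp: p_def)
  have A_imp: "\<exists>K>0. \<forall>z\<in>ball 0 1. cmod (p z) \<le> K * cmod (a z)" if A: "Dmu Z \<subseteq> deBR b"
  proof -
    have mem: "(\<lambda>z. p z * h z) \<in> deBR b" if "h \<in> H2" for h
      using zeros_mult_H2_in_Dmu[OF assms(5,7) that] A by (auto simp: p_def)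
    obtain C where C: "0 \<le> C" "\<And>w. cmod w < 1 \<Longrightarrow> (cmod (p w))\<^sup>2 \<le> C * (1 - (cmod (b w))\<^sup>2)"
      using multiples_in_deBR_bound[OF assms(1) mem] by blast
    have le: "cmod (p z) \<le> sqrt C * cmod (a z)" if "z \<in> ball 0 1" for z
      by (rule dominated_by_mate[OF assms(1,4) ph C]) (use that in auto)
    \<comment> \<open>Adding 1 makes the constant strictly positive, which C >= 0 alone does not
      ensure.\<close>
    have "cmod (p z) \<le> (sqrt C + 1) * cmod (a z)" if "z \<in> ball 0 1" for z
      using le[OF that] by (simp add: distrib_right) (meson add_increasing2 norm_ge_zero)
    then show ?thesis
      using C(1) by (intro exI[of _ "sqrt C + 1"]) (auto intro: add_nonneg_pos)
  qed
  have imp_A: "Dmu Z \<subseteq> deBR b" if K: "\<And>z. z \<in> ball 0 1 \<Longrightarrow> cmod (p z) \<le> K * cmod (a z)" for K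
  proof
    fix f assume f: "f \<in> Dmu Z"
    have an0: "a z \<noteq> 0" if "z \<in> ball 0 1" for z
      using K[OF that] p0[OF that] by auto
    obtain q h where h: "h \<in> H2" and fq: "\<And>z. z \<in> ball 0 1 \<Longrightarrow> f z = poly q z + p z * h z"
      using Dmu_decomposition[OF assms(5,7), of f] Dmu_subset_singleton[OF assms(5)] f unfolding pp Dmu_def by blast
    have "(\<lambda>z. p z / a z * h z) \<in> H2"
    proof (rule H2_mult_bounded[OF h, of _ K])
      show "(\<lambda>z. p z / a z) holomorphic_on ball 0 1"
        using an0 by (intro holomorphic_intros ph ah) auto
      show "cmod (p z / a z) \<le> K" if "cmod z < 1" for z
        using K[of z] an0[of z] that by (simp add: norm_divide pos_divide_le_eq)
    qed
    then have "(\<lambda>z. a z * (p z / a z * h z)) \<in> deBR b"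
      using ab by (intro mate_times_H2_in_deBR[OF assms(1) ah])
    moreover have "poly q \<in> deBR b"
      using ab by (intro poly_in_deBR[OF assms(1) ah _ a0])
    ultimately have "(\<lambda>z. poly q z + a z * (p z / a z * h z)) \<in> deBR b"
      by (intro deBR_add)
    then show "f \<in> deBR b"
      by (rule deBR_cong) (simp add: fq an0)
  qed
  have A_iff: "Dmu Z \<subseteq> deBR b \<longleftrightarrow> (\<exists>K>0. \<forall>z\<in>ball 0 1. cmod (p z) \<le> K * cmod (a z))"
    using A_imp imp_A by blast
  have B_iff: "(\<exists>g. g holomorphic_on ball 0 1 \<and> (INF z\<in>ball 0 1. cmod (g z)) > 0 \<and> (\<forall>z\<in>ball 0 1. a z = p z * g z)) \<longleftrightarrow>
     (\<exists>K>0. \<forall>z\<in>ball 0 1. cmod (p z) \<le> K * cmod (a z))"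
  proof
    assume "\<exists>g. g holomorphic_on ball 0 1 \<and> (INF z\<in>ball 0 1. cmod (g z)) > 0 \<and> (\<forall>z\<in>ball 0 1. a z = p z * g z)"
    then obtain g where g: "0 < (INF z\<in>ball 0 1. cmod (g z))" and ag: "\<And>z. z \<in> ball 0 1 \<Longrightarrow> a z = p z * g z"
      by blast
    obtain m where m: "m > 0" "\<And>z. z \<in> ball 0 1 \<Longrightarrow> m \<le> cmod (g z)"
      using g INF_pos_iff[of "\<lambda>z. cmod (g z)"] by auto
    have "cmod (p z) \<le> 1 / m * cmod (a z)" if "z \<in> ball 0 1" for z
      using mult_left_mono[OF m(2)[OF that], of "cmod (p z)"] m(1) by (simp add: ag[OF that] norm_mult field_simps)
    with m(1) show "\<exists>K>0. \<forall>z\<in>ball 0 1. cmod (p z) \<le> K * cmod (a z)"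
      by (intro exI[of _ "1 / m"]) auto
  next
    assume "\<exists>K>0. \<forall>z\<in>ball 0 1. cmod (p z) \<le> K * cmod (a z)"
    then obtain K where K: "K > 0" "\<And>z. z \<in> ball 0 1 \<Longrightarrow> cmod (p z) \<le> K * cmod (a z)"
      by blast
    have "(\<lambda>z. a z / p z) holomorphic_on ball 0 1"
      using p0 by (intro holomorphic_intros ph ah) auto
    moreover have "0 < (INF z\<in>ball 0 1. cmod (a z / p z))"
    proof (subst INF_pos_iff, simp, intro exI[of _ "1 / K"] conjI ballI)
      fix z :: complex assume z: "z \<in> ball 0 1"
      then show "1 / K \<le> cmod (a z / p z)"
        using K(2)[OF z] K(1) p0[OF z] by (simp add: norm_divide field_simps)
    qed (use K in auto)
    ultimately show "\<exists>g. g holomorphic_on ball 0 1 \<and> (INF z\<in>ball 0 1. cmod (g z)) > 0 \<and> (\<forall>z\<in>ball 0 1. a z = p z * g z)"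
      using p0 by (intro exI[of _ "\<lambda>z. a z / p z"]) auto
  qed
  obtain c1 c2 where c: "0 < c1" "0 < c2"
    and c1: "\<And>z. cmod z \<le> 1 \<Longrightarrow> c1 \<le> (\<Sum>\<zeta>\<in>Z. \<Prod>\<eta>\<in>Z - {\<zeta>}. (cmod (z - \<eta>))\<^sup>2)"
    and c2: "\<And>z. cmod z \<le> 1 \<Longrightarrow> (\<Sum>\<zeta>\<in>Z. \<Prod>\<eta>\<in>Z - {\<zeta>}. (cmod (z - \<eta>))\<^sup>2) \<le> c2"
    using cofactor_sum_bounds[OF assms(5,6)] by blast
  have Vp: "c1 \<le> potential_pts Z z * (cmod (p z))\<^sup>2" "potential_pts Z z * (cmod (p z))\<^sup>2 \<le> c2" if "z \<in> ball 0 1" for z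
    using c1[of z] c2[of z] potential_mult_zeros[OF assms(5) notZ[OF that]] that by (auto simp: p_def)
  have V0: "0 \<le> potential_pts Z z" for z
    unfolding potential_pts_def by (intro sum_nonneg) auto
  have C_iff: "(INF z\<in>ball 0 1. (cmod (a z))^2 * potential_pts Z z) > 0 \<longleftrightarrow> (\<exists>K>0. \<forall>z\<in>ball 0 1. cmod (p z) \<le> K * cmod (a z))"
  proof
    assume "(INF z\<in>ball 0 1. (cmod (a z))^2 * potential_pts Z z) > 0"
    then obtain m where m: "m > 0" "\<And>z. z \<in> ball 0 1 \<Longrightarrow> m \<le> (cmod (a z))^2 * potential_pts Z z"
      by (subst (asm) INF_pos_iff) (auto simp: V0)
    have "cmod (p z) \<le> sqrt (c2 / m) * cmod (a z)" if z: "z \<in> ball 0 1" for z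
    proof -
      have "m * (cmod (p z))\<^sup>2 \<le> (cmod (a z))^2 * potential_pts Z z * (cmod (p z))\<^sup>2"
        by (intro mult_right_mono m(2)[OF z]) simp
      also have "\<dots> \<le> (cmod (a z))^2 * c2"
        using mult_left_mono[OF Vp(2)[OF z], of "(cmod (a z))^2"] by (simp add: mult.assoc)
      finally have "(cmod (p z))\<^sup>2 \<le> (sqrt (c2 / m) * cmod (a z))\<^sup>2"
        using m(1) c by (simp add: power_mult_distrib field_simps)
      then show ?thesis
        by (rule power2_le_imp_le) (use m(1) c in auto)
    qed
    then show "\<exists>K>0. \<forall>z\<in>ball 0 1. cmod (p z) \<le> K * cmod (a z)"
      using m(1) c by (intro exI[of _ "sqrt (c2 / m)"]) auto
  next
    assume "\<exists>K>0. \<forall>z\<in>ball 0 1. cmod (p z) \<le> K * cmod (a z)"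
    then obtain K where K: "K > 0" "\<And>z. z \<in> ball 0 1 \<Longrightarrow> cmod (p z) \<le> K * cmod (a z)"
      by blast
    show "(INF z\<in>ball 0 1. (cmod (a z))^2 * potential_pts Z z) > 0"
    proof (subst INF_pos_iff, simp add: V0, intro exI[of _ "c1 / K\<^sup>2"] conjI ballI)
      fix z :: complex assume z: "z \<in> ball 0 1"
      have "(cmod (p z))\<^sup>2 \<le> (K * cmod (a z))\<^sup>2"
        by (intro power_mono K(2)[OF z]) simp
      then have "potential_pts Z z * (cmod (p z))\<^sup>2 \<le> potential_pts Z z * (K * cmod (a z))\<^sup>2"
        by (intro mult_left_mono V0)
      with Vp(1)[OF z] have "c1 \<le> potential_pts Z z * (K * cmod (a z))\<^sup>2"
        by linarith
      then show "c1 / K\<^sup>2 \<le> (cmod (a z))^2 * potential_pts Z z"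
        using K(1) by (simp add: pos_divide_le_eq power_mult_distrib mult_ac)
    qed (use K c in auto)
  qed
  show ?thesis
    using A_iff B_iff C_iff unfolding p_def by blast
qed

end
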